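(* Let $d\ge 1$, $m\ge -d$, $\nu>0$, $L=-\Delta+|x|^2+m$ on $\mathbb{R}^d$, and let $\phi$ and $P_tf$ be as defined in the context. For every $f\in L^1(\phi)$ the function $u(t,x)=P_tf(x)$ is defined by an absolutely convergent integral for all $(t,x)\in(0,\infty)\times\mathbb{R}^d$, and it satisfies: (i) $u(t,x)\in C^\infty((0,\infty)\times\mathbb{R}^d)$; (ii) $u$ satisfies the partial differential equation $$u_{tt}+\frac{1-2\nu}{t}\,u_t=Lu,\qquad (t,x)\in(0,\infty)\times\mathbb{R}^d;$$ (iii) for a.e. $x\in\mathbb{R}^d$ it holds $\lim_{t\to0^+}u(t,x)=f(x)$. Conversely, if a (measurable) function $f\ge 0$ on $\mathbb{R}^d$ is such that the integral defining $P_tf(x)$ is finite for some $(t,x)\in(0,\infty)\times\mathbb{R}^d$, then $f\in L^1(\phi)$.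
   Context: Fix $d\ge1$, $m\ge -d$, $\nu>0$. The operator $L=-\Delta+|x|^2+m$ acts in the variable $x\in\mathbb{R}^d$. Its heat semigroup is $e^{-vL}f(x)=\int_{\mathbb{R}^d}h_v(x,y)f(y)\,dy$, $v>0$, with (positive) kernel $$h_v(x,y)=e^{-vm}\,[2\pi\sinh(2v)]^{-d/2}\,\exp\Big(-\frac{|x-y|^2}{2\tanh(2v)}-\tanh(v)\,x\cdot y\Big).$$ For measurable $f:\mathbb{R}^d\to\mathbb{C}$ the Poisson-like integral is $$P_tf(x)=\frac{t^{2\nu}}{4^\nu\Gamma(\nu)}\int_0^\infty e^{-\frac{t^2}{4u}}\,\big[e^{-uL}f\big](x)\,\frac{du}{u^{1+\nu}},\qquad t>0,\ x\in\mathbb{R}^d,$$ absolute convergence meaning that the same expression with $f$ replaced by $|f|$ is finite. The function $\phi:\mathbb{R}^d\to(0,\infty)$ is $$\phi(y)=\frac{e^{-|y|^2/2}}{(1+|y|)^{\frac{d+m}{2}}[\ln(e+|y|)]^{1+\nu}}\ \text{ if } m>-d,\qquad \phi(y)=\frac{e^{-|y|^2/2}}{[\ln(e+|y|)]^{\nu}}\ \text{ if } m=-d.$$ $L^1(\phi)$ denotes the space of measurable $f:\mathbb{R}^d\to\mathbb{C}$ with $\int_{\mathbb{R}^d}|f(y)|\phi(y)\,dy<\infty$. *)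

theory Defs
  imports "HOL-Analysis.Analysis"
begin

text \<open>
  Throughout, \<open>\<real>\<^sup>d\<close> is \<^typ>\<open>real ^ 'n\<close> with \<open>d = CARD('n)\<close>, and \<open>measurable\<close> means Lebesgue measurable.
\<close>

text \<open>
  The kernel \<open>h\<^sub>v(x,y)\<close> of \<open>e\<^sup>-\<^sup>v\<^sup>L\<close> (Mehler's formula), where \<open>L = -\<Delta> + |x|\<^sup>2 + m\<close>.
\<close>

definition heat_kernel :: "real \<Rightarrow> real \<Rightarrow> real ^ 'n \<Rightarrow> real ^ 'n \<Rightarrow> real" where
  "heat_kernel m v x y =
     exp (- (v * m)) * (2 * pi * sinh (2 * v)) powr (- (real CARD('n) / 2)) *
     exp (- ((norm (x - y))\<^sup>2 / (2 * tanh (2 * v))) - tanh v * (x \<bullet> y))"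

definition heat_semigroup :: "real \<Rightarrow> real \<Rightarrow> (real ^ 'n \<Rightarrow> complex) \<Rightarrow> real ^ 'n \<Rightarrow> complex" where
  "heat_semigroup m v f x = (\<integral>y. heat_kernel m v x y *\<^sub>R f y \<partial>lebesgue)"

definition poisson :: "real \<Rightarrow> real \<Rightarrow> (real ^ 'n \<Rightarrow> complex) \<Rightarrow> real \<Rightarrow> real ^ 'n \<Rightarrow> complex" where
  "poisson m \<nu> f t x =
     (t powr (2 * \<nu>) / (4 powr \<nu> * Gamma \<nu>)) *\<^sub>R
     (LINT u:{0<..}|lebesgue. (exp (- (t\<^sup>2 / (4 * u))) / u powr (1 + \<nu>)) *\<^sub>R heat_semigroup m u f x)"

text \<open>
  The same iterated integral with \<open>f\<close> replaced by \<open>|f|\<close>, as an element of \<open>[0,\<infinity>]\<close>. The Bochner integrals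
  in \<^const>\<open>poisson\<close> are \<open>0\<close> when they diverge, so absolute convergence has to be expressed through this
  quantity.
\<close>

definition poisson_abs :: "real \<Rightarrow> real \<Rightarrow> (real ^ 'n \<Rightarrow> complex) \<Rightarrow> real \<Rightarrow> real ^ 'n \<Rightarrow> ennreal" where
  "poisson_abs m \<nu> f t x =
     ennreal (t powr (2 * \<nu>) / (4 powr \<nu> * Gamma \<nu>)) *
     (\<integral>\<^sup>+u\<in>{0<..}. ennreal (exp (- (t\<^sup>2 / (4 * u))) / u powr (1 + \<nu>)) *
        (\<integral>\<^sup>+y. ennreal (heat_kernel m u x y * norm (f y)) \<partial>lebesgue) \<partial>lebesgue)"

definition weight_phi :: "real \<Rightarrow> real \<Rightarrow> real ^ 'n \<Rightarrow> real" where
  "weight_phi m \<nu> y =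
     (if m = - real CARD('n)
      then exp (- ((norm y)\<^sup>2 / 2)) / ln (exp 1 + norm y) powr \<nu>
      else exp (- ((norm y)\<^sup>2 / 2)) /
             ((1 + norm y) powr ((real CARD('n) + m) / 2) * ln (exp 1 + norm y) powr (1 + \<nu>)))"

definition L1_phi :: "real \<Rightarrow> real \<Rightarrow> (real ^ 'n \<Rightarrow> complex) set" where
  "L1_phi m \<nu> = {f \<in> borel_measurable lebesgue.
     (\<integral>\<^sup>+y. ennreal (norm (f y) * weight_phi m \<nu> y) \<partial>lebesgue) < \<infinity>}"

text \<open>
  \<open>C\<^sup>k\<close> on an open set \<open>S\<close>: all iterated directional derivatives up to order \<open>k\<close>
  exist (as values of Frechet derivatives) and are continuous.
\<close>

primrec Ck_on :: "nat \<Rightarrow> ('a::real_normed_vector) set \<Rightarrow> ('a \<Rightarrow> 'b::real_normed_vector) \<Rightarrow> bool" where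
  "Ck_on 0 S g \<longleftrightarrow> continuous_on S g"
| "Ck_on (Suc k) S g \<longleftrightarrow> (\<forall>z\<in>S. g differentiable (at z)) \<and>
     (\<forall>w. Ck_on k S (\<lambda>z. frechet_derivative g (at z) w))"

definition Cinfinity_on :: "('a::real_normed_vector) set \<Rightarrow> ('a \<Rightarrow> 'b::real_normed_vector) \<Rightarrow> bool" where
  "Cinfinity_on S g \<longleftrightarrow> (\<forall>k. Ck_on k S g)"

definition partial_deriv :: "'n \<Rightarrow> (real ^ 'n \<Rightarrow> complex) \<Rightarrow> real ^ 'n \<Rightarrow> complex" where
  "partial_deriv i g x = vector_derivative (\<lambda>s. g (x + s *\<^sub>R axis i 1)) (at 0)"

definition laplacian :: "(real ^ 'n \<Rightarrow> complex) \<Rightarrow> real ^ 'n \<Rightarrow> complex" where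
  "laplacian g x = (\<Sum>i\<in>UNIV. partial_deriv i (partial_deriv i g) x)"

definition hermite_op :: "real \<Rightarrow> (real ^ 'n \<Rightarrow> complex) \<Rightarrow> real ^ 'n \<Rightarrow> complex" where
  "hermite_op m g x = - laplacian g x + (norm x)\<^sup>2 *\<^sub>R g x + m *\<^sub>R g x"

text \<open>
  \<open>u\<^sub>t\<^sub>t + ((1 - 2\<nu>)/t) u\<^sub>t = L u\<close> at the point \<open>(t,x)\<close>. The total function \<^const>\<open>vector_derivative\<close> has its
  intended meaning only where the derivative exists, so this is to be read together with
  smoothness of \<open>u\<close>.
\<close>

definition extension_pde_at :: "real \<Rightarrow> real \<Rightarrow> (real \<Rightarrow> real ^ 'n \<Rightarrow> complex) \<Rightarrow> real \<Rightarrow> real ^ 'n \<Rightarrow> bool" where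
  "extension_pde_at m \<nu> u t x \<longleftrightarrow>
     vector_derivative (\<lambda>s. vector_derivative (\<lambda>r. u r x) (at s)) (at t)
       + ((1 - 2 * \<nu>) / t) *\<^sub>R vector_derivative (\<lambda>r. u r x) (at t)
     = hermite_op m (u t) x"

end

theory Submission
  imports Defs "HOL-Real_Asymp.Real_Asymp" "HOL-Probability.Distributions"
begin

text \<open>
  After expansion of the square, Mehler's kernel has the exponent
  \<open>csch (2u) x\<bullet>y - coth (2u) (|x|\<^sup>2 + |y|\<^sup>2) / 2\<close>. Together with the factor \<open>exp (- t\<^sup>2 / (4u))\<close> of the
  subordination formula, the exponent under the double integral in \<open>(u, y)\<close> that defines \<open>P\<^sub>t f(x)\<close> is affine in
  \<open>a = t\<^sup>2\<close>, \<open>b = |x|\<^sup>2\<close> and \<open>x\<close>. Hence, up to the factor \<open>t powr (2 * \<nu>)\<close>, the Poisson integral is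
  \<open>\<Phi>(t\<^sup>2, |x|\<^sup>2, x)\<close>, where \<open>\<Phi>\<close> is the Laplace transform of a fixed density that depends on \<open>f\<close>.

  \<^bold>\<open>The weight.\<close> For fixed \<open>(t, x)\<close> the time integral of the kernel has exactly the order of magnitude of
  \<open>\<phi>(y)\<close>. At small times the kernel is smaller than any weight in question (\<open>kern_small\<close>). At large times it is
  \<open>exp (- |y|\<^sup>2 / 2) exp (- (d + m) u) u powr (-1 - \<nu>)\<close> with a cutoff below \<open>u = ln |y| / 2\<close> (\<open>kern_large\<close>). The
  value of the integrand at the cutoff gives the power and the logarithm in \<open>\<phi>\<close> if \<open>m > -d\<close>; if \<open>m = -d\<close> there is
  no exponential decay, and the integral of the tail gives one logarithm less. The upper bound
  (\<open>kern_integral_le\<close>) holds for all parameters with \<open>|x|\<^sup>2 < a + b\<close> and yields absolute convergence; the lower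
  bound (\<open>kern_integral_ge\<close>) yields the converse by Tonelli's theorem.

  \<^bold>\<open>Smoothness and the equation.\<close> A Laplace transform is smooth on any open set on which it converges absolutely,
  and its derivatives are the transforms of the moments (\<open>laplace_has_derivative\<close>, \<open>laplace_Ck_on\<close>). The
  parameters with \<open>|x|\<^sup>2 < a + b\<close> form such a set, so \<open>P\<^sub>t f(x)\<close> is smooth by the chain rule, and all derivatives in
  the equation may be taken under the integral. There \<open>\<partial>\<^sub>t\<^sub>t + ((1 - 2\<nu>)/t) \<partial>\<^sub>t - L\<close>, applied to the kernel, equals
  the derivative in \<open>u\<close> of the kernel. The kernel vanishes at both ends of the time axis, so the integral is
  \<open>0\<close> (\<open>kern_density_pde\<close>).

  \<^bold>\<open>Boundary values.\<close> The averages over \<open>u\<close> are taken with probability measures that concentrate at \<open>u = 0\<close> as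
  \<open>t \<rightarrow> 0\<close> (\<open>subordination_tendsto\<close>), so it is enough that the heat semigroup at time \<open>u\<close> converges to \<open>f\<close>
  almost everywhere as \<open>u \<rightarrow> 0\<close>. This holds at every Lebesgue point, because the heat kernel at small times is
  dominated by Gaussians of width \<open>sqrt u\<close> (\<open>heat_semigroup_tendsto\<close>), and almost every point is a Lebesgue point
  (\<open>AE_lebesgue_point\<close>).
\<close>

section \<open>Calculus of continuously differentiable functions\<close>

text \<open>
  On an open set the Frechet derivative at a point sees only nearby values, so \<^const>\<open>Ck_on\<close>, although
  defined through the total function \<^const>\<open>frechet_derivative\<close>, depends only on the values on that set.
\<close>

lemma Ck_on_cong:
  assumes "open S" "\<And>z. z \<in> S \<Longrightarrow> f z = g z" "Ck_on k S f"
  shows "Ck_on k S g"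
  using assms(2,3)
proof (induction k arbitrary: f g)
  case 0
  then show ?case by (simp cong: continuous_on_cong)
next
  case (Suc k)
  have d: "g differentiable (at z)" if "z \<in> S" for z
  proof -
    have "(f has_derivative frechet_derivative f (at z)) (at z)"
      using Suc.prems(2) that by (simp add: frechet_derivative_works)
    then have "(g has_derivative frechet_derivative f (at z)) (at z)"
      by (rule has_derivative_transform_within_open[OF _ assms(1) that]) (rule Suc.prems(1))
    then show ?thesis by (rule differentiableI)
  qed
  have eq: "frechet_derivative f (at z) = frechet_derivative g (at z)" if "z \<in> S" for z
    using Suc.prems that assms(1) by (intro frechet_derivative_transform_within_open[of f z S g]) auto
  have "Ck_on k S (\<lambda>z. frechet_derivative g (at z) w)" for w
  proof -
    have "Ck_on k S (\<lambda>z. frechet_derivative f (at z) w)" using Suc.prems(2) by simp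
    then show ?thesis by (rule Suc.IH[rotated]) (use eq in auto)
  qed
  then show ?case using d by simp
qed

lemma Ck_on_SucI:
  assumes "open S" "\<And>z. z \<in> S \<Longrightarrow> (f has_derivative f' z) (at z)" "\<And>w. Ck_on k S (\<lambda>z. f' z w)"
  shows "Ck_on (Suc k) S f"
proof -
  have eq: "f' z = frechet_derivative f (at z)" if "z \<in> S" for z
    using assms(2)[OF that] by (rule frechet_derivative_at)
  have "Ck_on k S (\<lambda>z. frechet_derivative f (at z) w)" for w
    by (rule Ck_on_cong[OF assms(1) _ assms(3)[of w]]) (simp add: eq)
  then show ?thesis using differentiableI[OF assms(2)] by simp
qed

lemma Ck_on_SucD:
  assumes "Ck_on (Suc k) S f" "z \<in> S"
  shows "(f has_derivative frechet_derivative f (at z)) (at z)"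
  using assms by (simp add: frechet_derivative_works)

lemma Ck_on_decr: "Ck_on (Suc k) S f \<Longrightarrow> Ck_on k S f"
proof (induction k arbitrary: f)
  case 0
  then show ?case
    using differentiable_imp_continuous_within[of f _ UNIV] by (auto intro!: continuous_at_imp_continuous_on)
next
  case (Suc k)
  then have "Ck_on k S (\<lambda>z. frechet_derivative f (at z) w)" for w by simp
  then show ?case using Suc.prems by simp
qed

lemma Ck_on_const: "open S \<Longrightarrow> Ck_on k S (\<lambda>_. c)"
proof (induction k arbitrary: c)
  case (Suc k)
  then show ?case by (intro Ck_on_SucI[where f' = "\<lambda>_ _. 0"] has_derivative_const) auto
qed simp

lemma Ck_on_bounded_linear:
  assumes "open S" "bounded_linear f"
  shows "Ck_on k S f"
proof (cases k)
  case 0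
  then show ?thesis using assms(2) by (simp add: linear_continuous_on)
next
  case (Suc l)
  then show ?thesis
    unfolding Suc by (intro Ck_on_SucI[where f' = "\<lambda>_. f"] bounded_linear_imp_has_derivative assms Ck_on_const)
qed

lemma Ck_on_add:
  assumes "open S" "Ck_on k S f" "Ck_on k S g"
  shows "Ck_on k S (\<lambda>z. f z + g z)"
  using assms(2,3)
proof (induction k arbitrary: f g)
  case 0
  then show ?case by (simp add: continuous_on_add)
next
  case (Suc k)
  show ?case
  proof (rule Ck_on_SucI[OF assms(1) has_derivative_add[OF Ck_on_SucD Ck_on_SucD, OF Suc.prems(1) _ Suc.prems(2)]])
    fix w
    show "Ck_on k S (\<lambda>z. frechet_derivative f (at z) w + frechet_derivative g (at z) w)"
      using Suc.prems by (intro Suc.IH[of "\<lambda>z. frechet_derivative f (at z) w" "\<lambda>z. frechet_derivative g (at z) w"]) auto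
  qed
qed

lemma Ck_on_sum:
  assumes "open S" "\<And>i. i \<in> I \<Longrightarrow> Ck_on k S (f i)"
  shows "Ck_on k S (\<lambda>z. \<Sum>i\<in>I. f i z)"
  using assms(2)
  by (induction I rule: infinite_finite_induct) (auto intro!: Ck_on_const Ck_on_add assms(1))

lemma Ck_on_bilinear:
  assumes "bounded_bilinear B" "open S" "Ck_on k S f" "Ck_on k S g"
  shows "Ck_on k S (\<lambda>z. B (f z) (g z))"
  using assms(3,4)
proof (induction k arbitrary: f g)
  case 0
  then show ?case using bounded_bilinear.continuous_on[OF assms(1)] by simp
next
  case (Suc k)
  show ?case
  proof (rule Ck_on_SucI[OF assms(2) bounded_bilinear.FDERIV[OF assms(1) Ck_on_SucD Ck_on_SucD, OF Suc.prems(1) _ Suc.prems(2)]])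
    fix w
    show "Ck_on k S (\<lambda>z. B (f z) (frechet_derivative g (at z) w) + B (frechet_derivative f (at z) w) (g z))"
      using Suc.prems Ck_on_decr[OF Suc.prems(1)] Ck_on_decr[OF Suc.prems(2)]
      by (intro Ck_on_add assms(2) Suc.IH) auto
  qed auto
qed

text \<open>
  In the chain rule the direction \<open>Df(z) w\<close> moves with \<open>z\<close>, whereas \<^const>\<open>Ck_on\<close> speaks of derivatives in
  fixed directions. Expanding \<open>Df(z) w\<close> in the standard basis turns the derivative of the composite into
  a finite sum of products, each factor of which is covered by the induction hypothesis.
\<close>

lemma Ck_on_compose:
  fixes f :: "'a::real_normed_vector \<Rightarrow> 'b::euclidean_space" and g :: "'b \<Rightarrow> 'c::real_normed_vector"
  assumes "open S" "f ` S \<subseteq> T" "Ck_on k S f" "Ck_on k T g"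
  shows "Ck_on k S (\<lambda>z. g (f z))"
  using assms(3,4)
proof (induction k arbitrary: g)
  case 0
  then show ?case using assms(2) continuous_on_compose2 by auto
next
  case (Suc k)
  let ?Df = "\<lambda>z. frechet_derivative f (at z)" and ?Dg = "\<lambda>z. frechet_derivative g (at z)"
  have eq: "?Dg (f z) (?Df z w) = (\<Sum>b\<in>Basis. (?Df z w \<bullet> b) *\<^sub>R ?Dg (f z) b)" if "z \<in> S" for z w
  proof -
    have lin: "linear (?Dg (f z))"
      using Suc.prems(2) assms(2) that by (intro linear_frechet_derivative) auto
    have "?Dg (f z) (\<Sum>b\<in>Basis. (v \<bullet> b) *\<^sub>R b) = (\<Sum>b\<in>Basis. (v \<bullet> b) *\<^sub>R ?Dg (f z) b)" for v
      unfolding linear_sum[OF lin] linear_scale[OF lin] by (rule refl)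
    from this[of "?Df z w"] show ?thesis unfolding euclidean_representation .
  qed
  show ?case
  proof (rule Ck_on_SucI[OF assms(1)])
    fix z assume z: "z \<in> S"
    show "((\<lambda>z. g (f z)) has_derivative (\<lambda>w. ?Dg (f z) (?Df z w))) (at z)"
      using assms(2) z by (intro has_derivative_compose[OF Ck_on_SucD[OF Suc.prems(1)] Ck_on_SucD[OF Suc.prems(2)]]) auto
  next
    fix w
    have "Ck_on k S (\<lambda>z. \<Sum>b\<in>Basis. (?Df z w \<bullet> b) *\<^sub>R ?Dg (f z) b)"
    proof (intro Ck_on_sum assms(1) Ck_on_bilinear[OF bounded_bilinear_scaleR])
      fix b :: 'b
      show "Ck_on k S (\<lambda>z. ?Df z w \<bullet> b)"
        using Suc.prems(1) by (intro Ck_on_bilinear[OF bounded_bilinear_inner] assms(1) Ck_on_const) auto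
      show "Ck_on k S (\<lambda>z. ?Dg (f z) b)"
        using Suc.prems Ck_on_decr[OF Suc.prems(1)] by (intro Suc.IH[of "\<lambda>y. frechet_derivative g (at y) b"]) auto
    qed
    then show "Ck_on k S (\<lambda>z. ?Dg (f z) (?Df z w))"
      by (rule Ck_on_cong[OF assms(1), rotated]) (simp add: eq)
  qed
qed

lemma Ck_on_powr: "Ck_on k {0<..} (\<lambda>t::real. C * t powr a)"
proof (induction k arbitrary: a C)
  case 0
  then show ?case by (auto intro!: continuous_intros)
next
  case (Suc k)
  show ?case
  proof (rule Ck_on_SucI[where f' = "\<lambda>t w. w * (C * (a * t powr (a - 1)))"])
    fix t :: real assume "t \<in> {0<..}"
    then have "((\<lambda>t::real. C * t powr a) has_real_derivative C * (a * t powr (a - 1))) (at t)"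
      by (auto intro!: derivative_eq_intros)
    then show "((\<lambda>t::real. C * t powr a) has_derivative (\<lambda>w. w * (C * (a * t powr (a - 1))))) (at t)"
      unfolding has_field_derivative_def by (rule has_derivative_eq_rhs) (simp add: fun_eq_iff)
  next
    fix w
    show "Ck_on k {0<..} (\<lambda>t. w * (C * (a * t powr (a - 1))))"
      using Suc.IH[of "w * C * a" "a - 1"] by (simp add: mult.assoc)
  qed simp
qed

section \<open>Laplace transforms are smooth where they converge absolutely\<close>

definition laplace :: "'w measure \<Rightarrow> ('w \<Rightarrow> 'e::euclidean_space) \<Rightarrow> ('w \<Rightarrow> complex) \<Rightarrow> 'e \<Rightarrow> complex" where
  "laplace M T g p = (\<integral>\<omega>. exp (p \<bullet> T \<omega>) *\<^sub>R g \<omega> \<partial>M)"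

text \<open>
  The norm of \<open>v\<close> is at most \<open>DIM('e)\<close> times its largest coordinate. This is what lets absolute
  convergence at finitely many neighbours of \<open>p\<close> control the radial factor \<open>exp (\<delta> |T|)\<close> below.
\<close>

lemma exp_norm_le_sum_exp_inner:
  fixes v :: "'e::euclidean_space" and \<delta> :: real
  assumes "\<delta> \<ge> 0"
  shows "exp (\<delta> * norm v) \<le> (\<Sum>b\<in>Basis. exp (DIM('e) * \<delta> * (v \<bullet> b)) + exp (- (DIM('e) * \<delta> * (v \<bullet> b))))"
proof -
  obtain b0 :: 'e where b0: "b0 \<in> Basis" "\<And>b. b \<in> Basis \<Longrightarrow> \<bar>v \<bullet> b\<bar> \<le> \<bar>v \<bullet> b0\<bar>"
  proof -
    have "Max ((\<lambda>b. \<bar>v \<bullet> b\<bar>) ` Basis) \<in> (\<lambda>b. \<bar>v \<bullet> b\<bar>) ` Basis" by (intro Max_in) auto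
    then obtain b0 where b0: "Max ((\<lambda>b. \<bar>v \<bullet> b\<bar>) ` Basis) = \<bar>v \<bullet> b0\<bar>" "b0 \<in> Basis" by (rule imageE)
    have "\<bar>v \<bullet> b\<bar> \<le> \<bar>v \<bullet> b0\<bar>" if "b \<in> Basis" for b
      unfolding b0(1)[symmetric] using that by (intro Max_ge) auto
    with b0(2) show ?thesis by (rule that)
  qed
  have "norm v \<le> (\<Sum>b\<in>Basis. \<bar>v \<bullet> b\<bar>)" by (rule norm_le_l1)
  also have "\<dots> \<le> DIM('e) * \<bar>v \<bullet> b0\<bar>"
    using sum_bounded_above[of Basis "\<lambda>b. \<bar>v \<bullet> b\<bar>"] b0(2) by simp
  finally have "\<delta> * norm v \<le> \<bar>DIM('e) * \<delta> * (v \<bullet> b0)\<bar>"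
    using assms by (simp add: abs_mult mult.left_commute mult.assoc mult_left_mono)
  then have "exp (\<delta> * norm v) \<le> exp \<bar>DIM('e) * \<delta> * (v \<bullet> b0)\<bar>" by simp
  also have "\<dots> \<le> exp (DIM('e) * \<delta> * (v \<bullet> b0)) + exp (- (DIM('e) * \<delta> * (v \<bullet> b0)))"
    by (cases "DIM('e) * \<delta> * (v \<bullet> b0) \<ge> 0") (auto simp: abs_if add_increasing add_increasing2)
  also have "\<dots> \<le> (\<Sum>b\<in>Basis. exp (DIM('e) * \<delta> * (v \<bullet> b)) + exp (- (DIM('e) * \<delta> * (v \<bullet> b))))"
    using b0(1) by (intro member_le_sum[where f = "\<lambda>b. exp (DIM('e) * \<delta> * (v \<bullet> b)) + exp (- (DIM('e) * \<delta> * (v \<bullet> b)))"]) (auto intro: add_nonneg_nonneg)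
  finally show ?thesis .
qed

lemma exp_remainder_le: "\<bar>exp a - 1 - a\<bar> \<le> a\<^sup>2 * exp \<bar>a\<bar>" for a :: real
proof -
  obtain t where t: "\<bar>t\<bar> \<le> \<bar>a\<bar>" "exp a = (\<Sum>m<2. a ^ m / fact m) + exp t / fact 2 * a ^ 2"
    using Maclaurin_exp_le[of a 2] by blast
  have "exp a - 1 - a = exp t / 2 * a\<^sup>2" using t(2) by (simp add: numeral_2_eq_2)
  then have "\<bar>exp a - 1 - a\<bar> = exp t / 2 * a\<^sup>2" by (simp only: abs_mult abs_divide abs_exp_cancel abs_numeral abs_power2)
  also have "\<dots> \<le> exp \<bar>a\<bar> * a\<^sup>2"
  proof (rule mult_right_mono)
    have "exp t \<le> exp \<bar>a\<bar>" using t(1) by simp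
    then show "exp t / 2 \<le> exp \<bar>a\<bar>" using exp_gt_zero[of t] by linarith
  qed simp
  finally show ?thesis by (simp add: mult.commute)
qed

text \<open>
  Absolute convergence on a neighbourhood of \<open>p\<close> leaves exponential room at \<open>p\<close> itself. All polynomial
  factors that differentiation brings down are absorbed by this room.
\<close>

lemma laplace_integrable_margin:
  fixes T :: "'w \<Rightarrow> 'e::euclidean_space" and g :: "'w \<Rightarrow> complex"
  assumes [measurable]: "T \<in> borel_measurable M" "g \<in> borel_measurable M"
    and U: "open U" "p \<in> U" and int: "\<And>p. p \<in> U \<Longrightarrow> integrable M (\<lambda>\<omega>. exp (p \<bullet> T \<omega>) *\<^sub>R g \<omega>)"
  obtains \<delta> where "\<delta> > 0" "integrable M (\<lambda>\<omega>. exp (p \<bullet> T \<omega> + \<delta> * norm (T \<omega>)) *\<^sub>R g \<omega>)"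
proof -
  obtain r where r: "r > 0" "ball p r \<subseteq> U" using U openE by blast
  \<comment> \<open>The neighbours \<open>p \<plusminus> (r/2) b\<close>, for \<open>b\<close> in the standard basis, lie in the ball of radius \<open>r\<close>.\<close>
  define \<delta> where "\<delta> = r / (2 * DIM('e))"
  have \<delta>: "\<delta> > 0" "DIM('e) * \<delta> = r / 2" using r by (auto simp: \<delta>_def)
  have "integrable M (\<lambda>\<omega>. exp (p \<bullet> T \<omega> + \<delta> * norm (T \<omega>)) *\<^sub>R g \<omega>)"
  proof (rule Bochner_Integration.integrable_bound)
    show "integrable M (\<lambda>\<omega>. \<Sum>b\<in>Basis. norm (exp ((p + (r/2) *\<^sub>R b) \<bullet> T \<omega>) *\<^sub>R g \<omega>) + norm (exp ((p - (r/2) *\<^sub>R b) \<bullet> T \<omega>) *\<^sub>R g \<omega>))"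
      using r by (intro Bochner_Integration.integrable_sum Bochner_Integration.integrable_add integrable_norm int subsetD[OF r(2)])
        (auto simp: dist_norm)
    show "AE \<omega> in M. norm (exp (p \<bullet> T \<omega> + \<delta> * norm (T \<omega>)) *\<^sub>R g \<omega>) \<le>
      norm (\<Sum>b\<in>Basis. norm (exp ((p + (r/2) *\<^sub>R b) \<bullet> T \<omega>) *\<^sub>R g \<omega>) + norm (exp ((p - (r/2) *\<^sub>R b) \<bullet> T \<omega>) *\<^sub>R g \<omega>))"
    proof (intro AE_I2)
      fix \<omega>
      have "exp (p \<bullet> T \<omega> + \<delta> * norm (T \<omega>)) \<le> exp (p \<bullet> T \<omega>) * (\<Sum>b\<in>Basis. exp (r/2 * (T \<omega> \<bullet> b)) + exp (- (r/2 * (T \<omega> \<bullet> b))))"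
        using exp_norm_le_sum_exp_inner[of \<delta> "T \<omega>"] \<delta> by (simp add: exp_add)
      then have "exp (p \<bullet> T \<omega> + \<delta> * norm (T \<omega>)) * norm (g \<omega>) \<le> exp (p \<bullet> T \<omega>) * (\<Sum>b\<in>Basis. exp (r/2 * (T \<omega> \<bullet> b)) + exp (- (r/2 * (T \<omega> \<bullet> b)))) * norm (g \<omega>)"
        by (rule mult_right_mono) simp
      also have "\<dots> = (\<Sum>b\<in>Basis. norm (exp ((p + (r/2) *\<^sub>R b) \<bullet> T \<omega>) *\<^sub>R g \<omega>) + norm (exp ((p - (r/2) *\<^sub>R b) \<bullet> T \<omega>) *\<^sub>R g \<omega>))"
        unfolding sum_distrib_left sum_distrib_right
      proof (rule sum.cong)
        fix b :: 'e
        have "exp ((p + (r/2) *\<^sub>R b) \<bullet> T \<omega>) = exp (p \<bullet> T \<omega>) * exp (r/2 * (T \<omega> \<bullet> b))"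
          "exp ((p - (r/2) *\<^sub>R b) \<bullet> T \<omega>) = exp (p \<bullet> T \<omega>) * exp (- (r/2 * (T \<omega> \<bullet> b)))"
          by (simp_all add: inner_add_left inner_diff_left inner_commute[of b] flip: exp_add)
        then show "exp (p \<bullet> T \<omega>) * (exp (r/2 * (T \<omega> \<bullet> b)) + exp (- (r/2 * (T \<omega> \<bullet> b)))) * norm (g \<omega>)
          = norm (exp ((p + (r/2) *\<^sub>R b) \<bullet> T \<omega>) *\<^sub>R g \<omega>) + norm (exp ((p - (r/2) *\<^sub>R b) \<bullet> T \<omega>) *\<^sub>R g \<omega>)"
          by (simp add: algebra_simps)
      qed simp
      also have "\<dots> \<le> norm \<dots>" unfolding real_norm_def by (rule abs_ge_self)
      finally show "norm (exp (p \<bullet> T \<omega> + \<delta> * norm (T \<omega>)) *\<^sub>R g \<omega>) \<le> norm (\<Sum>b\<in>Basis. norm (exp ((p + (r/2) *\<^sub>R b) \<bullet> T \<omega>) *\<^sub>R g \<omega>) + norm (exp ((p - (r/2) *\<^sub>R b) \<bullet> T \<omega>) *\<^sub>R g \<omega>))"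
        unfolding norm_scaleR abs_exp_cancel .
    qed
  qed measurable
  then show ?thesis using that \<delta>(1) by blast
qed

lemma laplace_integrable_moment:
  fixes T :: "'w \<Rightarrow> 'e::euclidean_space" and g :: "'w \<Rightarrow> complex"
  assumes [measurable]: "T \<in> borel_measurable M" "g \<in> borel_measurable M"
    and U: "open U" "p \<in> U" and int: "\<And>p. p \<in> U \<Longrightarrow> integrable M (\<lambda>\<omega>. exp (p \<bullet> T \<omega>) *\<^sub>R g \<omega>)"
  shows "integrable M (\<lambda>\<omega>. exp (p \<bullet> T \<omega>) *\<^sub>R ((w \<bullet> T \<omega>) *\<^sub>R g \<omega>))"
proof -
  obtain \<delta> where \<delta>: "\<delta> > 0" "integrable M (\<lambda>\<omega>. exp (p \<bullet> T \<omega> + \<delta> * norm (T \<omega>)) *\<^sub>R g \<omega>)"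
    using laplace_integrable_margin[OF assms] by blast
  show ?thesis
  proof (rule Bochner_Integration.integrable_bound)
    show "integrable M (\<lambda>\<omega>. (norm w / \<delta>) *\<^sub>R (exp (p \<bullet> T \<omega> + \<delta> * norm (T \<omega>)) *\<^sub>R g \<omega>))"
      using \<delta>(2) by (rule integrable_scaleR_right)
    show "AE \<omega> in M. norm (exp (p \<bullet> T \<omega>) *\<^sub>R ((w \<bullet> T \<omega>) *\<^sub>R g \<omega>)) \<le> norm ((norm w / \<delta>) *\<^sub>R (exp (p \<bullet> T \<omega> + \<delta> * norm (T \<omega>)) *\<^sub>R g \<omega>))"
    proof (intro AE_I2)
      fix \<omega>
      have "\<delta> * norm (T \<omega>) \<le> exp (\<delta> * norm (T \<omega>))"
        using exp_ge_add_one_self[of "\<delta> * norm (T \<omega>)"] by linarith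
      then have "norm (T \<omega>) \<le> exp (\<delta> * norm (T \<omega>)) / \<delta>" using \<delta>(1) by (simp add: field_simps)
      then have "norm w * norm (T \<omega>) \<le> norm w * (exp (\<delta> * norm (T \<omega>)) / \<delta>)" by (intro mult_left_mono) auto
      moreover have "\<bar>w \<bullet> T \<omega>\<bar> \<le> norm w * norm (T \<omega>)" by (rule Cauchy_Schwarz_ineq2)
      ultimately have "\<bar>w \<bullet> T \<omega>\<bar> \<le> norm w / \<delta> * exp (\<delta> * norm (T \<omega>))" by simp
      then have "exp (p \<bullet> T \<omega>) * (\<bar>w \<bullet> T \<omega>\<bar> * norm (g \<omega>)) \<le> exp (p \<bullet> T \<omega>) * (norm w / \<delta> * exp (\<delta> * norm (T \<omega>)) * norm (g \<omega>))"
        by (intro mult_left_mono mult_right_mono) auto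
      then show "norm (exp (p \<bullet> T \<omega>) *\<^sub>R ((w \<bullet> T \<omega>) *\<^sub>R g \<omega>)) \<le> norm ((norm w / \<delta>) *\<^sub>R (exp (p \<bullet> T \<omega> + \<delta> * norm (T \<omega>)) *\<^sub>R g \<omega>))"
        using \<delta>(1) by (simp add: exp_add abs_mult mult_ac)
    qed
  qed measurable
qed

text \<open>
  The integrand has remainder at most \<open>|h|\<^sup>2 |T|\<^sup>2 exp (|h| |T|)\<close> times its value at \<open>p\<close>, and the
  exponential margin makes this integrable with a bound uniform in small \<open>h\<close>. The derivative is again a
  Laplace transform, of \<open>g\<close> multiplied by a linear form in \<open>T\<close>.
\<close>

lemma laplace_has_derivative:
  fixes T :: "'w \<Rightarrow> 'e::euclidean_space" and g :: "'w \<Rightarrow> complex"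
  assumes [measurable]: "T \<in> borel_measurable M" "g \<in> borel_measurable M"
    and U: "open U" "p \<in> U" and int: "\<And>p. p \<in> U \<Longrightarrow> integrable M (\<lambda>\<omega>. exp (p \<bullet> T \<omega>) *\<^sub>R g \<omega>)"
  shows "(laplace M T g has_derivative (\<lambda>w. laplace M T (\<lambda>\<omega>. (w \<bullet> T \<omega>) *\<^sub>R g \<omega>) p)) (at p)"
proof -
  note mom = laplace_integrable_moment[OF assms]
  obtain \<delta> where \<delta>: "\<delta> > 0" and margin: "integrable M (\<lambda>\<omega>. exp (p \<bullet> T \<omega> + \<delta> * norm (T \<omega>)) *\<^sub>R g \<omega>)"
    using laplace_integrable_margin[OF assms] by blast
  define B where "B = (\<integral>\<omega>. norm (exp (p \<bullet> T \<omega> + \<delta> * norm (T \<omega>)) *\<^sub>R g \<omega>) \<partial>M)"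
  have bl: "bounded_linear (\<lambda>w. laplace M T (\<lambda>\<omega>. (w \<bullet> T \<omega>) *\<^sub>R g \<omega>) p)"
    unfolding linear_conv_bounded_linear[symmetric]
  proof (rule linearI)
    fix v w :: 'e
    show "laplace M T (\<lambda>\<omega>. ((v + w) \<bullet> T \<omega>) *\<^sub>R g \<omega>) p = laplace M T (\<lambda>\<omega>. (v \<bullet> T \<omega>) *\<^sub>R g \<omega>) p + laplace M T (\<lambda>\<omega>. (w \<bullet> T \<omega>) *\<^sub>R g \<omega>) p"
      using Bochner_Integration.integral_add[OF mom[of v] mom[of w]]
      by (simp add: laplace_def inner_add_left scaleR_add_left scaleR_add_right algebra_simps)
  next
    fix r and w :: 'e
    show "laplace M T (\<lambda>\<omega>. ((r *\<^sub>R w) \<bullet> T \<omega>) *\<^sub>R g \<omega>) p = r *\<^sub>R laplace M T (\<lambda>\<omega>. (w \<bullet> T \<omega>) *\<^sub>R g \<omega>) p"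
      unfolding laplace_def integral_scaleR_right[symmetric] by (simp add: mult_ac)
  qed
  have rem: "norm (laplace M T g y - laplace M T g p - laplace M T (\<lambda>\<omega>. ((y - p) \<bullet> T \<omega>) *\<^sub>R g \<omega>) p) \<le> (norm (y - p))\<^sup>2 * (8 / \<delta>\<^sup>2 * B)"
    if y: "norm (y - p) \<le> \<delta> / 2" for y
  proof -
    let ?E = "\<lambda>\<omega>. exp (p \<bullet> T \<omega> + \<delta> * norm (T \<omega>)) *\<^sub>R g \<omega>" and ?h = "\<lambda>\<omega>. (y - p) \<bullet> T \<omega>"
    have hb: "\<bar>?h \<omega>\<bar> \<le> norm (y - p) * norm (T \<omega>)" for \<omega> by (rule Cauchy_Schwarz_ineq2)
    have hb2: "\<bar>?h \<omega>\<bar> \<le> \<delta> / 2 * norm (T \<omega>)" for \<omega>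
      using hb[of \<omega>] mult_right_mono[OF y, of "norm (T \<omega>)"] by simp
    have eqy: "exp (y \<bullet> T \<omega>) = exp (p \<bullet> T \<omega>) * exp (?h \<omega>)" for \<omega>
      by (simp add: inner_diff_left flip: exp_add)
    have inty: "integrable M (\<lambda>\<omega>. exp (y \<bullet> T \<omega>) *\<^sub>R g \<omega>)"
    proof (rule Bochner_Integration.integrable_bound[OF margin])
      have "exp (y \<bullet> T \<omega>) \<le> exp (p \<bullet> T \<omega> + \<delta> * norm (T \<omega>))" for \<omega>
      proof -
        have "?h \<omega> \<le> \<delta> * norm (T \<omega>)" using hb2[of \<omega>] mult_right_mono[of "\<delta>/2" \<delta> "norm (T \<omega>)"] \<delta> by simp
        then show ?thesis by (simp add: inner_diff_left)
      qed
      then show "AE \<omega> in M. norm (exp (y \<bullet> T \<omega>) *\<^sub>R g \<omega>) \<le> norm (?E \<omega>)"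
        by (intro AE_I2) (simp add: mult_right_mono)
    qed measurable
    have "laplace M T g y - laplace M T g p - laplace M T (\<lambda>\<omega>. ?h \<omega> *\<^sub>R g \<omega>) p
      = (\<integral>\<omega>. exp (y \<bullet> T \<omega>) *\<^sub>R g \<omega> - exp (p \<bullet> T \<omega>) *\<^sub>R g \<omega> - exp (p \<bullet> T \<omega>) *\<^sub>R (?h \<omega> *\<^sub>R g \<omega>) \<partial>M)"
      unfolding laplace_def using inty int[OF U(2)] mom
      by (simp add: Bochner_Integration.integral_diff Bochner_Integration.integrable_diff)
    also have "norm \<dots> \<le> (\<integral>\<omega>. (norm (y - p))\<^sup>2 * (8 / \<delta>\<^sup>2) * norm (?E \<omega>) \<partial>M)"
    proof (rule order_trans[OF integral_norm_bound integral_mono], goal_cases)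
      case 1 show ?case using inty int[OF U(2)] mom by (intro integrable_norm Bochner_Integration.integrable_diff)
    next
      case 2 show ?case using margin by (intro integrable_mult_right integrable_norm)
    next
      case (3 \<omega>)
      define N where "N = norm (T \<omega>)"
      have "\<bar>exp (?h \<omega>) - 1 - ?h \<omega>\<bar> \<le> (?h \<omega>)\<^sup>2 * exp \<bar>?h \<omega>\<bar>" by (rule exp_remainder_le)
      also have "\<dots> \<le> (norm (y - p) * N)\<^sup>2 * exp (\<delta> / 2 * N)"
      proof (rule mult_mono)
        show "(?h \<omega>)\<^sup>2 \<le> (norm (y - p) * N)\<^sup>2"
          using hb[of \<omega>] unfolding abs_le_square_iff[symmetric] by (simp add: N_def abs_mult)
        show "exp \<bar>?h \<omega>\<bar> \<le> exp (\<delta> / 2 * N)" using hb2[of \<omega>] by (simp add: N_def)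
      qed auto
      also have "\<dots> \<le> (norm (y - p))\<^sup>2 * (8 / \<delta>\<^sup>2 * exp (\<delta> / 2 * N)) * exp (\<delta> / 2 * N)"
      proof -
        have "(\<delta> / 2 * N)\<^sup>2 / 2 \<le> exp (\<delta> / 2 * N)"
        proof -
          have nn: "0 \<le> \<delta> / 2 * N" using \<delta> by (simp add: N_def)
          show ?thesis using exp_lower_Taylor_quadratic[OF nn] nn by linarith
        qed
        then have "N\<^sup>2 \<le> 8 / \<delta>\<^sup>2 * exp (\<delta> / 2 * N)" using \<delta> by (simp add: field_simps power2_eq_square)
        then show ?thesis unfolding power_mult_distrib by (intro mult_right_mono mult_left_mono) auto
      qed
      also have "\<dots> = (norm (y - p))\<^sup>2 * (8 / \<delta>\<^sup>2) * exp (\<delta> * N)"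
        using exp_add[of "\<delta> / 2 * N" "\<delta> / 2 * N"] by (simp add: field_simps)
      finally have "exp (p \<bullet> T \<omega>) * \<bar>exp (?h \<omega>) - 1 - ?h \<omega>\<bar> * norm (g \<omega>) \<le> exp (p \<bullet> T \<omega>) * ((norm (y - p))\<^sup>2 * (8 / \<delta>\<^sup>2) * exp (\<delta> * N)) * norm (g \<omega>)"
        by (intro mult_right_mono mult_left_mono) auto
      moreover have "exp (y \<bullet> T \<omega>) *\<^sub>R g \<omega> - exp (p \<bullet> T \<omega>) *\<^sub>R g \<omega> - exp (p \<bullet> T \<omega>) *\<^sub>R (?h \<omega> *\<^sub>R g \<omega>) = (exp (p \<bullet> T \<omega>) * (exp (?h \<omega>) - 1 - ?h \<omega>)) *\<^sub>R g \<omega>"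
        by (simp add: eqy algebra_simps)
      ultimately show ?case
        by (simp add: N_def exp_add abs_mult mult_ac)
    qed
    also have "\<dots> = (norm (y - p))\<^sup>2 * (8 / \<delta>\<^sup>2 * B)" by (simp add: B_def)
    finally show ?thesis .
  qed
  have quot: "norm (laplace M T g y - laplace M T g p - laplace M T (\<lambda>\<omega>. ((y - p) \<bullet> T \<omega>) *\<^sub>R g \<omega>) p) / norm (y - p) \<le> norm (y - p) * (8 / \<delta>\<^sup>2 * B)"
    if "y \<noteq> p" "dist y p < \<delta> / 2" for y
  proof -
    have "norm (laplace M T g y - laplace M T g p - laplace M T (\<lambda>\<omega>. ((y - p) \<bullet> T \<omega>) *\<^sub>R g \<omega>) p) \<le> norm (y - p) * (8 / \<delta>\<^sup>2 * B) * norm (y - p)"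
      using rem[of y] that by (simp only: dist_norm power2_eq_square mult_ac less_imp_le)
    then show ?thesis using that by (subst pos_divide_le_eq) auto
  qed
  show ?thesis
  proof (rule has_derivativeI_sandwich[of "\<delta> / 2"])
    show "0 < \<delta> / 2" using \<delta> by simp
    show "((\<lambda>y. norm (y - p) * (8 / \<delta>\<^sup>2 * B)) \<longlongrightarrow> 0) (at p)"
    proof -
      have "((\<lambda>y. norm (y - p) * (8 / \<delta>\<^sup>2 * B)) \<longlongrightarrow> norm (p - p) * (8 / \<delta>\<^sup>2 * B)) (at p)"
        by (intro tendsto_intros)
      then show ?thesis by simp
    qed
    show "bounded_linear (\<lambda>w. laplace M T (\<lambda>\<omega>. (w \<bullet> T \<omega>) *\<^sub>R g \<omega>) p)" by (fact bl)
  qed (use quot in blast)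
qed

text \<open>
  Multiplying \<open>g\<close> by a linear form in \<open>T\<close> preserves the hypothesis, so the derivative formula can be
  iterated.
\<close>

theorem laplace_Ck_on:
  fixes T :: "'w \<Rightarrow> 'e::euclidean_space" and g :: "'w \<Rightarrow> complex"
  assumes T: "T \<in> borel_measurable M" and g: "g \<in> borel_measurable M"
    and U: "open U" and int: "\<And>p. p \<in> U \<Longrightarrow> integrable M (\<lambda>\<omega>. exp (p \<bullet> T \<omega>) *\<^sub>R g \<omega>)"
  shows "Ck_on k U (laplace M T g)"
  using g int
proof (induction k arbitrary: g)
  case 0
  have "isCont (laplace M T g) p" if "p \<in> U" for p
    using laplace_has_derivative[OF T 0(1) U that 0(2)] by (rule has_derivative_continuous)
  then show ?case by (simp add: continuous_at_imp_continuous_on)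
next
  case (Suc k)
  show ?case
  proof (rule Ck_on_SucI[OF U])
    show "(laplace M T g has_derivative (\<lambda>w. laplace M T (\<lambda>\<omega>. (w \<bullet> T \<omega>) *\<^sub>R g \<omega>) p)) (at p)" if "p \<in> U" for p
      by (rule laplace_has_derivative[OF T Suc.prems(1) U that Suc.prems(2)])
    show "Ck_on k U (laplace M T (\<lambda>\<omega>. (w \<bullet> T \<omega>) *\<^sub>R g \<omega>))" for w
    proof (rule Suc.IH)
      show "(\<lambda>\<omega>. (w \<bullet> T \<omega>) *\<^sub>R g \<omega>) \<in> borel_measurable M" using T Suc.prems(1) by measurable
      show "integrable M (\<lambda>\<omega>. exp (p \<bullet> T \<omega>) *\<^sub>R ((w \<bullet> T \<omega>) *\<^sub>R g \<omega>))" if "p \<in> U" for p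
        by (rule laplace_integrable_moment[OF T Suc.prems(1) U that Suc.prems(2)])
    qed
  qed
qed

section \<open>Pointwise bounds for Mehler's kernel\<close>

text \<open>
  After expansion of \<open>|x - y|\<^sup>2\<close> the exponent of Mehler's kernel is
  \<open>csch (2u) x\<bullet>y - coth (2u) (|x|\<^sup>2 + |y|\<^sup>2) / 2\<close>; these are its two coefficients. They are comparable to
  \<open>1/(2u)\<close> for small \<open>u\<close>, while \<open>csch (2u)\<close> and \<open>coth (2u) - 1\<close> decay like \<open>exp (-2u)\<close> and \<open>exp (-4u)\<close> for
  large \<open>u\<close>.
\<close>

definition coth2 :: "real \<Rightarrow> real" where "coth2 u = cosh (2 * u) / sinh (2 * u)"
definition csch2 :: "real \<Rightarrow> real" where "csch2 u = 1 / sinh (2 * u)"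

lemma csch2_pos: "u > 0 \<Longrightarrow> csch2 u > 0" by (simp add: csch2_def)

lemma coth2_square: "u > 0 \<Longrightarrow> (coth2 u)\<^sup>2 = 1 + (csch2 u)\<^sup>2"
  using cosh_square_eq[of "2 * u"] by (simp add: coth2_def csch2_def power_divide field_simps)

lemma coth2_ge_1: "u > 0 \<Longrightarrow> coth2 u \<ge> 1"
  using sinh_le_cosh_real[of "2 * u"] by (simp add: coth2_def)

lemma csch2_le_coth2: "u > 0 \<Longrightarrow> csch2 u \<le> coth2 u"
  by (simp add: coth2_def csch2_def divide_right_mono cosh_real_ge_1)

lemma sinh_le_mult_cosh: "z \<ge> 0 \<Longrightarrow> sinh z \<le> z * cosh z" for z :: real
proof -
  assume "z \<ge> 0"
  then have "(\<lambda>z. z * cosh z - sinh z) 0 \<le> (\<lambda>z::real. z * cosh z - sinh z) z"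
  proof (rule DERIV_nonneg_imp_nondecreasing)
    fix w :: real assume "0 \<le> w" "w \<le> z"
    then show "\<exists>y. ((\<lambda>z. z * cosh z - sinh z) has_real_derivative y) (at w) \<and> 0 \<le> y"
      by (intro exI[of _ "w * sinh w"]) (auto intro!: derivative_eq_intros)
  qed
  then show ?thesis by simp
qed

lemma le_sinh: "z \<ge> 0 \<Longrightarrow> z \<le> sinh z" for z :: real
  using real_le_x_sinh[of z] by (simp add: sinh_field_def exp_minus)

lemma csch2_le: "u > 0 \<Longrightarrow> csch2 u \<le> 1 / (2 * u)"
  unfolding csch2_def using le_sinh[of "2 * u"] by (intro divide_left_mono) (auto intro: mult_pos_pos)

lemma coth2_ge: "u > 0 \<Longrightarrow> 1 / (2 * u) \<le> coth2 u"
  using sinh_le_mult_cosh[of "2 * u"] by (simp add: coth2_def field_simps)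

lemma coth2_le: "u > 0 \<Longrightarrow> coth2 u \<le> 1 / (2 * u) + 1"
proof -
  assume u: "u > 0"
  have "2 * u * exp (- (2 * u)) \<le> 2 * u" using u by simp
  also have "\<dots> \<le> sinh (2 * u)" using le_sinh[of "2 * u"] u by simp
  finally have "2 * u * (cosh (2 * u) - sinh (2 * u)) \<le> sinh (2 * u)" unfolding cosh_minus_sinh .
  then show ?thesis using u by (simp add: coth2_def field_simps)
qed

lemma csch2_ge: "0 < u \<Longrightarrow> u \<le> 1 \<Longrightarrow> 1 / (16 * u) \<le> csch2 u"
proof -
  assume u: "0 < u" "u \<le> 1"
  have "exp (2::real) \<le> 8"
  proof -
    have "exp (2::real) = exp 1 * exp 1" by (simp flip: exp_add)
    also have "\<dots> \<le> 2.8 * 2.8" using e_less_272 by (intro mult_mono) auto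
    finally show ?thesis by simp
  qed
  moreover have "cosh (2 * u) \<le> exp (2 * u)" using u cosh_minus_sinh[of "2*u"] sinh_plus_cosh[of "2 * u"] by (smt (verit) sinh_real_nonneg_iff)
  moreover have "exp (2 * u) \<le> exp 2" using u by simp
  ultimately have "cosh (2 * u) \<le> 8" by linarith
  then have "2 * u * cosh (2 * u) \<le> 2 * u * 8" using u by (intro mult_left_mono) auto
  then have "sinh (2 * u) \<le> 16 * u" using sinh_le_mult_cosh[of "2 * u"] u by linarith
  then show ?thesis unfolding csch2_def using u by (intro divide_left_mono) auto
qed

lemma sinh_exp: "sinh (2 * u) = exp (2 * u) * (1 - exp (- (4 * u))) / 2" for u :: real
  by (simp add: sinh_field_def algebra_simps flip: exp_add)

lemma csch2_exp: "u > 0 \<Longrightarrow> csch2 u = 2 * exp (- (2 * u)) / (1 - exp (- (4 * u)))"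
proof -
  assume "u > 0"
  then have "1 - exp (- (4 * u)) > 0" by simp
  then show ?thesis unfolding csch2_def sinh_exp exp_minus[of "2 * u"] by (simp add: field_simps)
qed

lemma coth2_exp: "u > 0 \<Longrightarrow> coth2 u = 1 + 2 * exp (- (4 * u)) / (1 - exp (- (4 * u)))"
proof -
  assume u: "u > 0"
  have "coth2 u = 1 + exp (- (2 * u)) * csch2 u"
    using u cosh_minus_sinh[of "2 * u"] by (simp add: coth2_def csch2_def field_simps)
  then show ?thesis unfolding csch2_exp[OF u] by (simp flip: exp_add)
qed

lemma tanh_eq_coth2_csch2: "u > 0 \<Longrightarrow> tanh u = coth2 u - csch2 u"
proof -
  assume u: "u > 0"
  define S C where SC: "S = sinh u" "C = cosh u"
  have "C * C = S * S + 1" using cosh_square_eq[of u] by (simp add: SC power2_eq_square)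
  moreover have "S > 0" "C > 0" using u by (auto simp: SC)
  moreover have eqs: "coth2 u = (C * C + S * S) / (2 * S * C)" "csch2 u = 1 / (2 * S * C)" "tanh u = S / C"
    by (simp_all add: coth2_def csch2_def tanh_def SC sinh_double cosh_double power2_eq_square)
  ultimately show ?thesis unfolding eqs by (simp add: divide_simps)
qed

lemma norm_diff_square: "(norm (x - y))\<^sup>2 = (norm x)\<^sup>2 + (norm y)\<^sup>2 - 2 * (x \<bullet> y)" for x y :: "'a::real_inner"
  by (simp add: power2_norm_eq_inner inner_diff_left inner_diff_right inner_commute)

lemma sinh_le_two_pi_sinh: "u > 0 \<Longrightarrow> sinh (2 * u) \<le> 2 * pi * sinh (2 * u)"
  using mult_right_mono[of 1 "2 * pi" "sinh (2 * u)"] pi_gt3 by simp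

lemma heat_kernel_eq:
  fixes x y :: "real ^ 'n::finite"
  assumes "u > 0"
  shows "heat_kernel m u x y = exp (- (u * m)) * (2 * pi * sinh (2 * u)) powr (- (real CARD('n) / 2)) *
    exp (csch2 u * (x \<bullet> y) - coth2 u / 2 * ((norm x)\<^sup>2 + (norm y)\<^sup>2))"
proof -
  note norm_diff_square[of x y]
  moreover have "1 / tanh (2 * u) = coth2 u" by (simp add: coth2_def tanh_def)
  ultimately have "- ((norm (x - y))\<^sup>2 / (2 * tanh (2 * u))) - tanh u * (x \<bullet> y)
      = - (((norm x)\<^sup>2 + (norm y)\<^sup>2 - 2 * (x \<bullet> y)) * coth2 u / 2) - (coth2 u - csch2 u) * (x \<bullet> y)"
    using tanh_eq_coth2_csch2[OF assms] by (simp add: divide_simps flip: \<open>1 / tanh (2 * u) = coth2 u\<close>)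
  also have "\<dots> = csch2 u * (x \<bullet> y) - coth2 u / 2 * ((norm x)\<^sup>2 + (norm y)\<^sup>2)"
    by (simp add: field_simps)
  finally show ?thesis unfolding heat_kernel_def by (simp add: mult.commute)
qed

lemma powr_times_exp_bounded:
  fixes N \<delta> :: real
  assumes "\<delta> > 0" "N \<ge> 0"
  obtains C where "C > 0" "\<And>z. z > 0 \<Longrightarrow> z powr N * exp (- (\<delta> * z)) \<le> C"
proof -
  have "((\<lambda>z. z powr N * exp (- (\<delta> * z))) \<longlongrightarrow> 0) at_top" using assms(1) by real_asymp
  then have "eventually (\<lambda>z. z powr N * exp (- (\<delta> * z)) < 1) at_top" by (rule order_tendstoD) simp
  then obtain z0 where z0: "\<And>z. z \<ge> z0 \<Longrightarrow> z powr N * exp (- (\<delta> * z)) < 1"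
    unfolding eventually_at_top_linorder by blast
  have "z powr N * exp (- (\<delta> * z)) \<le> 1 + \<bar>z0\<bar> powr N" if "z > 0" for z
  proof (cases "z \<ge> z0")
    case True
    then show ?thesis using z0[of z] powr_ge_zero[of "\<bar>z0\<bar>" N] by linarith
  next
    case False
    have "z powr N * exp (- (\<delta> * z)) \<le> z powr N * 1" using assms that by (intro mult_left_mono) auto
    also have "\<dots> \<le> \<bar>z0\<bar> powr N" using False that assms by (simp add: powr_mono2)
    finally show ?thesis by simp
  qed
  moreover have "1 + \<bar>z0\<bar> powr N > 0" using powr_ge_zero[of "\<bar>z0\<bar>" N] by linarith
  ultimately show ?thesis using that by blast
qed

text \<open>
  The integrand of the Poisson kernel at \<open>(t, x)\<close>, split into a factor free of \<open>(t, x)\<close> and an exponential.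
  The exponent is affine in \<open>t\<^sup>2\<close>, \<open>|x|\<^sup>2\<close> and \<open>x\<close>. Treating the first two as independent parameters
  \<open>a\<close> and \<open>b\<close> makes the Poisson integral a Laplace transform in \<open>(a, b, x)\<close>.
\<close>

definition kern_base :: "real \<Rightarrow> real \<Rightarrow> real \<Rightarrow> real ^ 'n::finite \<Rightarrow> real" where
  "kern_base m \<nu> u y = u powr (- (1 + \<nu>)) * exp (- (u * m)) *
     (2 * pi * sinh (2 * u)) powr (- (real CARD('n) / 2)) * exp (- (coth2 u / 2 * (norm y)\<^sup>2))"

definition kern_exp :: "real \<Rightarrow> real \<Rightarrow> real ^ 'n \<Rightarrow> real \<Rightarrow> real ^ 'n::finite \<Rightarrow> real" where
  "kern_exp a b x u y = exp (csch2 u * (x \<bullet> y) - a / (4 * u) - b * (coth2 u / 2))"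

lemma kern_nonneg: "0 \<le> kern_base m \<nu> u y" "0 < kern_exp a b x u z"
  by (simp_all add: kern_base_def kern_exp_def)

lemma kern_eq:
  "kern_base m \<nu> u y * kern_exp a b x u y = u powr (- (1 + \<nu>)) * (2 * pi * sinh (2 * u)) powr (- (real CARD('n) / 2)) *
     exp (- (u * m)) * exp (csch2 u * (x \<bullet> y) - a / (4 * u) - b * (coth2 u / 2) - coth2 u / 2 * (norm y)\<^sup>2)"
  for x y :: "real ^ 'n::finite"
proof -
  have "exp (- (coth2 u / 2 * (norm y)\<^sup>2)) * exp (csch2 u * (x \<bullet> y) - a / (4 * u) - b * (coth2 u / 2))
    = exp (csch2 u * (x \<bullet> y) - a / (4 * u) - b * (coth2 u / 2) - coth2 u / 2 * (norm y)\<^sup>2)"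
    by (simp flip: exp_add)
  then show ?thesis by (simp add: kern_base_def kern_exp_def mult_ac)
qed

lemma coth2_weight_le:
  assumes "u > 0"
  shows "- (b * (coth2 u / 2)) \<le> - (b / (4 * u)) + \<bar>b\<bar> / 2"
proof -
  have "\<bar>b * (coth2 u - 1 / (2 * u))\<bar> \<le> \<bar>b\<bar> * 1"
    unfolding abs_mult using coth2_ge[OF assms] coth2_le[OF assms] by (intro mult_left_mono) auto
  moreover have "b * (coth2 u - 1 / (2 * u)) = 2 * (b * (coth2 u / 2)) - 2 * (b / (4 * u))"
    by (simp add: algebra_simps)
  ultimately show ?thesis by (simp only: abs_le_iff) linarith
qed

text \<open>
  For small \<open>u\<close> both \<open>coth (2u)\<close> and \<open>csch (2u)\<close> behave like \<open>1/(2u)\<close>, so the exponent is close to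
  \<open>-(a + b - |x|\<^sup>2)/(4u) - |x - y|\<^sup>2/(4u)\<close>. The condition \<open>|x|\<^sup>2 < a + b\<close> is exactly what makes the kernel
  vanish as \<open>u \<rightarrow> 0\<close> even at \<open>y = x\<close>, and the coefficient of \<open>|y|\<^sup>2\<close> becomes as negative as desired.
\<close>

lemma kern_small:
  fixes x :: "real ^ 'n::finite"
  assumes "a + b > (norm x)\<^sup>2" "\<nu> > 0"
  obtains u0 \<delta> C where "0 < u0" "u0 \<le> 1" "0 < \<delta>" "0 < C"
    "\<And>u y. 0 < u \<Longrightarrow> u \<le> u0 \<Longrightarrow> kern_base m \<nu> u y * kern_exp a b x u y \<le> C * exp (- (\<delta> / u)) * exp (- (norm y)\<^sup>2)"
proof -
  define A where "A = a + b"
  \<comment> \<open>A weight slightly above 1 for \<open>2 x\<bullet>y \<le> k |x|\<^sup>2 + |y|\<^sup>2 / k\<close> that still satisfies \<open>k |x|\<^sup>2 < A\<close>.\<close>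
  define k where "k = 1 + (A - (norm x)\<^sup>2) / (2 * ((norm x)\<^sup>2 + 1))"
  have xpos: "(norm x)\<^sup>2 + 1 > 0" by (simp add: add_nonneg_pos)
  have k: "k > 1" using assms(1) xpos by (simp add: k_def A_def)
  have "k * (norm x)\<^sup>2 = (norm x)\<^sup>2 + (A - (norm x)\<^sup>2) / 2 * ((norm x)\<^sup>2 / ((norm x)\<^sup>2 + 1))"
    by (simp add: k_def field_simps)
  also have "\<dots> \<le> (norm x)\<^sup>2 + (A - (norm x)\<^sup>2) / 2 * 1"
    using assms(1) xpos by (intro add_left_mono mult_left_mono) (auto simp: A_def)
  also have "\<dots> < A" using assms(1) by (simp add: A_def field_simps)
  finally have kx: "k * (norm x)\<^sup>2 < A" .
  define \<delta> where "\<delta> = (A - k * (norm x)\<^sup>2) / 8"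
  have \<delta>: "\<delta> > 0" using kx by (simp add: \<delta>_def)
  define N where "N = 1 + \<nu> + real CARD('n) / 2"
  obtain D where D: "D > 0" "\<And>z. z > 0 \<Longrightarrow> z powr N * exp (- (\<delta> * z)) \<le> D"
    using powr_times_exp_bounded[OF \<delta>, of N] assms(2) by (auto simp: N_def)
  \<comment> \<open>Below this time \<open>csch (2u) (1 - 1/k) \<ge> 2\<close>, which yields the full Gaussian \<open>exp (- |y|\<^sup>2)\<close>.\<close>
  define u0 where "u0 = min 1 ((1 - 1 / k) / 32)"
  have u0: "0 < u0" "u0 \<le> 1" using k by (auto simp: u0_def)
  define C where "C = D * exp (\<bar>m\<bar> + \<bar>b\<bar> / 2)"
  have "kern_base m \<nu> u y * kern_exp a b x u y \<le> C * exp (- (\<delta> / u)) * exp (- (norm y)\<^sup>2)"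
    if u: "0 < u" "u \<le> u0" for u and y :: "real ^ 'n"
  proof -
    have u1: "u \<le> 1" using u u0 by simp
    have s: "csch2 u > 0" "csch2 u \<le> 1 / (2 * u)" using csch2_pos csch2_le u by auto
    have "0 \<le> (norm (sqrt k *\<^sub>R x - (1 / sqrt k) *\<^sub>R y))\<^sup>2" by simp
    also have "\<dots> = k * (norm x)\<^sup>2 + (norm y)\<^sup>2 / k - 2 * (x \<bullet> y)"
      unfolding norm_diff_square using k by (simp add: power_mult_distrib power_divide)
    finally have "csch2 u * (x \<bullet> y) \<le> csch2 u * (k * (norm x)\<^sup>2 / 2 + (norm y)\<^sup>2 / k / 2)"
      using s by (intro mult_left_mono) auto
    also have "\<dots> \<le> k * (norm x)\<^sup>2 / (4 * u) + csch2 u * ((norm y)\<^sup>2 / k / 2)"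
      using mult_right_mono[OF s(2), of "k * (norm x)\<^sup>2 / 2"] k by (simp add: algebra_simps)
    finally have e1: "csch2 u * (x \<bullet> y) \<le> k * (norm x)\<^sup>2 / (4 * u) + csch2 u / k * (norm y)\<^sup>2 / 2" by (simp add: mult_ac)
    have e2: "- (b * (coth2 u / 2)) \<le> - (b / (4 * u)) + \<bar>b\<bar> / 2" by (rule coth2_weight_le[OF u(1)])
    have "2 / (1 - 1 / k) \<le> 1 / (16 * u)"
      using u k by (simp add: u0_def field_simps)
    also have "\<dots> \<le> csch2 u" using csch2_ge u u1 by simp
    finally have "2 \<le> csch2 u * (1 - 1 / k)" using k by (simp add: field_simps)
    moreover have "csch2 u \<le> coth2 u" using csch2_le_coth2 u by simp
    ultimately have "2 \<le> coth2 u - csch2 u / k" by (simp add: algebra_simps)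
    then have "2 * (norm y)\<^sup>2 \<le> (coth2 u - csch2 u / k) * (norm y)\<^sup>2" by (intro mult_right_mono) auto
    then have e3: "csch2 u / k * (norm y)\<^sup>2 / 2 - coth2 u / 2 * (norm y)\<^sup>2 \<le> - (norm y)\<^sup>2" by (simp add: algebra_simps)
    have "k * (norm x)\<^sup>2 / (4 * u) - a / (4 * u) - b / (4 * u) = - (2 * \<delta> / u)"
      using u by (simp add: \<delta>_def A_def field_simps)
    then have expo: "csch2 u * (x \<bullet> y) - a / (4 * u) - b * (coth2 u / 2) - coth2 u / 2 * (norm y)\<^sup>2
        \<le> - (2 * \<delta> / u) + \<bar>b\<bar> / 2 - (norm y)\<^sup>2" using e1 e2 e3 by linarith
    have em: "exp (- (u * m)) \<le> exp \<bar>m\<bar>"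
    proof -
      have "\<bar>u * m\<bar> \<le> 1 * \<bar>m\<bar>" unfolding abs_mult using u u1 by (intro mult_right_mono) auto
      then show ?thesis by simp
    qed
    have "u \<le> 2 * pi * sinh (2 * u)"
    proof -
      have "u \<le> 2 * u" using u by simp
      also have "\<dots> \<le> sinh (2 * u)" using le_sinh[of "2 * u"] u by simp
      also have "\<dots> \<le> 2 * pi * sinh (2 * u)" using sinh_le_two_pi_sinh[OF u(1)] .
      finally show ?thesis .
    qed
    then have "(2 * pi * sinh (2 * u)) powr (- (real CARD('n) / 2)) \<le> u powr (- (real CARD('n) / 2))"
      using u by (intro powr_mono2') auto
    then have pw: "u powr (- (1 + \<nu>)) * (2 * pi * sinh (2 * u)) powr (- (real CARD('n) / 2)) \<le> (1 / u) powr N"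
    proof -
      have "(1 / u) powr N = u powr (- (1 + \<nu>) + - (real CARD('n) / 2))"
        using u by (simp add: N_def powr_divide powr_minus_divide[symmetric])
      also have "\<dots> = u powr (- (1 + \<nu>)) * u powr (- (real CARD('n) / 2))" by (rule powr_add)
      finally have "(1 / u) powr N = u powr (- (1 + \<nu>)) * u powr (- (real CARD('n) / 2))" .
      then show ?thesis using \<open>(2 * pi * sinh (2 * u)) powr (- (real CARD('n) / 2)) \<le> u powr (- (real CARD('n) / 2))\<close>
        by (simp add: mult_left_mono)
    qed
    have "kern_base m \<nu> u y * kern_exp a b x u y = (u powr (- (1 + \<nu>)) * (2 * pi * sinh (2 * u)) powr (- (real CARD('n) / 2))) *
       exp (- (u * m)) * exp (csch2 u * (x \<bullet> y) - a / (4 * u) - b * (coth2 u / 2) - coth2 u / 2 * (norm y)\<^sup>2)"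
      unfolding kern_eq by (simp only: mult_ac)
    also have "\<dots> \<le> (1 / u) powr N * exp \<bar>m\<bar> * exp (- (2 * \<delta> / u) + \<bar>b\<bar> / 2 - (norm y)\<^sup>2)"
      using pw em expo by (intro mult_mono mult_nonneg_nonneg) auto
    also have "\<dots> = ((1 / u) powr N * exp (- (\<delta> * (1 / u)))) * exp (\<bar>m\<bar> + \<bar>b\<bar> / 2) * exp (- (\<delta> / u)) * exp (- (norm y)\<^sup>2)"
      by (simp add: mult.assoc flip: exp_add)
    also have "\<dots> \<le> D * exp (\<bar>m\<bar> + \<bar>b\<bar> / 2) * exp (- (\<delta> / u)) * exp (- (norm y)\<^sup>2)"
      using D(2)[of "1 / u"] u by (intro mult_right_mono) auto
    finally show ?thesis by (simp add: C_def)
  qed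
  moreover have "C > 0" using D by (simp add: C_def)
  ultimately show ?thesis using that u0 \<delta> by blast
qed

text \<open>
  For large \<open>u\<close> the cross term is at most a constant times \<open>z = exp (-2u) |y|\<close>, and \<open>coth (2u) - 1\<close>
  contributes \<open>-z\<^sup>2\<close>, which dominates it. What remains is the stationary Gaussian
  \<open>exp (- |y|\<^sup>2 / 2)\<close>, the spectral decay \<open>exp (-(d + m) u)\<close>, and a cutoff to times with \<open>exp (2u) \<ge> |y|\<close>.
\<close>

lemma kern_large:
  fixes x :: "real ^ 'n::finite"
  assumes "a + b \<ge> 0" "0 < u0"
  obtains C where "0 < C"
    "\<And>u y. u0 \<le> u \<Longrightarrow> kern_base m \<nu> u y * kern_exp a b x u y \<le>
      C * exp (- ((norm y)\<^sup>2 / 2)) * (u powr (- (1 + \<nu>)) * exp (- ((real CARD('n) + m) * u)) * exp (- ((exp (- (2 * u)) * norm y)\<^sup>2 / 2)))"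
proof -
  define q where "q = 1 - exp (- (4 * u0))"
  have q: "q > 0" using assms(2) by (simp add: q_def)
  define C1 where "C1 = 2 / q"
  define C where "C = (q / 2) powr (- (real CARD('n) / 2)) * exp (\<bar>b\<bar> / 2 + C1\<^sup>2 * (norm x)\<^sup>2 / 2)"
  have "kern_base m \<nu> u y * kern_exp a b x u y \<le>
      C * exp (- ((norm y)\<^sup>2 / 2)) * (u powr (- (1 + \<nu>)) * exp (- ((real CARD('n) + m) * u)) * exp (- ((exp (- (2 * u)) * norm y)\<^sup>2 / 2)))"
    if uu: "u0 \<le> u" for u and y :: "real ^ 'n"
  proof -
    have u: "u > 0" using uu assms by simp
    have qu: "q \<le> 1 - exp (- (4 * u))" using uu by (simp add: q_def)
    have qu1: "1 - exp (- (4 * u)) \<le> 1" by simp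
    have qup: "1 - exp (- (4 * u)) > 0" using qu q by linarith
    define z where "z = exp (- (2 * u)) * norm y"
    have s: "csch2 u \<le> C1 * exp (- (2 * u))"
      unfolding csch2_exp[OF u] C1_def using qu q qup by (simp add: frac_le)
    have "csch2 u * (x \<bullet> y) \<le> csch2 u * (norm x * norm y)"
      using csch2_pos[OF u] norm_cauchy_schwarz[of x y] by (intro mult_left_mono) auto
    also have "\<dots> \<le> C1 * exp (- (2 * u)) * (norm x * norm y)" using s by (intro mult_right_mono) auto
    finally have e1: "csch2 u * (x \<bullet> y) \<le> (C1 * norm x) * z" by (simp add: z_def mult_ac)
    have amgm: "(C1 * norm x) * z \<le> C1\<^sup>2 * (norm x)\<^sup>2 / 2 + z\<^sup>2 / 2"
      using zero_le_power2[of "C1 * norm x - z"] by (simp add: power2_diff power_mult_distrib)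
    have "1 + 2 * exp (- (4 * u)) \<le> coth2 u"
      unfolding coth2_exp[OF u] using qu1 qup by (simp add: pos_le_divide_eq mult_left_le)
    then have "(1 + 2 * exp (- (4 * u))) * (norm y)\<^sup>2 \<le> coth2 u * (norm y)\<^sup>2" by (intro mult_right_mono) auto
    moreover have "exp (- (4 * u)) * (norm y)\<^sup>2 = z\<^sup>2"
      by (simp add: z_def power_mult_distrib flip: exp_double)
    ultimately have e2: "- (coth2 u / 2 * (norm y)\<^sup>2) \<le> - ((norm y)\<^sup>2 / 2) - z\<^sup>2" by (simp add: algebra_simps)
    have "0 \<le> (a + b) / (4 * u)" using assms u by simp
    then have e3: "- (a / (4 * u)) - b * (coth2 u / 2) \<le> \<bar>b\<bar> / 2"
      using coth2_weight_le[OF u, of b] unfolding add_divide_distrib by linarith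
    have expo: "csch2 u * (x \<bullet> y) - a / (4 * u) - b * (coth2 u / 2) - coth2 u / 2 * (norm y)\<^sup>2
      \<le> \<bar>b\<bar> / 2 + C1\<^sup>2 * (norm x)\<^sup>2 / 2 - (norm y)\<^sup>2 / 2 - z\<^sup>2 / 2"
      using e1 amgm e2 e3 by linarith
    have "q / 2 * exp (2 * u) \<le> 2 * pi * sinh (2 * u)"
    proof -
      have "q / 2 * exp (2 * u) \<le> sinh (2 * u)"
        unfolding sinh_exp using mult_right_mono[OF qu, of "exp (2 * u) / 2"] by (simp add: mult_ac)
      also have "\<dots> \<le> 2 * pi * sinh (2 * u)" using sinh_le_two_pi_sinh[OF u] .
      finally show ?thesis .
    qed
    then have "(2 * pi * sinh (2 * u)) powr (- (real CARD('n) / 2)) \<le> (q / 2 * exp (2 * u)) powr (- (real CARD('n) / 2))"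
      using q by (intro powr_mono2') auto
    also have "\<dots> = (q / 2) powr (- (real CARD('n) / 2)) * exp (- (real CARD('n) * u))"
      using q by (subst powr_mult) (auto simp: powr_def)
    finally have pw: "(2 * pi * sinh (2 * u)) powr (- (real CARD('n) / 2)) \<le> (q / 2) powr (- (real CARD('n) / 2)) * exp (- (real CARD('n) * u))" .
    have "kern_base m \<nu> u y * kern_exp a b x u y = (u powr (- (1 + \<nu>)) * exp (- (u * m))) * (2 * pi * sinh (2 * u)) powr (- (real CARD('n) / 2)) *
       exp (csch2 u * (x \<bullet> y) - a / (4 * u) - b * (coth2 u / 2) - coth2 u / 2 * (norm y)\<^sup>2)"
      unfolding kern_eq by (simp only: mult_ac)
    also have "\<dots> \<le> (u powr (- (1 + \<nu>)) * exp (- (u * m))) * ((q / 2) powr (- (real CARD('n) / 2)) * exp (- (real CARD('n) * u))) *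
        exp (\<bar>b\<bar> / 2 + C1\<^sup>2 * (norm x)\<^sup>2 / 2 - (norm y)\<^sup>2 / 2 - z\<^sup>2 / 2)"
      using pw expo by (intro mult_mono mult_nonneg_nonneg) auto
    also have "\<dots> = C * exp (- ((norm y)\<^sup>2 / 2)) * (u powr (- (1 + \<nu>)) * exp (- ((real CARD('n) + m) * u)) * exp (- (z\<^sup>2 / 2)))"
    proof -
      have "exp (\<bar>b\<bar> / 2 + C1\<^sup>2 * (norm x)\<^sup>2 / 2 - (norm y)\<^sup>2 / 2 - z\<^sup>2 / 2)
        = exp (\<bar>b\<bar> / 2 + C1\<^sup>2 * (norm x)\<^sup>2 / 2) * exp (- ((norm y)\<^sup>2 / 2)) * exp (- (z\<^sup>2 / 2))"
        by (simp flip: exp_add)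
      moreover have "exp (- ((real CARD('n) + m) * u)) = exp (- (u * m)) * exp (- (real CARD('n) * u))"
        by (simp add: algebra_simps flip: exp_add)
      ultimately show ?thesis unfolding C_def by (simp only: mult_ac)
    qed
    finally show ?thesis by (simp add: z_def)
  qed
  moreover have "C > 0" using q by (simp add: C_def)
  ultimately show ?thesis using that by blast
qed

section \<open>The Poisson kernel is dominated by the weight\<close>

text \<open>
  The radial profile of the weight without its Gaussian factor, with \<open>\<kappa> = d + m\<close> as parameter.
\<close>

definition tail_weight :: "real \<Rightarrow> real \<Rightarrow> real \<Rightarrow> real" where
  "tail_weight \<kappa> \<nu> R = (if \<kappa> = 0 then ln (exp 1 + R) powr (- \<nu>)
     else (1 + R) powr (- (\<kappa> / 2)) * ln (exp 1 + R) powr (- (1 + \<nu>)))"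

lemma ln_e_plus_ge_1: "R \<ge> 0 \<Longrightarrow> ln (exp 1 + R) \<ge> 1" for R :: real
  by (subst ln_ge_iff) (auto intro: add_pos_nonneg)

lemma tail_weight_pos: "R \<ge> 0 \<Longrightarrow> tail_weight \<kappa> \<nu> R > 0"
  using ln_e_plus_ge_1[of R] by (auto simp: tail_weight_def)

lemma weight_phi_eq:
  fixes y :: "real ^ 'n::finite"
  shows "weight_phi m \<nu> y = exp (- ((norm y)\<^sup>2 / 2)) * tail_weight (real CARD('n) + m) \<nu> (norm y)"
proof (cases "m = - real CARD('n)")
  case True
  then show ?thesis by (simp add: weight_phi_def tail_weight_def powr_minus_divide)
next
  case False
  then have "real CARD('n) + m \<noteq> 0" by linarith
  then show ?thesis using False unfolding weight_phi_def tail_weight_def powr_minus_divide by simp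
qed

lemma exp_le_tail_weight:
  assumes "\<kappa> \<ge> 0" "\<nu> > 0" "\<delta> > 0"
  obtains C where "C > 0" "\<And>R. R \<ge> 0 \<Longrightarrow> exp (- (\<delta> * R)) \<le> C * tail_weight \<kappa> \<nu> R"
proof -
  define N where "N = \<kappa> / 2 + (1 + \<nu>)"
  have N: "N \<ge> 0" "\<nu> \<le> N" using assms by (auto simp: N_def)
  obtain D where D: "D > 0" "\<And>z. z > 0 \<Longrightarrow> z powr N * exp (- (\<delta> * z)) \<le> D"
    using powr_times_exp_bounded[OF assms(3) N(1)] by blast
  have "exp (- (\<delta> * R)) \<le> (D * exp (3 * \<delta>)) * tail_weight \<kappa> \<nu> R" if R: "R \<ge> 0" for R
  proof -
    define z where "z = 3 + R"
    have z: "z > 0" "exp 1 + R \<le> z" "1 + R \<le> z" "z \<ge> 1" using R e_less_272 by (auto simp: z_def)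
    have l1: "ln (exp 1 + R) \<ge> 1" using ln_e_plus_ge_1[OF R] .
    have l2: "ln (exp 1 + R) \<le> z"
      using ln_le_minus_one[of "exp 1 + R"] z R by (smt (verit) exp_gt_zero)
    have tw: "z powr (- N) \<le> tail_weight \<kappa> \<nu> R"
    proof (cases "\<kappa> = 0")
      case True
      have "z powr (- N) \<le> z powr (- \<nu>)" using N z by (intro powr_mono) auto
      also have "\<dots> \<le> ln (exp 1 + R) powr (- \<nu>)" using l1 l2 assms by (intro powr_mono2') auto
      finally show ?thesis using True by (simp add: tail_weight_def)
    next
      case False
      have "z powr (- N) = z powr (- (\<kappa> / 2)) * z powr (- (1 + \<nu>))" by (simp add: N_def flip: powr_add)
      also have "\<dots> \<le> (1 + R) powr (- (\<kappa> / 2)) * ln (exp 1 + R) powr (- (1 + \<nu>))"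
        using l1 l2 z R assms by (intro mult_mono powr_mono2') auto
      finally show ?thesis using False by (simp add: tail_weight_def)
    qed
    have "exp (- (\<delta> * R)) = exp (3 * \<delta>) * (z powr N * exp (- (\<delta> * z))) * z powr (- N)"
      using z by (simp add: z_def powr_minus field_simps flip: exp_add)
    also have "\<dots> \<le> exp (3 * \<delta>) * D * tail_weight \<kappa> \<nu> R"
      using D(2)[OF z(1)] D(1) tw by (intro mult_mono) auto
    finally show ?thesis by (simp add: mult_ac)
  qed
  moreover have "D * exp (3 * \<delta>) > 0" using D by simp
  ultimately show ?thesis using that by blast
qed

lemma gaussian_le_tail_weight:
  assumes "\<kappa> \<ge> 0" "\<nu> > 0"
  obtains C where "C > 0" "\<And>R. R \<ge> 0 \<Longrightarrow> exp (- (R\<^sup>2 / 2)) \<le> C * tail_weight \<kappa> \<nu> R"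
proof -
  obtain C where C: "C > 0" "\<And>R. R \<ge> 0 \<Longrightarrow> exp (- (1 * R)) \<le> C * tail_weight \<kappa> \<nu> R"
    using exp_le_tail_weight[OF assms zero_less_one] by blast
  have "exp (- (R\<^sup>2 / 2)) \<le> exp (1/2) * C * tail_weight \<kappa> \<nu> R" if "R \<ge> 0" for R
  proof -
    have "- (R\<^sup>2 / 2) \<le> 1 / 2 + - (1 * R)" using zero_le_power2[of "R - 1"] by (simp add: power2_diff)
    then have "exp (- (R\<^sup>2 / 2)) \<le> exp (1/2) * exp (- (1 * R))" by (simp flip: exp_add)
    also have "\<dots> \<le> exp (1/2) * (C * tail_weight \<kappa> \<nu> R)" using C(2)[OF that] by (intro mult_left_mono) auto
    finally show ?thesis by (simp add: mult_ac)
  qed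
  then show ?thesis using that[of "exp (1/2) * C"] C(1) by simp
qed

lemma nn_integral_powr_tail:
  assumes "v > 0" "\<nu> > 0"
  shows "(\<integral>\<^sup>+u\<in>{v..}. ennreal (u powr (- (1 + \<nu>))) \<partial>lborel) = ennreal (v powr (- \<nu>) / \<nu>)"
proof -
  have "(\<integral>\<^sup>+u\<in>{v..}. ennreal (u powr (- (1 + \<nu>))) \<partial>lborel) = ennreal (0 - (- (v powr (- \<nu>) / \<nu>)))"
  proof (rule nn_integral_FTC_atLeast)
    fix u assume "v \<le> u"
    then show "((\<lambda>u. - (u powr (- \<nu>) / \<nu>)) has_real_derivative u powr (- (1 + \<nu>))) (at u)"
      using assms by (auto intro!: derivative_eq_intros simp: powr_diff powr_minus powr_add field_simps)
  next
    show "((\<lambda>u. - (u powr (- \<nu>) / \<nu>)) \<longlongrightarrow> 0) at_top" using assms(2) by real_asymp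
  qed auto
  then show ?thesis by simp
qed

lemma nn_integral_exp_abs_le:
  assumes "k > 0"
  shows "(\<integral>\<^sup>+u. ennreal (exp (- (k * \<bar>u - V\<bar>))) \<partial>lborel) \<le> ennreal (2 / k)"
proof -
  have half: "(\<integral>\<^sup>+u\<in>{0..}. ennreal (exp (- (k * u))) \<partial>lborel) = ennreal (1 / k)"
  proof -
    have "(\<integral>\<^sup>+u\<in>{0..}. ennreal (exp (- (k * u))) \<partial>lborel) = ennreal (0 - (- (exp (- (k * 0)) / k)))"
    proof (rule nn_integral_FTC_atLeast)
      show "((\<lambda>u. - (exp (- (k * u)) / k)) has_real_derivative exp (- (k * u))) (at u)" for u
        using assms by (auto intro!: derivative_eq_intros)
      show "((\<lambda>u. - (exp (- (k * u)) / k)) \<longlongrightarrow> 0) at_top" using assms by real_asymp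
    qed auto
    then show ?thesis by simp
  qed
  have "(\<integral>\<^sup>+u. ennreal (exp (- (k * \<bar>u - V\<bar>))) \<partial>lborel) = (\<integral>\<^sup>+u. ennreal (exp (- (k * \<bar>u\<bar>))) \<partial>lborel)"
    using nn_integral_real_affine[of "\<lambda>u. ennreal (exp (- (k * \<bar>u - V\<bar>)))" 1 V] by simp
  also have "\<dots> \<le> (\<integral>\<^sup>+u. ennreal (exp (- (k * u))) * indicator {0..} u + ennreal (exp (- (k * (- u)))) * indicator {0..} (- u) \<partial>lborel)"
    by (intro nn_integral_mono) (auto split: split_indicator)
  also have "\<dots> = (\<integral>\<^sup>+u\<in>{0..}. ennreal (exp (- (k * u))) \<partial>lborel) + (\<integral>\<^sup>+u. ennreal (exp (- (k * (- u)))) * indicator {0..} (- u) \<partial>lborel)"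
    by (subst nn_integral_add) auto
  also have "(\<integral>\<^sup>+u. ennreal (exp (- (k * (- u)))) * indicator {0..} (- u) \<partial>lborel) = (\<integral>\<^sup>+u\<in>{0..}. ennreal (exp (- (k * u))) \<partial>lborel)"
    using nn_integral_real_affine[of "\<lambda>u. ennreal (exp (- (k * u))) * indicator {0..} u" "-1" 0] by simp
  finally show ?thesis unfolding half using assms by (simp flip: ennreal_plus)
qed

text \<open>
  The last factor cuts the integral off below \<open>V = ln (e + R) / 2\<close>. If \<open>\<kappa> = 0\<close>, the rest of the integrand is
  \<open>u\<close> to the power \<open>-1 - \<nu>\<close>, and its integral over \<open>u \<ge> V\<close> is of order \<open>V powr (- \<nu>)\<close>. If \<open>\<kappa> > 0\<close>, the
  exponential decay confines the mass to a bounded distance from \<open>V\<close>, and the integral is of the order of the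
  integrand there, which is \<open>exp (- \<kappa> V) V powr (-1 - \<nu>)\<close>.
\<close>

lemma tail_integral_le:
  assumes "\<kappa> \<ge> 0" "\<nu> > 0" "u0 > 0" "u0 \<le> 1"
  obtains C where "C > 0" "\<And>R. R \<ge> 0 \<Longrightarrow>
    (\<integral>\<^sup>+u\<in>{u0..}. ennreal (u powr (- (1 + \<nu>)) * exp (- (\<kappa> * u)) * exp (- ((exp (- (2 * u)) * R)\<^sup>2 / 2))) \<partial>lborel)
      \<le> ennreal (C * tail_weight \<kappa> \<nu> R)"
proof (cases "\<kappa> = 0")
  case True
  obtain D where D: "D > 0" "\<And>R. R \<ge> 0 \<Longrightarrow> exp (- (1/2 * R)) \<le> D * tail_weight \<kappa> \<nu> R"
    using exp_le_tail_weight[OF assms(1,2), of "1/2"] by auto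
  define C where "C = u0 powr (- \<nu>) / \<nu> * (D * exp 2) + (1/4) powr (- \<nu>) / \<nu>"
  have "(\<integral>\<^sup>+u\<in>{u0..}. ennreal (u powr (- (1 + \<nu>)) * exp (- (\<kappa> * u)) * exp (- ((exp (- (2 * u)) * R)\<^sup>2 / 2))) \<partial>lborel)
      \<le> ennreal (C * tail_weight \<kappa> \<nu> R)" if R: "R \<ge> 0" for R
  proof -
    \<comment> \<open>Halving the cutoff time makes the cutoff factor exponentially small in \<open>R\<close> below it, at the cost of a constant only.\<close>
    define v where "v = ln (exp 1 + R) / 4"
    have l1: "ln (exp 1 + R) \<ge> 1" using ln_e_plus_ge_1[OF R] .
    have v: "v > 0" using l1 by (simp add: v_def)
    let ?p = "\<lambda>u. ennreal (u powr (- (1 + \<nu>)))"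
    have pt: "ennreal (u powr (- (1 + \<nu>)) * exp (- (\<kappa> * u)) * exp (- ((exp (- (2 * u)) * R)\<^sup>2 / 2))) * indicator {u0..} u
      \<le> ennreal (exp 2 * exp (- (1/2 * R))) * (?p u * indicator {u0..} u) + ?p u * indicator {v..} u" for u
    proof (cases "u0 \<le> u \<and> u < v")
      case True
      have eR: "exp 1 + R > 0" using R by (simp add: add_pos_nonneg)
      have "exp (4 * u) \<le> exp 1 + R" using True eR by (subst ln_ge_iff[symmetric]) (auto simp: v_def)
      then have "R\<^sup>2 / (exp 1 + R) \<le> R\<^sup>2 / exp (4 * u)" by (intro divide_left_mono) (auto intro: mult_pos_pos eR)
      moreover have "(exp (- (2 * u)) * R)\<^sup>2 = R\<^sup>2 / exp (4 * u)"
        by (simp add: power_mult_distrib exp_minus field_simps flip: exp_double)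
      moreover have "R - 4 \<le> R\<^sup>2 / (exp 1 + R)"
      proof -
        have "(R - 4) * (exp 1 + R) = R\<^sup>2 - (4 - exp 1) * R - 4 * exp 1" by (simp add: algebra_simps power2_eq_square)
        moreover have "0 \<le> (4 - exp 1) * R" using R e_less_272 by (intro mult_nonneg_nonneg) auto
        ultimately have "(R - 4) * (exp 1 + R) \<le> R\<^sup>2" using exp_gt_zero[of "1::real"] by linarith
        then show ?thesis using eR by (simp add: pos_le_divide_eq)
      qed
      ultimately have "- ((exp (- (2 * u)) * R)\<^sup>2 / 2) \<le> 2 + - (1/2 * R)" by linarith
      then have "exp (- ((exp (- (2 * u)) * R)\<^sup>2 / 2)) \<le> exp 2 * exp (- (1/2 * R))" by (simp flip: exp_add)
      then have "u powr (- (1 + \<nu>)) * exp (- (\<kappa> * u)) * exp (- ((exp (- (2 * u)) * R)\<^sup>2 / 2)) \<le> exp 2 * exp (- (1/2 * R)) * u powr (- (1 + \<nu>))"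
        unfolding \<open>\<kappa> = 0\<close> using mult_left_mono[of _ _ "u powr (- (1 + \<nu>))"] by (simp only: mult_zero_left minus_zero exp_zero mult_1_right mult.commute[of "exp 2 * _"] powr_ge_zero)
      then have "ennreal (u powr (- (1 + \<nu>)) * exp (- (\<kappa> * u)) * exp (- ((exp (- (2 * u)) * R)\<^sup>2 / 2))) \<le> ennreal (exp 2 * exp (- (1/2 * R))) * ?p u"
        by (subst ennreal_mult[symmetric]) (auto intro: ennreal_leI)
      then show ?thesis using True by simp
    next
      case False
      have "u powr (- (1 + \<nu>)) * exp (- (\<kappa> * u)) * exp (- ((exp (- (2 * u)) * R)\<^sup>2 / 2)) \<le> u powr (- (1 + \<nu>))"
        using \<open>\<kappa> = 0\<close> by (simp add: mult_left_le)
      then have "ennreal (u powr (- (1 + \<nu>)) * exp (- (\<kappa> * u)) * exp (- ((exp (- (2 * u)) * R)\<^sup>2 / 2))) \<le> ?p u"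
        by (rule ennreal_leI)
      then show ?thesis using False by (cases "u0 \<le> u") (auto simp: add_increasing)
    qed
    have "(\<integral>\<^sup>+u\<in>{u0..}. ennreal (u powr (- (1 + \<nu>)) * exp (- (\<kappa> * u)) * exp (- ((exp (- (2 * u)) * R)\<^sup>2 / 2))) \<partial>lborel)
      \<le> (\<integral>\<^sup>+u. ennreal (exp 2 * exp (- (1/2 * R))) * (?p u * indicator {u0..} u) + ?p u * indicator {v..} u \<partial>lborel)"
      by (intro nn_integral_mono pt)
    also have "\<dots> = ennreal (exp 2 * exp (- (1/2 * R))) * (\<integral>\<^sup>+u\<in>{u0..}. ?p u \<partial>lborel) + (\<integral>\<^sup>+u\<in>{v..}. ?p u \<partial>lborel)"
      by (subst nn_integral_add) (auto simp: nn_integral_cmult)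
    also have "\<dots> = ennreal (exp 2 * exp (- (1/2 * R)) * (u0 powr (- \<nu>) / \<nu>) + v powr (- \<nu>) / \<nu>)"
      unfolding nn_integral_powr_tail[OF assms(3,2)] nn_integral_powr_tail[OF v assms(2)]
      using assms(2) by (subst ennreal_mult[symmetric], simp, simp, subst ennreal_plus[symmetric], auto)
    also have "\<dots> \<le> ennreal (C * tail_weight \<kappa> \<nu> R)"
    proof (rule ennreal_leI)
      have "v powr (- \<nu>) / \<nu> = (1/4) powr (- \<nu>) / \<nu> * tail_weight \<kappa> \<nu> R"
        using True l1 powr_mult[of "1/4" "ln (exp 1 + R)" "- \<nu>"] by (simp add: v_def tail_weight_def)
      moreover have "exp 2 * exp (- (1/2 * R)) * (u0 powr (- \<nu>) / \<nu>) \<le> exp 2 * (D * tail_weight \<kappa> \<nu> R) * (u0 powr (- \<nu>) / \<nu>)"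
        using D(2)[OF R] assms by (intro mult_right_mono mult_left_mono) auto
      moreover have "exp 2 * (D * tail_weight \<kappa> \<nu> R) * (u0 powr (- \<nu>) / \<nu>) = u0 powr (- \<nu>) / \<nu> * (D * exp 2) * tail_weight \<kappa> \<nu> R"
        by (simp only: mult_ac)
      ultimately show "exp 2 * exp (- (1/2 * R)) * (u0 powr (- \<nu>) / \<nu>) + v powr (- \<nu>) / \<nu> \<le> C * tail_weight \<kappa> \<nu> R"
        unfolding C_def distrib_right by linarith
    qed
    finally show ?thesis .
  qed
  moreover have "C > 0" using D(1) assms by (auto simp: C_def intro!: add_pos_pos mult_pos_pos divide_pos_pos)
  ultimately show ?thesis using that by blast
next
  case False
  then have \<kappa>: "\<kappa> > 0" using assms by simp
  \<comment> \<open>\<open>C1\<close> compares the doubly exponential cutoff with \<open>exp (- \<kappa> |u - V|)\<close>, and \<open>C2\<close> trades half of that decay for a power of \<open>V / u\<close>.\<close>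
  define p where "p = \<kappa> / 2"
  obtain C1 where C1: "C1 > 0" "\<And>z. z > 0 \<Longrightarrow> z powr p * exp (- (1/40 * z)) \<le> C1"
    using powr_times_exp_bounded[of "1/40" p] \<kappa> by (auto simp: p_def)
  obtain C2 where C2: "C2 > 0" "\<And>z. z > 0 \<Longrightarrow> z powr (1 + \<nu>) * exp (- (\<kappa> / 2 * u0 * z)) \<le> C2"
    using powr_times_exp_bounded[of "\<kappa> / 2 * u0" "1 + \<nu>"] \<kappa> assms by auto
  define C3 where "C3 = max (exp (2 * \<kappa>)) C1"
  have C3: "C3 \<ge> exp (2 * \<kappa>)" "C3 \<ge> C1" "C3 \<ge> 1" "C3 > 0"
    using \<kappa> C1(1) one_le_exp_iff[of "2 * \<kappa>"] by (auto simp: C3_def less_max_iff_disj le_max_iff_disj simp del: one_le_exp_iff)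
  define K where "K = C3 * (C2 * exp (\<kappa> / 2 * u0))"
  define C where "C = K * (1/2) powr (- (1 + \<nu>)) * (4 / \<kappa>)"
  have "(\<integral>\<^sup>+u\<in>{u0..}. ennreal (u powr (- (1 + \<nu>)) * exp (- (\<kappa> * u)) * exp (- ((exp (- (2 * u)) * R)\<^sup>2 / 2))) \<partial>lborel)
      \<le> ennreal (C * tail_weight \<kappa> \<nu> R)" if R: "R \<ge> 0" for R
  proof -
    define V where "V = ln (exp 1 + R) / 2"
    have l1: "ln (exp 1 + R) \<ge> 1" using ln_e_plus_ge_1[OF R] .
    have V: "V > 0" using l1 by (simp add: V_def)
    have eR: "exp 1 + R > 0" using R by (simp add: add_pos_nonneg)
    have eV: "exp (2 * V) = exp 1 + R" using eR by (simp add: V_def)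
    have gauss: "exp (- (\<kappa> * (u - V))) * exp (- ((exp (- (2 * u)) * R)\<^sup>2 / 2)) \<le> C3 * exp (- (\<kappa> * \<bar>u - V\<bar>))" if u: "u > 0" for u
    proof (cases "u \<ge> V")
      case True
      have "exp (- (\<kappa> * (u - V))) * exp (- ((exp (- (2 * u)) * R)\<^sup>2 / 2)) \<le> exp (- (\<kappa> * (u - V))) * 1" by (intro mult_left_mono) auto
      also have "\<dots> \<le> C3 * exp (- (\<kappa> * \<bar>u - V\<bar>))" using True C3 mult_right_mono[of 1 C3 "exp (- (\<kappa> * (u - V)))"] by simp
      finally show ?thesis .
    next
      case False
      define w where "w = u - V"
      have w: "w < 0" using False by (simp add: w_def)
      show ?thesis
      proof (cases "R \<ge> 1")
        case True
        have e: "exp (- (4 * w)) powr p = exp (- (2 * \<kappa> * w))" by (simp add: powr_def p_def)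
        define r where "r = R / (exp 1 + R)"
        define E where "E = exp (- (4 * w))"
        have "1 / 4 \<le> r" using True eR e_less_272 by (simp add: r_def field_simps)
        then have "(1 / 4)\<^sup>2 \<le> r\<^sup>2" by (intro power_mono) auto
        then have "1 / 16 \<le> r\<^sup>2" by (simp add: power_divide)
        then have i1: "1 / 16 * E \<le> r\<^sup>2 * E" by (intro mult_right_mono) (auto simp: E_def)
        have "exp (- (2 * u)) = exp (- (2 * w)) / exp (2 * V)" by (simp add: w_def flip: exp_diff)
        then have i2: "exp (- (2 * u)) * R = r * exp (- (2 * w))" by (simp add: eV r_def)
        have i3: "(exp (- (2 * w)))\<^sup>2 = E" by (simp add: E_def flip: exp_double)
        have "0 \<le> E" by (simp add: E_def)
        then have "- ((exp (- (2 * u)) * R)\<^sup>2 / 2) \<le> - (1 / 40 * E)"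
          unfolding i2 power_mult_distrib i3 using i1 by linarith
        then have "- ((exp (- (2 * u)) * R)\<^sup>2 / 2) \<le> - (1 / 40 * exp (- (4 * w)))" by (simp only: E_def)
        then have "exp (- (\<kappa> * w)) * exp (- ((exp (- (2 * u)) * R)\<^sup>2 / 2)) \<le> exp (- (\<kappa> * w)) * exp (- (1/40 * exp (- (4 * w))))" by simp
        also have "\<dots> = (exp (- (4 * w)) powr p * exp (- (1/40 * exp (- (4 * w))))) * exp (\<kappa> * w)"
          unfolding e by (simp flip: exp_add)
        also have "\<dots> \<le> C1 * exp (\<kappa> * w)" using C1(2)[of "exp (- (4 * w))"] by (intro mult_right_mono) auto
        also have "\<dots> \<le> C3 * exp (- (\<kappa> * \<bar>w\<bar>))" using w C3 by (simp add: mult_right_mono)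
        finally show ?thesis by (simp add: w_def)
      next
        case False
        have "V \<le> 1"
        proof -
          have "exp 1 + R \<le> exp 1 * exp 1" using False e_less_272 exp_ge_add_one_self[of "1::real"] mult_right_mono[of 2 "exp 1" "exp 1 :: real"] by linarith
          then have "exp (2 * V) \<le> exp 2" unfolding eV by (simp flip: exp_add)
          then show ?thesis by simp
        qed
        then have w2: "w \<ge> -1" using u by (simp add: w_def)
        have "\<kappa> * (- 1) \<le> \<kappa> * w" using w2 \<kappa> by (intro mult_left_mono) auto
        then have "- (\<kappa> * w) \<le> 2 * \<kappa> + - (\<kappa> * \<bar>w\<bar>)" using w by simp
        then have "exp (- (\<kappa> * w)) \<le> exp (2 * \<kappa>) * exp (- (\<kappa> * \<bar>w\<bar>))" by (simp flip: exp_add)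
        also have "\<dots> \<le> C3 * exp (- (\<kappa> * \<bar>w\<bar>))" using C3 by (intro mult_right_mono) auto
        finally have "exp (- (\<kappa> * w)) \<le> C3 * exp (- (\<kappa> * \<bar>w\<bar>))" .
        moreover have "exp (- (\<kappa> * w)) * exp (- ((exp (- (2 * u)) * R)\<^sup>2 / 2)) \<le> exp (- (\<kappa> * w)) * 1" by (intro mult_left_mono) auto
        ultimately show ?thesis unfolding w_def by linarith
      qed
    qed
    have pw: "u powr (- (1 + \<nu>)) \<le> V powr (- (1 + \<nu>)) * (C2 * exp (\<kappa> / 2 * u0)) * exp (\<kappa> / 2 * \<bar>u - V\<bar>)" if u: "u0 \<le> u" for u
    proof -
      have u': "u > 0" using u assms by simp
      define z where "z = 1 + \<bar>u - V\<bar> / u0"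
      have z: "z > 0" using assms by (simp add: z_def add_pos_nonneg)
      have "V \<le> u + \<bar>u - V\<bar>" by linarith
      also have "\<dots> \<le> u * z"
        using mult_right_mono[OF u, of "\<bar>u - V\<bar> / u0"] assms by (simp add: z_def algebra_simps)
      finally have "(u * z) powr (- (1 + \<nu>)) \<le> V powr (- (1 + \<nu>))" using V assms by (intro powr_mono2') auto
      then have "u powr (- (1 + \<nu>)) * z powr (- (1 + \<nu>)) \<le> V powr (- (1 + \<nu>))" using u' z by (simp add: powr_mult)
      then have "u powr (- (1 + \<nu>)) * z powr (- (1 + \<nu>)) * z powr (1 + \<nu>) \<le> V powr (- (1 + \<nu>)) * z powr (1 + \<nu>)" by (rule mult_right_mono) simp
      moreover have "z powr (- (1 + \<nu>)) * z powr (1 + \<nu>) = 1" using z by (simp flip: powr_add)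
      ultimately have "u powr (- (1 + \<nu>)) \<le> V powr (- (1 + \<nu>)) * z powr (1 + \<nu>)" by (simp only: mult.assoc mult_1_right)
      also have "\<dots> \<le> V powr (- (1 + \<nu>)) * (C2 * exp (\<kappa> / 2 * u0 * z))"
      proof (rule mult_left_mono)
        have "z powr (1 + \<nu>) = z powr (1 + \<nu>) * exp (- (\<kappa> / 2 * u0 * z)) * exp (\<kappa> / 2 * u0 * z)"
          by (simp add: mult.assoc flip: exp_add)
        also have "\<dots> \<le> C2 * exp (\<kappa> / 2 * u0 * z)" using C2(2)[OF z] by (intro mult_right_mono) auto
        finally show "z powr (1 + \<nu>) \<le> C2 * exp (\<kappa> / 2 * u0 * z)" .
      qed simp
      also have "exp (\<kappa> / 2 * u0 * z) = exp (\<kappa> / 2 * u0) * exp (\<kappa> / 2 * \<bar>u - V\<bar>)"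
        using assms by (simp add: z_def algebra_simps flip: exp_add)
      finally show ?thesis by (simp add: mult_ac)
    qed
    define B where "B = (exp 1 + R) powr (- (\<kappa> / 2)) * V powr (- (1 + \<nu>)) * K"
    have B: "B \<ge> 0" using C2 C3 by (simp add: B_def K_def)
    have pt: "u powr (- (1 + \<nu>)) * exp (- (\<kappa> * u)) * exp (- ((exp (- (2 * u)) * R)\<^sup>2 / 2)) \<le> B * exp (- (\<kappa> / 2 * \<bar>u - V\<bar>))" if u: "u0 \<le> u" for u
    proof -
      have u': "u > 0" using u assms by simp
      have "exp (- (\<kappa> * u)) = exp (- (\<kappa> * V)) * exp (- (\<kappa> * (u - V)))" by (simp add: algebra_simps flip: exp_add)
      moreover have "exp (- (\<kappa> * V)) = (exp 1 + R) powr (- (\<kappa> / 2))" using eR by (simp add: powr_def V_def)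
      ultimately have "u powr (- (1 + \<nu>)) * exp (- (\<kappa> * u)) * exp (- ((exp (- (2 * u)) * R)\<^sup>2 / 2))
        = (exp 1 + R) powr (- (\<kappa> / 2)) * (u powr (- (1 + \<nu>)) * (exp (- (\<kappa> * (u - V))) * exp (- ((exp (- (2 * u)) * R)\<^sup>2 / 2))))" by simp
      also have "\<dots> \<le> (exp 1 + R) powr (- (\<kappa> / 2)) * ((V powr (- (1 + \<nu>)) * (C2 * exp (\<kappa> / 2 * u0)) * exp (\<kappa> / 2 * \<bar>u - V\<bar>)) * (C3 * exp (- (\<kappa> * \<bar>u - V\<bar>))))"
      proof (rule mult_left_mono)
        have "0 \<le> V powr (- (1 + \<nu>)) * (C2 * exp (\<kappa> / 2 * u0)) * exp (\<kappa> / 2 * \<bar>u - V\<bar>)"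
          using C2(1) by simp
        then show "u powr (- (1 + \<nu>)) * (exp (- (\<kappa> * (u - V))) * exp (- ((exp (- (2 * u)) * R)\<^sup>2 / 2)))
          \<le> (V powr (- (1 + \<nu>)) * (C2 * exp (\<kappa> / 2 * u0)) * exp (\<kappa> / 2 * \<bar>u - V\<bar>)) * (C3 * exp (- (\<kappa> * \<bar>u - V\<bar>)))"
          by (intro mult_mono[OF pw[OF u] gauss[OF u']]) simp_all
      qed simp
      also have "\<dots> = B * (exp (\<kappa> / 2 * \<bar>u - V\<bar>) * exp (- (\<kappa> * \<bar>u - V\<bar>)))" unfolding B_def K_def by (simp only: mult_ac)
      also have "exp (\<kappa> / 2 * \<bar>u - V\<bar>) * exp (- (\<kappa> * \<bar>u - V\<bar>)) = exp (- (\<kappa> / 2 * \<bar>u - V\<bar>))" unfolding exp_add[symmetric] by simp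
      finally show ?thesis .
    qed
    have "(\<integral>\<^sup>+u\<in>{u0..}. ennreal (u powr (- (1 + \<nu>)) * exp (- (\<kappa> * u)) * exp (- ((exp (- (2 * u)) * R)\<^sup>2 / 2))) \<partial>lborel)
      \<le> (\<integral>\<^sup>+u. ennreal B * ennreal (exp (- (\<kappa> / 2 * \<bar>u - V\<bar>))) \<partial>lborel)"
      using pt B by (intro nn_integral_mono) (auto split: split_indicator simp flip: ennreal_mult intro: ennreal_leI)
    also have "\<dots> = ennreal B * (\<integral>\<^sup>+u. ennreal (exp (- (\<kappa> / 2 * \<bar>u - V\<bar>))) \<partial>lborel)" by (intro nn_integral_cmult) auto
    also have "\<dots> \<le> ennreal B * ennreal (2 / (\<kappa> / 2))" using \<kappa> by (intro mult_left_mono nn_integral_exp_abs_le) auto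
    also have "\<dots> = ennreal (B * (4 / \<kappa>))" using B \<kappa> by (subst ennreal_mult[symmetric]) auto
    also have "\<dots> \<le> ennreal (C * tail_weight \<kappa> \<nu> R)"
    proof (rule ennreal_leI)
      have "V powr (- (1 + \<nu>)) = (1/2) powr (- (1 + \<nu>)) * ln (exp 1 + R) powr (- (1 + \<nu>))"
        using l1 powr_mult[of "1/2" "ln (exp 1 + R)" "- (1 + \<nu>)"] by (simp add: V_def)
      then have "B * (4 / \<kappa>) = C * ((exp 1 + R) powr (- (\<kappa> / 2)) * ln (exp 1 + R) powr (- (1 + \<nu>)))"
        by (simp add: B_def C_def mult_ac)
      also have "\<dots> \<le> C * ((1 + R) powr (- (\<kappa> / 2)) * ln (exp 1 + R) powr (- (1 + \<nu>)))"
        using R \<kappa> C2 C3 by (intro mult_left_mono mult_right_mono powr_mono2') (auto simp: C_def K_def)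
      finally show "B * (4 / \<kappa>) \<le> C * tail_weight \<kappa> \<nu> R" using False by (simp add: tail_weight_def)
    qed
    finally show ?thesis .
  qed
  moreover have "C > 0" using \<kappa> C2 C3 by (simp add: C_def K_def)
  ultimately show ?thesis using that by blast
qed

text \<open>
  Small times contribute a Gaussian \<open>exp (- |y|\<^sup>2)\<close>, negligible against the weight; large times contribute
  exactly its order of magnitude.
\<close>

lemma kern_integral_le:
  fixes x :: "real ^ 'n::finite"
  assumes "a + b > (norm x)\<^sup>2" "\<nu> > 0" "m \<ge> - real CARD('n)"
  obtains C where "C > 0"
    "\<And>y. (\<integral>\<^sup>+u\<in>{0<..}. ennreal (kern_base m \<nu> u y * kern_exp a b x u y) \<partial>lborel) \<le> ennreal (C * weight_phi m \<nu> y)"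
proof -
  define \<kappa> where "\<kappa> = real CARD('n) + m"
  have \<kappa>: "\<kappa> \<ge> 0" using assms(3) by (simp add: \<kappa>_def)
  obtain u0 \<delta> C1 where C1: "0 < u0" "u0 \<le> 1" "0 < \<delta>" "0 < C1"
    "\<And>u y. 0 < u \<Longrightarrow> u \<le> u0 \<Longrightarrow> kern_base m \<nu> u y * kern_exp a b x u y \<le> C1 * exp (- (\<delta> / u)) * exp (- (norm y)\<^sup>2)"
    using kern_small[OF assms(1,2)] by blast
  have "0 \<le> a + b" using assms(1) zero_le_power2[of "norm x"] by linarith
  then obtain C2 where C2: "0 < C2" "\<And>u y. u0 \<le> u \<Longrightarrow> kern_base m \<nu> u y * kern_exp a b x u y \<le>
      C2 * exp (- ((norm y)\<^sup>2 / 2)) * (u powr (- (1 + \<nu>)) * exp (- ((real CARD('n) + m) * u)) * exp (- ((exp (- (2 * u)) * norm y)\<^sup>2 / 2)))"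
    using kern_large[OF _ C1(1)] by blast
  obtain C3 where C3: "C3 > 0" "\<And>R. R \<ge> 0 \<Longrightarrow>
    (\<integral>\<^sup>+u\<in>{u0..}. ennreal (u powr (- (1 + \<nu>)) * exp (- (\<kappa> * u)) * exp (- ((exp (- (2 * u)) * R)\<^sup>2 / 2))) \<partial>lborel)
      \<le> ennreal (C3 * tail_weight \<kappa> \<nu> R)"
    using tail_integral_le[OF \<kappa> assms(2) C1(1,2)] by blast
  obtain C4 where C4: "C4 > 0" "\<And>R. R \<ge> 0 \<Longrightarrow> exp (- (R\<^sup>2 / 2)) \<le> C4 * tail_weight \<kappa> \<nu> R"
    using gaussian_le_tail_weight[OF \<kappa> assms(2)] by blast
  define C where "C = C1 * C4 + C2 * C3"
  have "(\<integral>\<^sup>+u\<in>{0<..}. ennreal (kern_base m \<nu> u y * kern_exp a b x u y) \<partial>lborel) \<le> ennreal (C * weight_phi m \<nu> y)" for y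
  proof -
    let ?K = "\<lambda>u. kern_base m \<nu> u y * kern_exp a b x u y"
    let ?G = "\<lambda>u. u powr (- (1 + \<nu>)) * exp (- (\<kappa> * u)) * exp (- ((exp (- (2 * u)) * norm y)\<^sup>2 / 2))"
    have pt: "ennreal (?K u) * indicator {0<..} u \<le> ennreal (C1 * exp (- (norm y)\<^sup>2)) * indicator {0..1} u +
        ennreal (C2 * exp (- ((norm y)\<^sup>2 / 2))) * (ennreal (?G u) * indicator {u0..} u)" for u
    proof (cases "u \<le> u0")
      case True
      have "?K u \<le> C1 * exp (- (norm y)\<^sup>2)" if "u > 0"
      proof -
        have "?K u \<le> C1 * exp (- (\<delta> / u)) * exp (- (norm y)\<^sup>2)" using C1(5)[OF that True] .
        also have "\<dots> \<le> C1 * 1 * exp (- (norm y)\<^sup>2)" using C1 that by (intro mult_right_mono mult_left_mono) auto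
        finally show ?thesis by simp
      qed
      then show ?thesis using True C1 by (auto intro!: add_increasing2 ennreal_leI split: split_indicator)
    next
      case False
      have "ennreal (?K u) \<le> ennreal (C2 * exp (- ((norm y)\<^sup>2 / 2)) * ?G u)"
        using C2(2)[of u y] False by (intro ennreal_leI) (simp add: \<kappa>_def)
      also have "\<dots> = ennreal (C2 * exp (- ((norm y)\<^sup>2 / 2))) * ennreal (?G u)" using C2 by (intro ennreal_mult) auto
      finally show ?thesis using False C1 by (auto intro!: add_increasing split: split_indicator)
    qed
    have "(\<integral>\<^sup>+u\<in>{0<..}. ennreal (?K u) \<partial>lborel) \<le> (\<integral>\<^sup>+u. ennreal (C1 * exp (- (norm y)\<^sup>2)) * indicator {0..1} u +
        ennreal (C2 * exp (- ((norm y)\<^sup>2 / 2))) * (ennreal (?G u) * indicator {u0..} u) \<partial>lborel)"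
      by (intro nn_integral_mono pt)
    also have "\<dots> = ennreal (C1 * exp (- (norm y)\<^sup>2)) + ennreal (C2 * exp (- ((norm y)\<^sup>2 / 2))) * (\<integral>\<^sup>+u\<in>{u0..}. ennreal (?G u) \<partial>lborel)"
      by (subst nn_integral_add) (auto simp: nn_integral_cmult nn_integral_cmult_indicator)
    also have "\<dots> \<le> ennreal (C1 * exp (- (norm y)\<^sup>2)) + ennreal (C2 * exp (- ((norm y)\<^sup>2 / 2))) * ennreal (C3 * tail_weight \<kappa> \<nu> (norm y))"
      using C3(2)[of "norm y"] by (intro add_left_mono mult_left_mono) auto
    also have "\<dots> = ennreal (C1 * exp (- (norm y)\<^sup>2) + C2 * exp (- ((norm y)\<^sup>2 / 2)) * (C3 * tail_weight \<kappa> \<nu> (norm y)))"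
      using C1 C2 C3 tail_weight_pos[of "norm y" \<kappa> \<nu>] by (simp add: ennreal_mult ennreal_plus)
    also have "\<dots> \<le> ennreal (C * weight_phi m \<nu> y)"
    proof (rule ennreal_leI)
      have "exp (- (norm y)\<^sup>2) = exp (- ((norm y)\<^sup>2 / 2)) * exp (- ((norm y)\<^sup>2 / 2))" by (simp flip: exp_add)
      also have "\<dots> \<le> exp (- ((norm y)\<^sup>2 / 2)) * (C4 * tail_weight \<kappa> \<nu> (norm y))" using C4 by (intro mult_left_mono) auto
      finally have "C1 * exp (- (norm y)\<^sup>2) \<le> C1 * (exp (- ((norm y)\<^sup>2 / 2)) * (C4 * tail_weight \<kappa> \<nu> (norm y)))" using C1 by (intro mult_left_mono) auto
      then show "C1 * exp (- (norm y)\<^sup>2) + C2 * exp (- ((norm y)\<^sup>2 / 2)) * (C3 * tail_weight \<kappa> \<nu> (norm y)) \<le> C * weight_phi m \<nu> y"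
        by (simp add: weight_phi_eq \<kappa>_def C_def algebra_simps)
    qed
    finally show ?thesis .
  qed
  moreover have "C > 0" using C1 C2 C3 C4 by (simp add: C_def add_pos_pos)
  ultimately show ?thesis using that by blast
qed

section \<open>The Poisson integral as a Laplace transform\<close>

text \<open>
  The integrand of the Poisson kernel at the point \<open>(t, x)\<close> is the product of a weight in the time variable \<open>u\<close> and
  Mehler's kernel (\<open>subordinated_heat_kernel\<close>). For \<open>\<nu> = 1/2\<close> the weight is, up to a constant, the density of a
  Levy distribution.
\<close>

abbreviation pkern :: "real \<Rightarrow> real \<Rightarrow> real \<Rightarrow> real ^ 'n \<Rightarrow> real \<Rightarrow> real ^ 'n::finite \<Rightarrow> real" where
  "pkern m \<nu> t x u y \<equiv> kern_base m \<nu> u y * kern_exp (t\<^sup>2) ((norm x)\<^sup>2) x u y"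

abbreviation levy_weight :: "real \<Rightarrow> real \<Rightarrow> real \<Rightarrow> real" where
  "levy_weight \<nu> t u \<equiv> exp (- (t\<^sup>2 / (4 * u))) / u powr (1 + \<nu>)"

lemma borel_measurable_coth2 [measurable]: "coth2 \<in> borel_measurable borel"
  and borel_measurable_csch2 [measurable]: "csch2 \<in> borel_measurable borel"
proof -
  have "(cosh :: real \<Rightarrow> real) \<in> borel_measurable borel" "(sinh :: real \<Rightarrow> real) \<in> borel_measurable borel"
    by (auto intro!: borel_measurable_continuous_onI continuous_intros)
  then have [measurable]: "(\<lambda>u::real. cosh (2 * u)) \<in> borel_measurable borel" "(\<lambda>u::real. sinh (2 * u)) \<in> borel_measurable borel"
    by measurable
  show "coth2 \<in> borel_measurable borel" "csch2 \<in> borel_measurable borel"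
    unfolding coth2_def[abs_def] csch2_def[abs_def] by measurable
qed

lemma borel_measurable_sinh_double [measurable]: "(\<lambda>u::real. sinh (2 * u)) \<in> borel_measurable borel"
  by (auto intro!: borel_measurable_continuous_onI continuous_intros)

text \<open>
  The Poisson integral is the Laplace transform of \<open>kern_density m \<nu> f\<close> along the map \<open>kern_feature\<close>, at the
  parameter \<open>(t\<^sup>2, |x|\<^sup>2, x)\<close>. The set \<open>kern_domain\<close> is an open set of parameters on which it converges
  absolutely. It contains all such points with \<open>t \<noteq> 0\<close>.
\<close>

definition kern_feature :: "real \<times> (real ^ 'n::finite) \<Rightarrow> real \<times> real \<times> (real ^ 'n)" where
  "kern_feature = (\<lambda>(u, y). (- (1 / (4 * u)), - (coth2 u / 2), csch2 u *\<^sub>R y))"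

definition kern_density :: "real \<Rightarrow> real \<Rightarrow> (real ^ 'n::finite \<Rightarrow> complex) \<Rightarrow> real \<times> (real ^ 'n) \<Rightarrow> complex" where
  "kern_density m \<nu> f = (\<lambda>(u, y). (indicator {0<..} u * kern_base m \<nu> u y) *\<^sub>R f y)"

definition kern_domain :: "(real \<times> real \<times> (real ^ 'n::finite)) set" where
  "kern_domain = {(a, b, x). (norm x)\<^sup>2 < a + b}"

lemma kern_exp_eq_feature: "kern_exp a b x u y = exp ((a, b, x) \<bullet> kern_feature (u, y))"
  by (simp add: kern_exp_def kern_feature_def)

lemma open_kern_domain: "open kern_domain"
proof -
  have eq: "kern_domain = {p. (norm (snd (snd p)))\<^sup>2 < fst p + fst (snd p)}"
    by (auto simp: kern_domain_def)
  show ?thesis unfolding eq by (intro open_Collect_less continuous_intros)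
qed

lemma borel_measurable_kern_base [measurable]:
  "(\<lambda>(u, y). kern_base m \<nu> u y) \<in> borel_measurable (lborel \<Otimes>\<^sub>M (lborel :: (real ^ 'n::finite) measure))"
  unfolding kern_base_def by measurable

lemma borel_measurable_kern_exp [measurable]:
  "(\<lambda>(u, y). kern_exp a b x u y) \<in> borel_measurable (lborel \<Otimes>\<^sub>M (lborel :: (real ^ 'n::finite) measure))"
  unfolding kern_exp_def by measurable

lemma borel_measurable_kern_feature [measurable]:
  "kern_feature \<in> borel_measurable (lborel \<Otimes>\<^sub>M (lborel :: (real ^ 'n::finite) measure))"
  unfolding kern_feature_def by (subst borel_prod[symmetric], subst borel_prod[symmetric]) measurable

lemma borel_measurable_kern_density [measurable]:
  assumes [measurable]: "f \<in> borel_measurable borel"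
  shows "kern_density m \<nu> f \<in> borel_measurable (lborel \<Otimes>\<^sub>M (lborel :: (real ^ 'n::finite) measure))"
  unfolding kern_density_def kern_base_def by measurable

lemma weight_phi_pos: "weight_phi m \<nu> (y :: real ^ 'n::finite) > 0"
  unfolding weight_phi_eq using tail_weight_pos[of "norm y" "real CARD('n) + m" \<nu>] by simp

lemma borel_measurable_weight_phi [measurable]: "weight_phi m \<nu> \<in> borel_measurable (borel :: (real ^ 'n::finite) measure)"
proof -
  have "weight_phi m \<nu> = (\<lambda>y :: real ^ 'n. if m = - real CARD('n)
      then exp (- ((norm y)\<^sup>2 / 2)) / ln (exp 1 + norm y) powr \<nu>
      else exp (- ((norm y)\<^sup>2 / 2)) /
             ((1 + norm y) powr ((real CARD('n) + m) / 2) * ln (exp 1 + norm y) powr (1 + \<nu>)))"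
    by (simp add: fun_eq_iff weight_phi_def)
  then show ?thesis by simp
qed

lemma kern_iterated_nn_integral:
  fixes f :: "real ^ 'n::finite \<Rightarrow> complex"
  assumes [measurable]: "f \<in> borel_measurable borel"
  shows "(\<integral>\<^sup>+u\<in>{0<..}. (\<integral>\<^sup>+y. ennreal (kern_base m \<nu> u y * kern_exp a b x u y * norm (f y)) \<partial>lborel) \<partial>lborel)
    = (\<integral>\<^sup>+y. ennreal (norm (f y)) * (\<integral>\<^sup>+u\<in>{0<..}. ennreal (kern_base m \<nu> u y * kern_exp a b x u y) \<partial>lborel) \<partial>lborel)"
proof -
  let ?K = "\<lambda>u y. kern_base m \<nu> u y * kern_exp a b x u y"
  have "(\<integral>\<^sup>+u\<in>{0<..}. (\<integral>\<^sup>+y. ennreal (?K u y * norm (f y)) \<partial>lborel) \<partial>lborel)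
    = (\<integral>\<^sup>+u. (\<integral>\<^sup>+y. ennreal (?K u y * norm (f y)) * indicator {0<..} u \<partial>lborel) \<partial>lborel)"
    by (intro nn_integral_cong nn_integral_multc[symmetric]) measurable
  also have "\<dots> = (\<integral>\<^sup>+y. (\<integral>\<^sup>+u. ennreal (?K u y * norm (f y)) * indicator {0<..} u \<partial>lborel) \<partial>lborel)"
    by (rule lborel_pair.Fubini'[symmetric]) measurable
  also have "\<dots> = (\<integral>\<^sup>+y. ennreal (norm (f y)) * (\<integral>\<^sup>+u\<in>{0<..}. ennreal (?K u y) \<partial>lborel) \<partial>lborel)"
  proof (rule nn_integral_cong)
    fix y
    have "(\<integral>\<^sup>+u. ennreal (?K u y * norm (f y)) * indicator {0<..} u \<partial>lborel)
      = (\<integral>\<^sup>+u. ennreal (norm (f y)) * (ennreal (?K u y) * indicator {0<..} u) \<partial>lborel)"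
    proof (rule nn_integral_cong)
      fix u
      have nn: "0 \<le> ?K u y" by (intro mult_nonneg_nonneg kern_nonneg less_imp_le[OF kern_nonneg(2)])
      show "ennreal (?K u y * norm (f y)) * indicator {0<..} u = ennreal (norm (f y)) * (ennreal (?K u y) * indicator {0<..} u)"
        unfolding ennreal_mult[OF nn norm_ge_zero] by (simp only: mult_ac)
    qed
    also have "\<dots> = ennreal (norm (f y)) * (\<integral>\<^sup>+u\<in>{0<..}. ennreal (?K u y) \<partial>lborel)"
      by (rule nn_integral_cmult) measurable
    finally show "(\<integral>\<^sup>+u. ennreal (?K u y * norm (f y)) * indicator {0<..} u \<partial>lborel) = \<dots>" .
  qed
  finally show ?thesis .
qed

lemma kern_iterated_finite:
  fixes f :: "real ^ 'n::finite \<Rightarrow> complex"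
  assumes [measurable]: "f \<in> borel_measurable borel"
    and fin: "(\<integral>\<^sup>+y. ennreal (norm (f y) * weight_phi m \<nu> y) \<partial>lborel) < \<infinity>"
    and p: "(norm x)\<^sup>2 < a + b" and "\<nu> > 0" "m \<ge> - real CARD('n)"
  shows "(\<integral>\<^sup>+u\<in>{0<..}. (\<integral>\<^sup>+y. ennreal (kern_base m \<nu> u y * kern_exp a b x u y * norm (f y)) \<partial>lborel) \<partial>lborel) < \<infinity>"
proof -
  obtain C where C: "C > 0" "\<And>y. (\<integral>\<^sup>+u\<in>{0<..}. ennreal (kern_base m \<nu> u y * kern_exp a b x u y) \<partial>lborel) \<le> ennreal (C * weight_phi m \<nu> y)"
    using kern_integral_le[OF p assms(4,5)] by blast
  have "(\<integral>\<^sup>+y. ennreal (norm (f y)) * (\<integral>\<^sup>+u\<in>{0<..}. ennreal (kern_base m \<nu> u y * kern_exp a b x u y) \<partial>lborel) \<partial>lborel)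
    \<le> (\<integral>\<^sup>+y. ennreal (norm (f y)) * ennreal (C * weight_phi m \<nu> y) \<partial>lborel)"
    by (intro nn_integral_mono mult_left_mono C) auto
  also have "\<dots> = (\<integral>\<^sup>+y. ennreal C * ennreal (norm (f y) * weight_phi m \<nu> y) \<partial>lborel)"
    by (intro nn_integral_cong)
      (simp only: ennreal_mult[OF less_imp_le[OF C(1)] less_imp_le[OF weight_phi_pos]] ennreal_mult[OF norm_ge_zero less_imp_le[OF weight_phi_pos]] mult_ac)
  also have "\<dots> = ennreal C * (\<integral>\<^sup>+y. ennreal (norm (f y) * weight_phi m \<nu> y) \<partial>lborel)"
    by (rule nn_integral_cmult) measurable
  also have "\<dots> < \<infinity>" using fin by (simp add: ennreal_mult_less_top)
  finally show ?thesis unfolding kern_iterated_nn_integral[OF assms(1)] .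
qed

lemma kern_integrable:
  fixes f :: "real ^ 'n::finite \<Rightarrow> complex"
  assumes f [measurable]: "f \<in> borel_measurable borel"
    and fin: "(\<integral>\<^sup>+y. ennreal (norm (f y) * weight_phi m \<nu> y) \<partial>lborel) < \<infinity>"
    and \<nu>: "\<nu> > 0" "m \<ge> - real CARD('n)" and p: "p \<in> kern_domain"
  shows "integrable (lborel \<Otimes>\<^sub>M lborel) (\<lambda>\<omega>. exp (p \<bullet> kern_feature \<omega>) *\<^sub>R kern_density m \<nu> f \<omega>)"
proof (rule integrableI_bounded)
  show "(\<lambda>\<omega>. exp (p \<bullet> kern_feature \<omega>) *\<^sub>R kern_density m \<nu> f \<omega>) \<in> borel_measurable (lborel \<Otimes>\<^sub>M lborel)" by measurable
  obtain a b x where pe: "p = (a, b, x)" by (cases p) auto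
  have "(\<integral>\<^sup>+\<omega>. ennreal (norm (exp (p \<bullet> kern_feature \<omega>) *\<^sub>R kern_density m \<nu> f \<omega>)) \<partial>(lborel \<Otimes>\<^sub>M lborel))
    = (\<integral>\<^sup>+u. (\<integral>\<^sup>+y. ennreal (norm (exp (p \<bullet> kern_feature (u, y)) *\<^sub>R kern_density m \<nu> f (u, y))) \<partial>lborel) \<partial>lborel)"
    by (rule lborel.nn_integral_fst[symmetric]) measurable
  also have "\<dots> = (\<integral>\<^sup>+u\<in>{0<..}. (\<integral>\<^sup>+y. ennreal (kern_base m \<nu> u y * kern_exp a b x u y * norm (f y)) \<partial>lborel) \<partial>lborel)"
  proof (rule nn_integral_cong)
    fix u
    show "(\<integral>\<^sup>+y. ennreal (norm (exp (p \<bullet> kern_feature (u, y)) *\<^sub>R kern_density m \<nu> f (u, y))) \<partial>lborel)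
      = (\<integral>\<^sup>+y. ennreal (kern_base m \<nu> u y * kern_exp a b x u y * norm (f y)) \<partial>lborel) * indicator {0<..} u"
      unfolding pe kern_exp_eq_feature[symmetric] kern_density_def
      using kern_nonneg(1)[of m \<nu> u] kern_nonneg(2)[of a b x u, THEN less_imp_le] 
      by (cases "u > 0") (auto intro!: nn_integral_cong simp: abs_mult mult_ac abs_of_nonneg[OF kern_nonneg(1)])
  qed
  also have "\<dots> < \<infinity>" using p by (intro kern_iterated_finite[OF f fin _ \<nu>]) (auto simp: pe kern_domain_def)
  finally show "(\<integral>\<^sup>+\<omega>. ennreal (norm (exp (p \<bullet> kern_feature \<omega>) *\<^sub>R kern_density m \<nu> f \<omega>)) \<partial>(lborel \<Otimes>\<^sub>M lborel)) < \<infinity>" .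
qed

text \<open>
  A Borel representative of \<open>f\<close> makes the kernel times \<open>f\<close> measurable for the product of two Borel measures,
  which is where Fubini's theorem applies. The integrals in the definitions do not change.
\<close>

lemma lebesgue_ex_borel_complex:
  fixes f :: "'a::euclidean_space \<Rightarrow> complex"
  assumes "f \<in> borel_measurable lebesgue"
  obtains f' where "f' \<in> borel_measurable borel" "AE y in lborel. f y = f' y"
proof -
  have m: "(\<lambda>y. Re (f y)) \<in> borel_measurable lebesgue" "(\<lambda>y. Im (f y)) \<in> borel_measurable lebesgue"
    using assms by measurable
  obtain r i where ri: "r \<in> borel_measurable borel" "AE y in lborel. Re (f y) = r y"
    "i \<in> borel_measurable borel" "AE y in lborel. Im (f y) = i y"
    using completion_ex_borel_measurable_real[OF m(1)] completion_ex_borel_measurable_real[OF m(2)] by auto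
  have "(\<lambda>y. Complex (r y) (i y)) \<in> borel_measurable borel"
    using ri(1,3) by (simp add: Complex_eq)
  moreover have "AE y in lborel. f y = Complex (r y) (i y)"
    using ri(2,4) by eventually_elim (simp add: complex_eq_iff)
  ultimately show ?thesis by (rule that)
qed

lemma subordinated_heat_kernel:
  fixes x y :: "real ^ 'n::finite"
  assumes "u > 0"
  shows "levy_weight \<nu> t u * heat_kernel m u x y = pkern m \<nu> t x u y"
proof -
  have "csch2 u * (x \<bullet> y) - coth2 u / 2 * ((norm x)\<^sup>2 + (norm y)\<^sup>2) + - (t\<^sup>2 / (4 * u))
    = csch2 u * (x \<bullet> y) - t\<^sup>2 / (4 * u) - (norm x)\<^sup>2 * (coth2 u / 2) - coth2 u / 2 * (norm y)\<^sup>2"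
    unfolding distrib_left mult.commute[of "(norm x)\<^sup>2" "coth2 u / 2"] by linarith
  then have e: "exp (csch2 u * (x \<bullet> y) - coth2 u / 2 * ((norm x)\<^sup>2 + (norm y)\<^sup>2)) * exp (- (t\<^sup>2 / (4 * u)))
    = exp (csch2 u * (x \<bullet> y) - t\<^sup>2 / (4 * u) - (norm x)\<^sup>2 * (coth2 u / 2) - coth2 u / 2 * (norm y)\<^sup>2)"
    unfolding exp_add[symmetric] by (rule arg_cong)
  have p: "levy_weight \<nu> t u = exp (- (t\<^sup>2 / (4 * u))) * u powr (- (1 + \<nu>))"
    unfolding powr_minus_divide by simp
  show ?thesis unfolding kern_eq heat_kernel_eq[OF assms] e[symmetric] p by (simp only: mult_ac)
qed

lemma heat_kernel_nonneg: "u > 0 \<Longrightarrow> heat_kernel m u x y \<ge> 0"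
  by (simp add: heat_kernel_def)

lemma borel_measurable_heat_kernel [measurable]: "heat_kernel m u x \<in> borel_measurable (borel :: (real ^ 'n::finite) measure)"
  unfolding heat_kernel_def[abs_def] by measurable

lemma heat_semigroup_cong_AE:
  fixes f f' :: "real ^ 'n::finite \<Rightarrow> complex"
  assumes [measurable]: "f' \<in> borel_measurable borel" and ae: "AE y in lborel. f y = f' y" and f: "f \<in> borel_measurable lebesgue"
  shows "heat_semigroup m u f x = (\<integral>y. heat_kernel m u x y *\<^sub>R f' y \<partial>lborel)"
proof -
  have "AE y in lebesgue. f y = f' y" using ae by (rule AE_completion)
  moreover have [measurable]: "heat_kernel m u x \<in> borel_measurable lebesgue" "f' \<in> borel_measurable lebesgue"
    by (auto intro!: measurable_completion)
  ultimately have "heat_semigroup m u f x = (\<integral>y. heat_kernel m u x y *\<^sub>R f' y \<partial>lebesgue)"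
    unfolding heat_semigroup_def using f by (intro integral_cong_AE) auto
  also have "\<dots> = (\<integral>y. heat_kernel m u x y *\<^sub>R f' y \<partial>lborel)" by (rule integral_completion) measurable
  finally show ?thesis .
qed

lemma poisson_abs_eq:
  fixes f f' :: "real ^ 'n::finite \<Rightarrow> complex"
  assumes [measurable]: "f' \<in> borel_measurable borel" and ae: "AE y in lborel. f y = f' y"
  shows "poisson_abs m \<nu> f t x = ennreal (t powr (2 * \<nu>) / (4 powr \<nu> * Gamma \<nu>)) *
    (\<integral>\<^sup>+u\<in>{0<..}. (\<integral>\<^sup>+y. ennreal (pkern m \<nu> t x u y * norm (f' y)) \<partial>lborel) \<partial>lborel)"
proof -
  have eq: "ennreal (levy_weight \<nu> t u) * (\<integral>\<^sup>+y. ennreal (heat_kernel m u x y * norm (f y)) \<partial>lebesgue)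
    = (\<integral>\<^sup>+y. ennreal (pkern m \<nu> t x u y * norm (f' y)) \<partial>lborel)" if u: "u > 0" for u
  proof -
    have "(\<integral>\<^sup>+y. ennreal (heat_kernel m u x y * norm (f y)) \<partial>lebesgue) = (\<integral>\<^sup>+y. ennreal (heat_kernel m u x y * norm (f' y)) \<partial>lborel)"
      unfolding nn_integral_completion using ae by (intro nn_integral_cong_AE) (auto elim!: eventually_mono)
    then have "ennreal (levy_weight \<nu> t u) * (\<integral>\<^sup>+y. ennreal (heat_kernel m u x y * norm (f y)) \<partial>lebesgue)
      = (\<integral>\<^sup>+y. ennreal (levy_weight \<nu> t u) * ennreal (heat_kernel m u x y * norm (f' y)) \<partial>lborel)"
      by (simp add: nn_integral_cmult)
    also have "\<dots> = (\<integral>\<^sup>+y. ennreal (pkern m \<nu> t x u y * norm (f' y)) \<partial>lborel)"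
      unfolding subordinated_heat_kernel[OF u, symmetric]
      using u by (intro nn_integral_cong) (subst ennreal_mult[symmetric], auto intro!: mult_nonneg_nonneg heat_kernel_nonneg simp: mult.assoc)
    finally show ?thesis .
  qed
  have "(\<integral>\<^sup>+u\<in>{0<..}. ennreal (levy_weight \<nu> t u) *
        (\<integral>\<^sup>+y. ennreal (heat_kernel m u x y * norm (f y)) \<partial>lebesgue) \<partial>lebesgue)
    = (\<integral>\<^sup>+u\<in>{0<..}. (\<integral>\<^sup>+y. ennreal (pkern m \<nu> t x u y * norm (f' y)) \<partial>lborel) \<partial>lebesgue)"
  proof (rule nn_integral_cong)
    fix u
    show "ennreal (levy_weight \<nu> t u) * (\<integral>\<^sup>+y. ennreal (heat_kernel m u x y * norm (f y)) \<partial>lebesgue) * indicator {0<..} u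
      = (\<integral>\<^sup>+y. ennreal (pkern m \<nu> t x u y * norm (f' y)) \<partial>lborel) * indicator {0<..} u"
    proof (cases "u > 0")
      case True
      show ?thesis unfolding eq[OF True] ..
    qed simp
  qed
  then show ?thesis unfolding poisson_abs_def by (simp only: nn_integral_completion)
qed

lemma subordinated_heat_semigroup:
  fixes f f' :: "real ^ 'n::finite \<Rightarrow> complex"
  assumes f' [measurable]: "f' \<in> borel_measurable borel" and ae: "AE y in lborel. f y = f' y" and f: "f \<in> borel_measurable lebesgue"
  shows "indicator {0<..} u *\<^sub>R (levy_weight \<nu> t u *\<^sub>R heat_semigroup m u f x)
    = (\<integral>y. exp ((t\<^sup>2, (norm x)\<^sup>2, x) \<bullet> kern_feature (u, y)) *\<^sub>R kern_density m \<nu> f' (u, y) \<partial>lborel)"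
proof (cases "u > 0")
  case True
  have "levy_weight \<nu> t u *\<^sub>R heat_semigroup m u f x
    = (\<integral>y. levy_weight \<nu> t u *\<^sub>R (heat_kernel m u x y *\<^sub>R f' y) \<partial>lborel)"
    unfolding heat_semigroup_cong_AE[OF f' ae f] by (rule integral_scaleR_right[symmetric])
  also have "\<dots> = (\<integral>y. exp ((t\<^sup>2, (norm x)\<^sup>2, x) \<bullet> kern_feature (u, y)) *\<^sub>R kern_density m \<nu> f' (u, y) \<partial>lborel)"
    unfolding scaleR_scaleR subordinated_heat_kernel[OF True] kern_exp_eq_feature
    using True by (intro Bochner_Integration.integral_cong refl) (simp add: kern_density_def mult.commute[of "exp _"])
  finally show ?thesis using True by simp
qed (simp add: kern_density_def)

lemma set_integrable_subordinated_heat_semigroup: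
  fixes f f' :: "real ^ 'n::finite \<Rightarrow> complex"
  assumes f': "f' \<in> borel_measurable borel" and ae: "AE y in lborel. f y = f' y" and f: "f \<in> borel_measurable lebesgue"
    and int: "integrable (lborel \<Otimes>\<^sub>M lborel) (\<lambda>\<omega>. exp ((t\<^sup>2, (norm x)\<^sup>2, x) \<bullet> kern_feature \<omega>) *\<^sub>R kern_density m \<nu> f' \<omega>)"
  shows "set_integrable lborel {0<..} (\<lambda>u. levy_weight \<nu> t u *\<^sub>R heat_semigroup m u f x)"
  unfolding set_integrable_def subordinated_heat_semigroup[OF f' ae f] by (rule lborel_pair.integrable_fst'[OF int])

lemma poisson_eq_lborel:
  fixes f f' :: "real ^ 'n::finite \<Rightarrow> complex"
  assumes f': "f' \<in> borel_measurable borel" and ae: "AE y in lborel. f y = f' y" and f: "f \<in> borel_measurable lebesgue"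
    and int: "integrable (lborel \<Otimes>\<^sub>M lborel) (\<lambda>\<omega>. exp ((t\<^sup>2, (norm x)\<^sup>2, x) \<bullet> kern_feature \<omega>) *\<^sub>R kern_density m \<nu> f' \<omega>)"
  shows "poisson m \<nu> f t x = (t powr (2 * \<nu>) / (4 powr \<nu> * Gamma \<nu>)) *\<^sub>R
    (LINT u:{0<..}|lborel. levy_weight \<nu> t u *\<^sub>R heat_semigroup m u f x)"
  unfolding poisson_def set_lebesgue_integral_def
  using borel_measurable_integrable[OF set_integrable_subordinated_heat_semigroup[OF assms, unfolded set_integrable_def]]
  by (subst integral_completion) simp_all

lemma poisson_eq_laplace:
  fixes f f' :: "real ^ 'n::finite \<Rightarrow> complex"
  assumes f': "f' \<in> borel_measurable borel" and ae: "AE y in lborel. f y = f' y" and f: "f \<in> borel_measurable lebesgue"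
    and int: "integrable (lborel \<Otimes>\<^sub>M lborel) (\<lambda>\<omega>. exp ((t\<^sup>2, (norm x)\<^sup>2, x) \<bullet> kern_feature \<omega>) *\<^sub>R kern_density m \<nu> f' \<omega>)"
  shows "poisson m \<nu> f t x = (t powr (2 * \<nu>) / (4 powr \<nu> * Gamma \<nu>)) *\<^sub>R
    laplace (lborel \<Otimes>\<^sub>M lborel) kern_feature (kern_density m \<nu> f') (t\<^sup>2, (norm x)\<^sup>2, x)"
  unfolding poisson_eq_lborel[OF assms] set_lebesgue_integral_def subordinated_heat_semigroup[OF f' ae f] laplace_def
    lborel_pair.integral_fst'[OF int] ..

section \<open>Smoothness, and the kernel as a function of time\<close>

lemma Ck_on_parabolic_point:
  assumes S: "open S"
  shows "Ck_on k S (\<lambda>(t, x). (t\<^sup>2, (norm x)\<^sup>2, x) :: real \<times> real \<times> (real ^ 'n::finite))"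
proof -
  have l: "Ck_on k S (fst :: real \<times> (real ^ 'n) \<Rightarrow> real)" "Ck_on k S (snd :: real \<times> (real ^ 'n) \<Rightarrow> real ^ 'n)"
    by (intro Ck_on_bounded_linear S bounded_linear_fst bounded_linear_snd)+
  have l3: "Ck_on k S (\<lambda>z :: real \<times> (real ^ 'n). (0 :: real, 0 :: real, snd z))"
    by (intro Ck_on_bounded_linear S bounded_linear_Pair bounded_linear_zero bounded_linear_snd)
  have "Ck_on k S (\<lambda>z :: real \<times> (real ^ 'n). ((fst z * fst z) *\<^sub>R (1, 0, 0) + (snd z \<bullet> snd z) *\<^sub>R (0, 1, 0)) + (0 :: real, 0 :: real, snd z))"
    by (intro Ck_on_add Ck_on_bilinear[OF bounded_bilinear_scaleR] Ck_on_bilinear[OF bounded_bilinear_mult]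
        Ck_on_bilinear[OF bounded_bilinear_inner] Ck_on_const S l l3)
  then show ?thesis
    by (rule Ck_on_cong[OF S, rotated]) (auto simp: power2_eq_square dot_square_norm)
qed

text \<open>
  The Laplace transform is smooth in the independent parameters \<open>(a, b, x)\<close>, and \<open>(t, x)\<close> enters through the
  polynomial map \<open>(t, x) \<mapsto> (t\<^sup>2, |x|\<^sup>2, x)\<close>.
\<close>

lemma poisson_Cinfinity:
  fixes f' :: "real ^ 'n::finite \<Rightarrow> complex"
  assumes f' [measurable]: "f' \<in> borel_measurable borel"
    and int: "\<And>p. p \<in> kern_domain \<Longrightarrow> integrable (lborel \<Otimes>\<^sub>M lborel) (\<lambda>\<omega>. exp (p \<bullet> kern_feature \<omega>) *\<^sub>R kern_density m \<nu> f' \<omega>)"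
  shows "Ck_on k ({0<..} \<times> UNIV) (\<lambda>(t, x). (c * t powr s) *\<^sub>R
    laplace (lborel \<Otimes>\<^sub>M lborel) kern_feature (kern_density m \<nu> f') (t\<^sup>2, (norm x)\<^sup>2, x))"
proof -
  let ?S = "{0<..} \<times> UNIV :: (real \<times> (real ^ 'n)) set"
  let ?L = "laplace (lborel \<Otimes>\<^sub>M lborel) kern_feature (kern_density m \<nu> f')"
  have S: "open ?S" by (intro open_Times) auto
  have "Ck_on k ?S (\<lambda>z. (c * fst z powr s) *\<^sub>R ?L ((\<lambda>(t, x). (t\<^sup>2, (norm x)\<^sup>2, x)) z))"
  proof (intro Ck_on_bilinear[OF bounded_bilinear_scaleR] S)
    show "Ck_on k ?S (\<lambda>z. c * fst z powr s)"
      by (rule Ck_on_compose[OF S _ _ Ck_on_powr, of fst]) (auto intro!: Ck_on_bounded_linear S bounded_linear_fst)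
    show "Ck_on k ?S (\<lambda>z. ?L ((\<lambda>(t, x). (t\<^sup>2, (norm x)\<^sup>2, x)) z))"
    proof (rule Ck_on_compose[OF S _ Ck_on_parabolic_point[OF S]])
      show "Ck_on k kern_domain ?L"
        by (rule laplace_Ck_on[OF _ _ open_kern_domain int]) measurable
    qed (auto simp: kern_domain_def)
  qed
  then show ?thesis by (rule Ck_on_cong[OF S, rotated]) auto
qed

lemma laplace_has_vector_derivative:
  fixes T :: "'w \<Rightarrow> 'e::euclidean_space" and g :: "'w \<Rightarrow> complex"
  assumes "T \<in> borel_measurable M" "g \<in> borel_measurable M" "open U"
    and int: "\<And>p. p \<in> U \<Longrightarrow> integrable M (\<lambda>\<omega>. exp (p \<bullet> T \<omega>) *\<^sub>R g \<omega>)"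
    and \<gamma>: "\<gamma> r \<in> U" "(\<gamma> has_vector_derivative v) (at r)"
  shows "((\<lambda>r. laplace M T g (\<gamma> r)) has_vector_derivative laplace M T (\<lambda>\<omega>. (v \<bullet> T \<omega>) *\<^sub>R g \<omega>) (\<gamma> r)) (at r)"
proof -
  let ?D = "\<lambda>w. laplace M T (\<lambda>\<omega>. (w \<bullet> T \<omega>) *\<^sub>R g \<omega>) (\<gamma> r)"
  have D: "(laplace M T g has_derivative ?D) (at (\<gamma> r))"
    by (rule laplace_has_derivative[OF assms(1,2,3) \<gamma>(1) int])
  have "((\<lambda>r. laplace M T g (\<gamma> r)) has_derivative (\<lambda>h. ?D (h *\<^sub>R v))) (at r)"
    by (rule has_derivative_compose[OF \<gamma>(2)[unfolded has_vector_derivative_def] D])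
  then show ?thesis
    unfolding has_vector_derivative_def using linear_scale[OF has_derivative_linear[OF D]] by simp
qed

lemma DERIV_coth2: "u > 0 \<Longrightarrow> (coth2 has_real_derivative - (2 * (csch2 u)\<^sup>2)) (at u)"
proof -
  assume u: "u > 0"
  then have s: "sinh (2 * u) \<noteq> 0" by simp
  have "((\<lambda>u. cosh (2 * u) / sinh (2 * u)) has_real_derivative (2 * (sinh (2 * u))\<^sup>2 - 2 * (cosh (2 * u))\<^sup>2) / (sinh (2 * u))\<^sup>2) (at u)"
    using s by (auto intro!: derivative_eq_intros simp: power2_eq_square)
  moreover have "(2 * (sinh (2 * u))\<^sup>2 - 2 * (cosh (2 * u))\<^sup>2) / (sinh (2 * u))\<^sup>2 = - (2 * (csch2 u)\<^sup>2)"
    using cosh_square_eq[of "2 * u"] by (simp add: csch2_def power_divide)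
  ultimately show ?thesis unfolding coth2_def[abs_def] by simp
qed

lemma DERIV_csch2: "u > 0 \<Longrightarrow> (csch2 has_real_derivative - (2 * csch2 u * coth2 u)) (at u)"
proof -
  assume u: "u > 0"
  then have s: "sinh (2 * u) \<noteq> 0" by simp
  have "((\<lambda>u. 1 / sinh (2 * u)) has_real_derivative - (2 * cosh (2 * u) / (sinh (2 * u))\<^sup>2)) (at u)"
    using s by (auto intro!: derivative_eq_intros simp: power2_eq_square)
  moreover have "- (2 * cosh (2 * u) / (sinh (2 * u))\<^sup>2) = - (2 * csch2 u * coth2 u)"
    by (simp add: csch2_def coth2_def power2_eq_square)
  ultimately show ?thesis unfolding csch2_def[abs_def] by simp
qed

text \<open>
  The logarithmic derivative of the integrand of the Poisson kernel in the time variable \<open>u\<close>. It is a quadratic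
  polynomial in the components of \<open>kern_feature\<close>, namely the one that the differential operator
  \<open>\<partial>\<^sub>t\<^sub>t + ((1 - 2\<nu>)/t) \<partial>\<^sub>t - L\<close> produces when it acts on that integrand with its factor
  \<open>t powr (2 * \<nu>)\<close>.
\<close>

definition kern_log_deriv :: "real \<Rightarrow> real \<Rightarrow> real \<Rightarrow> real ^ 'n \<Rightarrow> real \<Rightarrow> real ^ 'n::finite \<Rightarrow> real" where
  "kern_log_deriv m \<nu> t x u y = - ((1 + \<nu>) / u) - m - real CARD('n) * coth2 u - 2 * csch2 u * coth2 u * (x \<bullet> y)
     + t\<^sup>2 / (4 * u\<^sup>2) + (csch2 u)\<^sup>2 * ((norm x)\<^sup>2 + (norm y)\<^sup>2)"

lemma DERIV_kern:
  fixes x y :: "real ^ 'n::finite"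
  assumes u: "u > 0"
  shows "((\<lambda>u. pkern m \<nu> t x u y) has_real_derivative
    kern_log_deriv m \<nu> t x u y * (pkern m \<nu> t x u y)) (at u)"
proof -
  \<comment> \<open>The logarithm of the integrand is differentiated instead, which turns the powers into sums.\<close>
  define E where "E = (\<lambda>u. - (1 + \<nu>) * ln u - u * m - real CARD('n) / 2 * ln (2 * pi * sinh (2 * u))
    + (csch2 u * (x \<bullet> y) - t\<^sup>2 / (4 * u) - (norm x)\<^sup>2 * (coth2 u / 2) - coth2 u / 2 * (norm y)\<^sup>2))"
  have eq: "exp (E u) = pkern m \<nu> t x u y" if "u \<in> {0<..}" for u
  proof -
    have "2 * pi * sinh (2 * u) > 0" using that by simp
    moreover have "E u = - (1 + \<nu>) * ln u + - (real CARD('n) / 2) * ln (2 * pi * sinh (2 * u)) + - (u * m)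
      + (csch2 u * (x \<bullet> y) - t\<^sup>2 / (4 * u) - (norm x)\<^sup>2 * (coth2 u / 2) - coth2 u / 2 * (norm y)\<^sup>2)"
      unfolding E_def by linarith
    ultimately show ?thesis using that unfolding kern_eq powr_def by (simp only: exp_add) simp
  qed
  have s: "sinh (2 * u) > 0" using u by simp
  have lnsinh: "((\<lambda>u. ln (2 * pi * sinh (2 * u))) has_real_derivative 2 * coth2 u) (at u)"
  proof -
    have "((\<lambda>u. ln (2 * pi * sinh (2 * u))) has_real_derivative 2 * pi * (cosh (2 * u) * 2) / (2 * pi * sinh (2 * u))) (at u)"
      using s by (auto intro!: derivative_eq_intros)
    moreover have "2 * pi * (cosh (2 * u) * 2) / (2 * pi * sinh (2 * u)) = 2 * coth2 u" by (simp add: coth2_def)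
    ultimately show ?thesis by simp
  qed
  have lin: "((\<lambda>u. t\<^sup>2 / (4 * u)) has_real_derivative - (t\<^sup>2 / (4 * u\<^sup>2))) (at u)"
    using u by (auto intro!: derivative_eq_intros simp: power2_eq_square field_simps)
  have "(E has_real_derivative - (1 + \<nu>) * (1 / u) - m - real CARD('n) / 2 * (2 * coth2 u)
    + (- (2 * csch2 u * coth2 u) * (x \<bullet> y) - (- (t\<^sup>2 / (4 * u\<^sup>2))) - (norm x)\<^sup>2 * (- (2 * (csch2 u)\<^sup>2) / 2) - - (2 * (csch2 u)\<^sup>2) / 2 * (norm y)\<^sup>2)) (at u)"
    unfolding E_def using u
    by (intro DERIV_add DERIV_diff DERIV_cmult DERIV_cmult_right DERIV_cdivide DERIV_csch2 DERIV_coth2 lnsinh lin)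
      (auto intro!: derivative_eq_intros simp: divide_inverse)
  moreover have "- (1 + \<nu>) * (1 / u) - m - real CARD('n) / 2 * (2 * coth2 u)
    + (- (2 * csch2 u * coth2 u) * (x \<bullet> y) - (- (t\<^sup>2 / (4 * u\<^sup>2))) - (norm x)\<^sup>2 * (- (2 * (csch2 u)\<^sup>2) / 2) - - (2 * (csch2 u)\<^sup>2) / 2 * (norm y)\<^sup>2)
    = kern_log_deriv m \<nu> t x u y"
    unfolding kern_log_deriv_def by (simp add: algebra_simps add_divide_distrib)
  ultimately have "(E has_real_derivative kern_log_deriv m \<nu> t x u y) (at u)" by (simp only:)
  then have "((\<lambda>u. exp (E u)) has_real_derivative exp (E u) * kern_log_deriv m \<nu> t x u y) (at u)"
    by (rule DERIV_fun_exp)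
  then have "((\<lambda>u. pkern m \<nu> t x u y) has_real_derivative exp (E u) * kern_log_deriv m \<nu> t x u y) (at u)"
    by (rule has_field_derivative_transform_within_open[where S = "{0<..}"]) (use u eq in auto)
  moreover have "exp (E u) = pkern m \<nu> t x u y" using eq u by simp
  ultimately show ?thesis by (simp only: mult.commute[of "kern_log_deriv m \<nu> t x u y"])
qed

lemma isCont_kern_log_deriv: "u > 0 \<Longrightarrow> isCont (\<lambda>u. kern_log_deriv m \<nu> t x u y) u"
  unfolding kern_log_deriv_def using DERIV_isCont[OF DERIV_coth2] DERIV_isCont[OF DERIV_csch2]
  by (intro continuous_intros) auto

lemma kern_tendsto_0:
  fixes x y :: "real ^ 'n::finite"
  assumes t: "t > 0" and \<nu>: "\<nu> > 0"
  shows "((\<lambda>u. pkern m \<nu> t x u y) \<longlongrightarrow> 0) (at_right 0)"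
proof -
  have h: "(norm x)\<^sup>2 < t\<^sup>2 + (norm x)\<^sup>2" using t by simp
  obtain u0 \<delta> C where C: "0 < u0" "u0 \<le> 1" "0 < \<delta>" "0 < C"
    "\<And>u y. 0 < u \<Longrightarrow> u \<le> u0 \<Longrightarrow> pkern m \<nu> t x u y \<le> C * exp (- (\<delta> / u)) * exp (- (norm y)\<^sup>2)"
    by (rule kern_small[OF h \<nu>, where m = m]) (rule that; assumption)
  show ?thesis
  proof (rule tendsto_sandwich[OF _ _ tendsto_const])
    show "\<forall>\<^sub>F u in at_right 0. 0 \<le> pkern m \<nu> t x u y"
      by (intro always_eventually allI mult_nonneg_nonneg kern_nonneg less_imp_le[OF kern_nonneg(2)])
    show "\<forall>\<^sub>F u in at_right 0. pkern m \<nu> t x u y \<le> C * exp (- (\<delta> / u)) * exp (- (norm y)\<^sup>2)"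
      unfolding eventually_at_right_field using C(1,5) by (intro exI[of _ u0]) auto
    have "((\<lambda>u. exp (- (\<delta> / u))) \<longlongrightarrow> 0) (at_right 0)" using C(3) by real_asymp
    then show "((\<lambda>u. C * exp (- (\<delta> / u)) * exp (- (norm y)\<^sup>2)) \<longlongrightarrow> 0) (at_right 0)"
      by (auto intro!: tendsto_mult_left_zero tendsto_mult_right_zero)
  qed
qed

lemma kern_tendsto_infinity:
  fixes x y :: "real ^ 'n::finite"
  assumes \<nu>: "\<nu> > 0" and m: "m \<ge> - real CARD('n)"
  shows "((\<lambda>u. pkern m \<nu> t x u y) \<longlongrightarrow> 0) at_top"
proof -
  have h: "0 \<le> t\<^sup>2 + (norm x)\<^sup>2" by simp
  obtain C where C: "0 < C"
    "\<And>u y. 1 \<le> u \<Longrightarrow> pkern m \<nu> t x u y \<le>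
      C * exp (- ((norm y)\<^sup>2 / 2)) * (u powr (- (1 + \<nu>)) * exp (- ((real CARD('n) + m) * u)) * exp (- ((exp (- (2 * u)) * norm y)\<^sup>2 / 2)))"
    by (rule kern_large[OF h zero_less_one, where m = m and \<nu> = \<nu> and x = x]) (rule that; assumption)
  show ?thesis
  proof (rule tendsto_sandwich[OF _ _ tendsto_const])
    show "\<forall>\<^sub>F u in at_top. 0 \<le> pkern m \<nu> t x u y"
      by (intro always_eventually allI mult_nonneg_nonneg kern_nonneg less_imp_le[OF kern_nonneg(2)])
    have "pkern m \<nu> t x u y \<le> C * u powr (- (1 + \<nu>))" if u: "u \<ge> 1" for u
    proof -
      have pw: "u powr (- (1 + \<nu>)) * exp (- ((real CARD('n) + m) * u)) * exp (- ((exp (- (2 * u)) * norm y)\<^sup>2 / 2)) \<le> u powr (- (1 + \<nu>)) * 1 * 1"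
        using m u mult_nonneg_nonneg[of "real CARD('n) + m" u] by (intro mult_mono) auto
      have "C * exp (- ((norm y)\<^sup>2 / 2)) * (u powr (- (1 + \<nu>)) * exp (- ((real CARD('n) + m) * u)) * exp (- ((exp (- (2 * u)) * norm y)\<^sup>2 / 2)))
        \<le> C * (u powr (- (1 + \<nu>)) * 1 * 1)"
      proof (rule mult_mono)
        show "C * exp (- ((norm y)\<^sup>2 / 2)) \<le> C" using C(1) by simp
      qed (use C(1) pw in auto)
      with C(2)[OF u, of y] show ?thesis by simp
    qed
    then show "\<forall>\<^sub>F u in at_top. pkern m \<nu> t x u y \<le> C * u powr (- (1 + \<nu>))"
      unfolding eventually_at_top_linorder by blast
    have "((\<lambda>u. u powr (- (1 + \<nu>))) \<longlongrightarrow> 0) at_top" using \<nu> by real_asymp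
    then show "((\<lambda>u. C * u powr (- (1 + \<nu>))) \<longlongrightarrow> 0) at_top" by (rule tendsto_mult_right_zero)
  qed
qed

text \<open>
  The integrand tends to \<open>0\<close> at both ends of the time axis, so its derivative has integral \<open>0\<close>.
\<close>

lemma kern_integral_deriv_eq_0:
  fixes x y :: "real ^ 'n::finite"
  assumes t: "t > 0" and \<nu>: "\<nu> > 0" and m: "m \<ge> - real CARD('n)"
    and int: "integrable lborel (\<lambda>u. indicator {0<..} u * (kern_log_deriv m \<nu> t x u y * (pkern m \<nu> t x u y)))"
  shows "(\<integral>u. indicator {0<..} u * (kern_log_deriv m \<nu> t x u y * (pkern m \<nu> t x u y)) \<partial>lborel) = 0"
proof -
  let ?\<rho> = "\<lambda>u. pkern m \<nu> t x u y"
  have "(LBINT u=ereal 0..\<infinity>. kern_log_deriv m \<nu> t x u y * ?\<rho> u) = 0 - 0"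
  proof (rule interval_integral_FTC_integrable[where F = ?\<rho>])
    show "(?\<rho> has_vector_derivative kern_log_deriv m \<nu> t x u y * ?\<rho> u) (at u)" if "ereal 0 < ereal u" for u
      using DERIV_kern[of u] that by (simp add: has_real_derivative_iff_has_vector_derivative)
    show "isCont (\<lambda>u. kern_log_deriv m \<nu> t x u y * ?\<rho> u) u" if "ereal 0 < ereal u" for u
      using that isCont_kern_log_deriv DERIV_isCont[OF DERIV_kern] by (intro isCont_mult[of u "\<lambda>u. kern_log_deriv m \<nu> t x u y" ?\<rho>]) auto
    have "einterval (ereal 0) \<infinity> = {0<..}" by (auto simp: einterval_def)
    then show "set_integrable lborel (einterval (ereal 0) \<infinity>) (\<lambda>u. kern_log_deriv m \<nu> t x u y * ?\<rho> u)"
      using int by (simp add: set_integrable_def)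
    show "((?\<rho> \<circ> real_of_ereal) \<longlongrightarrow> 0) (at_right (ereal 0))"
      unfolding ereal_tendsto_simps by (rule kern_tendsto_0[OF t \<nu>])
    show "((?\<rho> \<circ> real_of_ereal) \<longlongrightarrow> 0) (at_left \<infinity>)"
      unfolding ereal_tendsto_simps by (rule kern_tendsto_infinity[OF \<nu> m])
  qed auto
  then show ?thesis
    unfolding interval_integral_to_infinity_eq set_lebesgue_integral_def by simp
qed

section \<open>The differential equation\<close>

text \<open>
  The hypothesis under which Laplace transforms may be differentiated; it passes from a density to its moments.
\<close>

definition kern_admissible :: "(real \<times> (real ^ 'n::finite) \<Rightarrow> complex) \<Rightarrow> bool" where
  "kern_admissible g \<longleftrightarrow> g \<in> borel_measurable (lborel \<Otimes>\<^sub>M lborel) \<and>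
     (\<forall>p\<in>kern_domain. integrable (lborel \<Otimes>\<^sub>M lborel) (\<lambda>\<omega>. exp (p \<bullet> kern_feature \<omega>) *\<^sub>R g \<omega>))"

definition kern_moment :: "real \<times> real \<times> (real ^ 'n::finite) \<Rightarrow> (real \<times> (real ^ 'n) \<Rightarrow> complex) \<Rightarrow> real \<times> (real ^ 'n) \<Rightarrow> complex" where
  "kern_moment w g = (\<lambda>\<omega>. (w \<bullet> kern_feature \<omega>) *\<^sub>R g \<omega>)"

abbreviation kern_laplace :: "(real \<times> (real ^ 'n::finite) \<Rightarrow> complex) \<Rightarrow> real \<times> real \<times> (real ^ 'n) \<Rightarrow> complex" where
  "kern_laplace \<equiv> laplace (lborel \<Otimes>\<^sub>M lborel) kern_feature"

lemma kern_admissible_moment: "kern_admissible g \<Longrightarrow> kern_admissible (kern_moment w g)"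
proof -
  assume "kern_admissible g"
  then have g [measurable]: "g \<in> borel_measurable (lborel \<Otimes>\<^sub>M lborel)"
    and int: "\<And>p. p \<in> kern_domain \<Longrightarrow> integrable (lborel \<Otimes>\<^sub>M lborel) (\<lambda>\<omega>. exp (p \<bullet> kern_feature \<omega>) *\<^sub>R g \<omega>)"
    by (auto simp: kern_admissible_def)
  have "integrable (lborel \<Otimes>\<^sub>M lborel) (\<lambda>\<omega>. exp (p \<bullet> kern_feature \<omega>) *\<^sub>R (w \<bullet> kern_feature \<omega>) *\<^sub>R g \<omega>)" if "p \<in> kern_domain" for p
    by (rule laplace_integrable_moment[OF borel_measurable_kern_feature g open_kern_domain that int])
  moreover have "(\<lambda>\<omega>. (w \<bullet> kern_feature \<omega>) *\<^sub>R g \<omega>) \<in> borel_measurable (lborel \<Otimes>\<^sub>M lborel)" by measurable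
  ultimately show ?thesis unfolding kern_admissible_def kern_moment_def by blast
qed

lemma kern_laplace_has_vector_derivative:
  assumes "kern_admissible g" "\<gamma> r \<in> kern_domain" "(\<gamma> has_vector_derivative v) (at r)"
  shows "((\<lambda>r. kern_laplace g (\<gamma> r)) has_vector_derivative kern_laplace (kern_moment v g) (\<gamma> r)) (at r)"
  unfolding kern_moment_def using assms(1)
  by (intro laplace_has_vector_derivative[OF borel_measurable_kern_feature _ open_kern_domain _ assms(2,3)])
    (auto simp: kern_admissible_def)

lemma kern_laplace_moment_linear:
  assumes g: "kern_admissible g" and p: "p \<in> kern_domain"
  shows "kern_laplace (kern_moment (a *\<^sub>R v + w) g) p = a *\<^sub>R kern_laplace (kern_moment v g) p + kern_laplace (kern_moment w g) p"
proof -
  have "((kern_laplace g) has_derivative (\<lambda>w. kern_laplace (kern_moment w g) p)) (at p)"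
    unfolding kern_moment_def using g
    by (intro laplace_has_derivative[OF borel_measurable_kern_feature _ open_kern_domain p]) (auto simp: kern_admissible_def)
  then have lin: "linear (\<lambda>w. kern_laplace (kern_moment w g) p)" by (rule has_derivative_linear)
  show ?thesis unfolding linear_add[OF lin] linear_scale[OF lin] ..
qed

lemma has_bochner_kern_laplace:
  assumes "kern_admissible g" "p \<in> kern_domain"
  shows "has_bochner_integral (lborel \<Otimes>\<^sub>M lborel) (\<lambda>\<omega>. exp (p \<bullet> kern_feature \<omega>) *\<^sub>R g \<omega>) (kern_laplace g p)"
  using assms by (simp add: kern_admissible_def laplace_def has_bochner_integral_iff)

text \<open>
  The coordinate directions of the parameter space: \<open>e1\<close> for \<open>a = t\<^sup>2\<close>, \<open>e2\<close> for \<open>b = |x|\<^sup>2\<close>, and \<open>e3 i\<close> for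
  the \<open>i\<close>-th coordinate of \<open>x\<close>.
\<close>

abbreviation "e1 \<equiv> (1, 0, 0)"
abbreviation "e2 \<equiv> (0, 1, 0)"
abbreviation "e3 i \<equiv> (0, 0, axis i 1)"

abbreviation ppoint :: "real \<Rightarrow> real ^ 'n \<Rightarrow> real \<times> real \<times> (real ^ 'n)" where
  "ppoint t x \<equiv> (t\<^sup>2, (norm x)\<^sup>2, x)"

text \<open>
  The second derivative of \<open>x \<mapsto> \<Phi>(t\<^sup>2, |x|\<^sup>2, x)\<close> in the \<open>i\<close>-th coordinate, by the chain rule.
\<close>

abbreviation kern_hess :: "real \<Rightarrow> real ^ 'n \<Rightarrow> 'n::finite \<Rightarrow> (real \<times> (real ^ 'n) \<Rightarrow> complex) \<Rightarrow> complex" where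
  "kern_hess t x i g \<equiv> 2 *\<^sub>R kern_laplace (kern_moment e2 g) (ppoint t x)
      + (2 * x $ i) *\<^sub>R ((2 * x $ i) *\<^sub>R kern_laplace (kern_moment e2 (kern_moment e2 g)) (ppoint t x)
        + kern_laplace (kern_moment (e3 i) (kern_moment e2 g)) (ppoint t x))
      + ((2 * x $ i) *\<^sub>R kern_laplace (kern_moment e2 (kern_moment (e3 i) g)) (ppoint t x)
        + kern_laplace (kern_moment (e3 i) (kern_moment (e3 i) g)) (ppoint t x))"

lemma ppoint_in_domain: "t \<noteq> 0 \<Longrightarrow> ppoint t x \<in> kern_domain"
  by (simp add: kern_domain_def)

lemma powr_kern_laplace_derivative_t:
  assumes g: "kern_admissible g" and r: "r > 0"
  shows "((\<lambda>r. r powr s *\<^sub>R kern_laplace g (ppoint r x)) has_vector_derivative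
    (s * r powr (s - 1)) *\<^sub>R kern_laplace g (ppoint r x) + (2 * r powr (s + 1)) *\<^sub>R kern_laplace (kern_moment e1 g) (ppoint r x)) (at r)"
proof -
  let ?p = "\<lambda>r. ppoint r x"
  have dom: "?p r \<in> kern_domain" using r by (intro ppoint_in_domain) simp
  have "((\<lambda>r. r\<^sup>2) has_vector_derivative (2 * r)) (at r)"
    unfolding has_real_derivative_iff_has_vector_derivative[symmetric] by (auto intro!: derivative_eq_intros)
  then have "(?p has_vector_derivative (2 * r, 0, 0)) (at r)"
    by (intro has_vector_derivative_Pair has_vector_derivative_const)
  then have "(?p has_vector_derivative ((2 * r) *\<^sub>R e1 + 0)) (at r)" by simp
  from kern_laplace_has_vector_derivative[OF g dom this]
  have d: "((\<lambda>r. kern_laplace g (?p r)) has_vector_derivative (2 * r) *\<^sub>R kern_laplace (kern_moment e1 g) (?p r)) (at r)"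
    unfolding kern_laplace_moment_linear[OF g dom] by (simp add: kern_moment_def laplace_def)
  have "((\<lambda>r. r powr s) has_field_derivative s * r powr (s - 1)) (at r)"
    using r by (auto intro!: derivative_eq_intros)
  from has_vector_derivative_scaleR[OF this d]
  have "((\<lambda>r. r powr s *\<^sub>R kern_laplace g (?p r)) has_vector_derivative
    (r powr s *\<^sub>R ((2 * r) *\<^sub>R kern_laplace (kern_moment e1 g) (?p r)) + (s * r powr (s - 1)) *\<^sub>R kern_laplace g (?p r))) (at r)" .
  moreover have "r powr s * (2 * r) = 2 * r powr (s + 1)" using r by (simp add: powr_add)
  ultimately show ?thesis by (simp only: scaleR_scaleR add.commute)
qed

lemma kern_laplace_derivative_x:
  fixes g :: "real \<times> (real ^ 'n::finite) \<Rightarrow> complex"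
  assumes g: "kern_admissible g" and t: "t > 0"
  shows "((\<lambda>s. kern_laplace g (ppoint t (x + s *\<^sub>R axis i 1))) has_vector_derivative
    (2 * x $ i) *\<^sub>R kern_laplace (kern_moment e2 g) (ppoint t x) + kern_laplace (kern_moment (e3 i) g) (ppoint t x)) (at 0)"
proof -
  let ?p = "\<lambda>s. ppoint t (x + s *\<^sub>R axis i 1)"
  have dom: "ppoint t x \<in> kern_domain" using t by (intro ppoint_in_domain) simp
  have nrm: "(norm (x + s *\<^sub>R axis i 1))\<^sup>2 = (norm x)\<^sup>2 + 2 * s * x $ i + s\<^sup>2" for s
    unfolding power2_norm_eq_inner
    by (simp add: inner_add_left inner_add_right inner_axis inner_commute[of "axis i 1"] inner_axis_axis power2_eq_square algebra_simps)
  have "((\<lambda>s. (norm (x + s *\<^sub>R axis i 1))\<^sup>2) has_vector_derivative (2 * x $ i)) (at 0)"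
    unfolding nrm has_real_derivative_iff_has_vector_derivative[symmetric] by (auto intro!: derivative_eq_intros)
  moreover have "((\<lambda>s. x + s *\<^sub>R axis i 1) has_vector_derivative axis i 1) (at 0)"
    by (auto intro!: derivative_eq_intros)
  ultimately have "(?p has_vector_derivative (0, 2 * x $ i, axis i 1)) (at 0)"
    by (intro has_vector_derivative_Pair has_vector_derivative_const)
  then have v: "(?p has_vector_derivative ((2 * x $ i) *\<^sub>R e2 + e3 i)) (at 0)" by simp
  have "((\<lambda>s. kern_laplace g (?p s)) has_vector_derivative kern_laplace (kern_moment ((2 * x $ i) *\<^sub>R e2 + e3 i) g) (?p 0)) (at 0)"
    by (rule kern_laplace_has_vector_derivative[OF g _ v]) (use dom in simp)
  then show ?thesis using dom by (simp add: kern_laplace_moment_linear[OF g] del: scaleR_Pair add_Pair)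
qed

lemma partial_deriv_kern_laplace:
  fixes g :: "real \<times> (real ^ 'n::finite) \<Rightarrow> complex"
  assumes g: "kern_admissible g" and t: "t > 0"
  shows "partial_deriv i (\<lambda>x. A *\<^sub>R kern_laplace g (ppoint t x)) x =
    A *\<^sub>R ((2 * x $ i) *\<^sub>R kern_laplace (kern_moment e2 g) (ppoint t x) + kern_laplace (kern_moment (e3 i) g) (ppoint t x))"
  unfolding partial_deriv_def
  by (rule vector_derivative_at)
    (intro bounded_linear.has_vector_derivative[OF bounded_linear_scaleR_right] kern_laplace_derivative_x[OF g t])

lemma partial_deriv2_kern_laplace:
  fixes g :: "real \<times> (real ^ 'n::finite) \<Rightarrow> complex"
  assumes g: "kern_admissible g" and t: "t > 0"
  shows "partial_deriv i (partial_deriv i (\<lambda>x. A *\<^sub>R kern_laplace g (ppoint t x))) x =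
    A *\<^sub>R (kern_hess t x i g)"
proof -
  let ?F2 = "\<lambda>x. kern_laplace (kern_moment e2 g) (ppoint t x)" and ?F3 = "\<lambda>x. kern_laplace (kern_moment (e3 i) g) (ppoint t x)"
  let ?B = "(2 * x $ i) *\<^sub>R ((2 * x $ i) *\<^sub>R kern_laplace (kern_moment e2 (kern_moment e2 g)) (ppoint t x)
        + kern_laplace (kern_moment (e3 i) (kern_moment e2 g)) (ppoint t x))"
    and ?C = "((2 * x $ i) *\<^sub>R kern_laplace (kern_moment e2 (kern_moment (e3 i) g)) (ppoint t x)
        + kern_laplace (kern_moment (e3 i) (kern_moment (e3 i) g)) (ppoint t x))"
  note ok = kern_admissible_moment[OF g]
  have c: "((\<lambda>s. 2 * (x + s *\<^sub>R axis i 1) $ i) has_field_derivative 2) (at 0)"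
    by (auto intro!: derivative_eq_intros simp: axis_def)
  from has_vector_derivative_scaleR[OF c kern_laplace_derivative_x[OF ok[of e2] t, of x i]]
  have 1: "((\<lambda>s. (2 * (x + s *\<^sub>R axis i 1) $ i) *\<^sub>R ?F2 (x + s *\<^sub>R axis i 1)) has_vector_derivative
     ?B + 2 *\<^sub>R ?F2 x) (at 0)" by simp
  have "((\<lambda>s. A *\<^sub>R ((2 * (x + s *\<^sub>R axis i 1) $ i) *\<^sub>R ?F2 (x + s *\<^sub>R axis i 1) + ?F3 (x + s *\<^sub>R axis i 1))) has_vector_derivative
    A *\<^sub>R ((?B + 2 *\<^sub>R ?F2 x)
      + ?C)) (at 0)"
    by (intro bounded_linear.has_vector_derivative[OF bounded_linear_scaleR_right] has_vector_derivative_add 1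
        kern_laplace_derivative_x[OF ok t])
  then have V: "vector_derivative (\<lambda>s. A *\<^sub>R ((2 * (x + s *\<^sub>R axis i 1) $ i) *\<^sub>R ?F2 (x + s *\<^sub>R axis i 1) + ?F3 (x + s *\<^sub>R axis i 1))) (at 0)
    = A *\<^sub>R ((?B + 2 *\<^sub>R ?F2 x)
      + ?C)"
    by (rule vector_derivative_at)
  have PD: "partial_deriv i (\<lambda>x. A *\<^sub>R kern_laplace g (ppoint t x)) = (\<lambda>x. A *\<^sub>R ((2 * x $ i) *\<^sub>R ?F2 x + ?F3 x))"
    by (rule ext) (rule partial_deriv_kern_laplace[OF g t])
  show ?thesis unfolding PD unfolding partial_deriv_def V by (simp only: add_ac)
qed

text \<open>
  The left-hand side is what remains of \<open>u\<^sub>t\<^sub>t + ((1 - 2\<nu>)/t) u\<^sub>t - L u\<close> after division by \<open>t powr (2 * \<nu>)\<close> and a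
  constant. Collected under one integral it is the time derivative of the integrand times \<open>f\<close>. By Fubini's
  theorem the time integral can be carried out first, for almost every fixed \<open>y\<close>, and it vanishes.
\<close>

lemma kern_density_pde:
  fixes f :: "real ^ 'n::finite \<Rightarrow> complex"
  assumes g: "kern_admissible (kern_density m \<nu> f)" and t: "t > 0" and \<nu>: "\<nu> > 0" and m: "m \<ge> - real CARD('n)"
  defines "g \<equiv> kern_density m \<nu> f"
  shows "(4 + 4 * \<nu>) *\<^sub>R kern_laplace (kern_moment e1 g) (ppoint t x) + (4 * t\<^sup>2) *\<^sub>R kern_laplace (kern_moment e1 (kern_moment e1 g)) (ppoint t x)
    + (\<Sum>i\<in>UNIV. kern_hess t x i g)
    + (- (norm x)\<^sup>2 - m) *\<^sub>R kern_laplace g (ppoint t x) = 0" (is "?V = 0")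
proof -
  let ?p = "ppoint t x"
  let ?E = "\<lambda>\<omega>. exp (?p \<bullet> kern_feature \<omega>)"
  let ?I = "\<lambda>\<omega> i. 2 *\<^sub>R (?E \<omega> *\<^sub>R kern_moment e2 g \<omega>)
      + (2 * x $ i) *\<^sub>R ((2 * x $ i) *\<^sub>R (?E \<omega> *\<^sub>R kern_moment e2 (kern_moment e2 g) \<omega>)
        + ?E \<omega> *\<^sub>R kern_moment (e3 i) (kern_moment e2 g) \<omega>)
      + ((2 * x $ i) *\<^sub>R (?E \<omega> *\<^sub>R kern_moment e2 (kern_moment (e3 i) g) \<omega>)
        + ?E \<omega> *\<^sub>R kern_moment (e3 i) (kern_moment (e3 i) g) \<omega>)"
  let ?J = "\<lambda>\<omega>. (4 + 4 * \<nu>) *\<^sub>R (?E \<omega> *\<^sub>R kern_moment e1 g \<omega>) + (4 * t\<^sup>2) *\<^sub>R (?E \<omega> *\<^sub>R kern_moment e1 (kern_moment e1 g) \<omega>)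
    + (\<Sum>i\<in>UNIV. ?I \<omega> i)
    + (- (norm x)\<^sup>2 - m) *\<^sub>R (?E \<omega> *\<^sub>R g \<omega>)"
  have dom: "?p \<in> kern_domain" using t by (intro ppoint_in_domain) simp
  have ok: "kern_admissible g" unfolding g_def by (rule g)
  note ok1 = kern_admissible_moment[OF ok]
  note ok2 = kern_admissible_moment[OF ok1]
  \<comment> \<open>The polynomial in the components of \<open>kern_feature\<close> that collects all moments on the left-hand side.\<close>
  define S where "S \<omega> = (4 + 4 * \<nu>) * (e1 \<bullet> kern_feature \<omega>) + 4 * t\<^sup>2 * (e1 \<bullet> kern_feature \<omega>)\<^sup>2
    + (\<Sum>i\<in>UNIV. 2 * (e2 \<bullet> kern_feature \<omega>) + (2 * x $ i)\<^sup>2 * (e2 \<bullet> kern_feature \<omega>)\<^sup>2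
      + 2 * (2 * x $ i) * (e2 \<bullet> kern_feature \<omega>) * (e3 i \<bullet> kern_feature \<omega>) + (e3 i \<bullet> kern_feature \<omega>)\<^sup>2)
    + (- (norm x)\<^sup>2 - m)" for \<omega> :: "real \<times> (real ^ 'n)"
  have "has_bochner_integral (lborel \<Otimes>\<^sub>M lborel) ?J ?V"
    by (intro has_bochner_integral_add has_bochner_integral_scaleR_right has_bochner_integral_sum has_bochner_kern_laplace dom ok ok1 ok2)
  moreover have "?J \<omega> = (S \<omega> * ?E \<omega>) *\<^sub>R g \<omega>" for \<omega>
  proof -
    have "(\<Sum>i\<in>UNIV. ?I \<omega> i)
      = (\<Sum>i\<in>UNIV. ((2 * (e2 \<bullet> kern_feature \<omega>) + (2 * x $ i)\<^sup>2 * (e2 \<bullet> kern_feature \<omega>)\<^sup>2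
      + 2 * (2 * x $ i) * (e2 \<bullet> kern_feature \<omega>) * (e3 i \<bullet> kern_feature \<omega>) + (e3 i \<bullet> kern_feature \<omega>)\<^sup>2) * ?E \<omega>) *\<^sub>R g \<omega>)"
      by (intro sum.cong refl) (simp add: kern_moment_def algebra_simps power2_eq_square scaleR_conv_of_real)
    then show ?thesis
      unfolding S_def distrib_right sum_distrib_right scaleR_add_left scaleR_sum_left
      by (simp add: kern_moment_def algebra_simps power2_eq_square)
  qed
  ultimately have HB: "has_bochner_integral (lborel \<Otimes>\<^sub>M lborel) (\<lambda>\<omega>. (S \<omega> * ?E \<omega>) *\<^sub>R g \<omega>) ?V" by (simp only:)
  have S: "S (u, y) = kern_log_deriv m \<nu> t x u y" if u: "u > 0" for u and y :: "real ^ 'n"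
  proof -
    have "(\<Sum>i\<in>UNIV. 2 * (- (coth2 u / 2)) + (2 * x $ i)\<^sup>2 * (- (coth2 u / 2))\<^sup>2 + 2 * (2 * x $ i) * (- (coth2 u / 2)) * (csch2 u * y $ i) + (csch2 u * y $ i)\<^sup>2)
      = (\<Sum>i\<in>UNIV. - coth2 u + (coth2 u)\<^sup>2 * (x $ i * x $ i) - 2 * csch2 u * coth2 u * (x $ i * y $ i) + (csch2 u)\<^sup>2 * (y $ i * y $ i))"
      by (intro sum.cong refl) (simp add: power2_eq_square)
    also have "\<dots> = - (real CARD('n) * coth2 u) + (coth2 u)\<^sup>2 * (norm x)\<^sup>2 - 2 * csch2 u * coth2 u * (x \<bullet> y) + (csch2 u)\<^sup>2 * (norm y)\<^sup>2"
      by (simp add: sum.distrib sum_subtractf power2_norm_eq_inner inner_vec_def sum_distrib_left)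
    finally have sum: "(\<Sum>i\<in>UNIV. 2 * (- (coth2 u / 2)) + (2 * x $ i)\<^sup>2 * (- (coth2 u / 2))\<^sup>2 + 2 * (2 * x $ i) * (- (coth2 u / 2)) * (csch2 u * y $ i) + (csch2 u * y $ i)\<^sup>2)
      = - (real CARD('n) * coth2 u) + (coth2 u)\<^sup>2 * (norm x)\<^sup>2 - 2 * csch2 u * coth2 u * (x \<bullet> y) + (csch2 u)\<^sup>2 * (norm y)\<^sup>2" .
    have feat: "e1 \<bullet> kern_feature (u, y) = - (1 / (4 * u))" "e2 \<bullet> kern_feature (u, y) = - (coth2 u / 2)"
      "\<And>i. e3 i \<bullet> kern_feature (u, y) = csch2 u * y $ i"
      by (simp_all add: kern_feature_def inner_axis inner_commute[of "axis _ 1"])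
    show ?thesis
      using u unfolding S_def feat sum kern_log_deriv_def coth2_square[OF u]
      by (simp add: field_simps power2_eq_square)
  qed
  have spl: "(\<lambda>(u, y). (S (u, y) * ?E (u, y)) *\<^sub>R g (u, y)) = (\<lambda>\<omega>. (S \<omega> * ?E \<omega>) *\<^sub>R g \<omega>)"
    by (rule ext) (simp add: case_prod_beta)
  have int: "integrable (lborel \<Otimes>\<^sub>M lborel) (\<lambda>(u, y). (S (u, y) * ?E (u, y)) *\<^sub>R g (u, y))"
    unfolding spl using HB by (simp only: has_bochner_integral_iff)
  let ?\<rho>' = "\<lambda>u y. indicator {0<..} u * (kern_log_deriv m \<nu> t x u y * (pkern m \<nu> t x u y))"
  have eq: "(S (u, y) * ?E (u, y)) *\<^sub>R g (u, y) = ?\<rho>' u y *\<^sub>R f y" for u y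
    by (cases "u > 0") (simp_all add: S g_def kern_density_def kern_exp_eq_feature)
  have "?V = (\<integral>\<omega>. (S \<omega> * ?E \<omega>) *\<^sub>R g \<omega> \<partial>(lborel \<Otimes>\<^sub>M lborel))"
    using HB by (simp only: has_bochner_integral_iff)
  also have "\<dots> = (\<integral>y. (\<integral>u. (S (u, y) * ?E (u, y)) *\<^sub>R g (u, y) \<partial>lborel) \<partial>lborel)"
    using lborel_pair.integral_snd[OF int] unfolding spl by (rule sym)
  also have "\<dots> = (\<integral>y. 0 \<partial>(lborel :: (real ^ 'n) measure))"
  proof (rule integral_cong_AE)
    show "(\<lambda>y. \<integral>u. (S (u, y) * ?E (u, y)) *\<^sub>R g (u, y) \<partial>lborel) \<in> borel_measurable lborel"
      using borel_measurable_integrable[OF lborel_pair.integrable_snd[OF int]] by simp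
    show "AE y in lborel. (\<integral>u. (S (u, y) * ?E (u, y)) *\<^sub>R g (u, y) \<partial>lborel) = 0"
      using lborel_pair.AE_integrable_snd[OF int]
    proof eventually_elim
      fix y assume i: "integrable lborel (\<lambda>u. (S (u, y) * ?E (u, y)) *\<^sub>R g (u, y))"
      show "(\<integral>u. (S (u, y) * ?E (u, y)) *\<^sub>R g (u, y) \<partial>lborel) = 0"
      proof (cases "f y = 0")
        case True
        then show ?thesis unfolding eq by simp
      next
        case False
        have "(\<lambda>u. (?\<rho>' u y *\<^sub>R f y) / f y) = (\<lambda>u. complex_of_real (?\<rho>' u y))"
          using False by (simp add: fun_eq_iff scaleR_conv_of_real)
        then have "integrable lborel (\<lambda>u. complex_of_real (?\<rho>' u y))"
          using integrable_divide_zero[OF i[unfolded eq], of "f y"] by (simp only:)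
        then have \<rho>'_int: "integrable lborel (\<lambda>u. ?\<rho>' u y)" by (rule integrable_Re[of _ "\<lambda>u. complex_of_real (?\<rho>' u y)", unfolded Re_complex_of_real])
        then have "(\<integral>u. ?\<rho>' u y \<partial>lborel) = 0" by (rule kern_integral_deriv_eq_0[OF t \<nu> m])
        then show ?thesis unfolding eq integral_scaleR_left[OF \<rho>'_int] by simp
      qed
    qed
  qed simp
  finally show ?thesis by simp
qed

lemma poisson_pde:
  fixes f :: "real ^ 'n::finite \<Rightarrow> complex"
  assumes g: "kern_admissible (kern_density m \<nu> f')" and t: "t > 0" and \<nu>: "\<nu> > 0" and m: "m \<ge> - real CARD('n)"
    and rep: "\<And>t x. t > 0 \<Longrightarrow> poisson m \<nu> f t x = (c * t powr (2 * \<nu>)) *\<^sub>R kern_laplace (kern_density m \<nu> f') (ppoint t x)"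
  shows "extension_pde_at m \<nu> (poisson m \<nu> f) t x"
proof -
  define g where "g = kern_density m \<nu> f'"
  have ok: "kern_admissible g" unfolding g_def by (rule g)
  note ok1 = kern_admissible_moment[OF ok]
  let ?F = "\<lambda>g r. kern_laplace g (ppoint r x)"
  let ?m = "kern_moment e1"
  define P where "P = t powr (2 * \<nu>)"
  have d1: "((\<lambda>r. poisson m \<nu> f r x) has_vector_derivative
      c *\<^sub>R ((2 * \<nu> * r powr (2 * \<nu> - 1)) *\<^sub>R ?F g r + (2 * r powr (2 * \<nu> + 1)) *\<^sub>R ?F (?m g) r)) (at r)" if r: "r > 0" for r
  proof (rule has_vector_derivative_transform_within_open[where S = "{0<..}"])
    show "((\<lambda>r. c *\<^sub>R (r powr (2 * \<nu>) *\<^sub>R ?F g r)) has_vector_derivative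
      c *\<^sub>R ((2 * \<nu> * r powr (2 * \<nu> - 1)) *\<^sub>R ?F g r + (2 * r powr (2 * \<nu> + 1)) *\<^sub>R ?F (?m g) r)) (at r)"
      by (intro bounded_linear.has_vector_derivative[OF bounded_linear_scaleR_right] powr_kern_laplace_derivative_t ok r)
    show "c *\<^sub>R (r powr (2 * \<nu>) *\<^sub>R ?F g r) = poisson m \<nu> f r x" if "r \<in> {0<..}" for r
      using rep[of r x] that by (simp add: g_def)
  qed (use r in auto)
  have v1: "vector_derivative (\<lambda>r. poisson m \<nu> f r x) (at r) = c *\<^sub>R ((2 * \<nu>) *\<^sub>R (r powr (2 * \<nu> - 1) *\<^sub>R ?F g r) + 2 *\<^sub>R (r powr (2 * \<nu> + 1) *\<^sub>R ?F (?m g) r))" if r: "r > 0" for r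
    using vector_derivative_at[OF d1[OF r]] by simp
  have d2: "((\<lambda>s. vector_derivative (\<lambda>r. poisson m \<nu> f r x) (at s)) has_vector_derivative
      c *\<^sub>R ((2 * \<nu>) *\<^sub>R (((2 * \<nu> - 1) * t powr (2 * \<nu> - 1 - 1)) *\<^sub>R ?F g t + (2 * t powr (2 * \<nu> - 1 + 1)) *\<^sub>R ?F (?m g) t)
        + 2 *\<^sub>R (((2 * \<nu> + 1) * t powr (2 * \<nu> + 1 - 1)) *\<^sub>R ?F (?m g) t + (2 * t powr (2 * \<nu> + 1 + 1)) *\<^sub>R ?F (?m (?m g)) t))) (at t)"
  proof (rule has_vector_derivative_transform_within_open[where S = "{0<..}"])
    show "((\<lambda>r. c *\<^sub>R ((2 * \<nu>) *\<^sub>R (r powr (2 * \<nu> - 1) *\<^sub>R ?F g r) + 2 *\<^sub>R (r powr (2 * \<nu> + 1) *\<^sub>R ?F (?m g) r))) has_vector_derivative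
      c *\<^sub>R ((2 * \<nu>) *\<^sub>R (((2 * \<nu> - 1) * t powr (2 * \<nu> - 1 - 1)) *\<^sub>R ?F g t + (2 * t powr (2 * \<nu> - 1 + 1)) *\<^sub>R ?F (?m g) t)
        + 2 *\<^sub>R (((2 * \<nu> + 1) * t powr (2 * \<nu> + 1 - 1)) *\<^sub>R ?F (?m g) t + (2 * t powr (2 * \<nu> + 1 + 1)) *\<^sub>R ?F (?m (?m g)) t))) (at t)"
      by (intro bounded_linear.has_vector_derivative[OF bounded_linear_scaleR_right] has_vector_derivative_add powr_kern_laplace_derivative_t ok ok1 t)
  qed (use t v1 in auto)
  have pw: "t powr (2 * \<nu> - 1) = P / t" "t powr (2 * \<nu> + 1) = P * t" "t powr (2 * \<nu> - 1 - 1) = P / t\<^sup>2" "t powr (2 * \<nu> - 1 + 1) = P"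
    "t powr (2 * \<nu> + 1 - 1) = P" "t powr (2 * \<nu> + 1 + 1) = P * t\<^sup>2"
    using t by (simp_all add: P_def powr_add powr_diff power2_eq_square)
  have lhs: "vector_derivative (\<lambda>s. vector_derivative (\<lambda>r. poisson m \<nu> f r x) (at s)) (at t)
       + ((1 - 2 * \<nu>) / t) *\<^sub>R vector_derivative (\<lambda>r. poisson m \<nu> f r x) (at t)
    = (c * P) *\<^sub>R ((4 + 4 * \<nu>) *\<^sub>R ?F (?m g) t + (4 * t\<^sup>2) *\<^sub>R ?F (?m (?m g)) t)"
    unfolding vector_derivative_at[OF d2] v1[OF t] pw
    using t by (simp add: scaleR_conv_of_real field_simps power2_eq_square)
  have u: "poisson m \<nu> f t = (\<lambda>x. (c * P) *\<^sub>R kern_laplace g (ppoint t x))"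
    using rep[OF t] by (simp add: fun_eq_iff P_def g_def)
  define Lap where "Lap = (\<Sum>i\<in>UNIV. kern_hess t x i g)"
  have rhs: "hermite_op m (poisson m \<nu> f t) x = (c * P) *\<^sub>R (- Lap + ((norm x)\<^sup>2 + m) *\<^sub>R ?F g t)"
    unfolding hermite_op_def laplacian_def u partial_deriv2_kern_laplace[OF ok t] scaleR_sum_right[symmetric] Lap_def[symmetric]
    by (simp add: scaleR_conv_of_real algebra_simps)
  have "((4 + 4 * \<nu>) *\<^sub>R ?F (?m g) t + (4 * t\<^sup>2) *\<^sub>R ?F (?m (?m g)) t) + Lap + (- (norm x)\<^sup>2 - m) *\<^sub>R ?F g t = 0"
    using kern_density_pde[OF g t \<nu> m, of x] unfolding Lap_def g_def .
  then have "(4 + 4 * \<nu>) *\<^sub>R ?F (?m g) t + (4 * t\<^sup>2) *\<^sub>R ?F (?m (?m g)) t = - Lap + ((norm x)\<^sup>2 + m) *\<^sub>R ?F g t"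
    by (simp add: algebra_simps add_eq_0_iff2 eq_neg_iff_add_eq_0)
  then show ?thesis unfolding extension_pde_at_def lhs rhs by simp
qed

section \<open>Lebesgue points\<close>

text \<open>
  The measure with density \<open>h\<close> is finite and gives \<open>T\<close> mass \<open>0\<close>, so \<open>T\<close> lies in open sets \<open>U\<close> of arbitrarily
  small mass. The bad points of \<open>T\<close> are centres of small balls in \<open>U\<close> whose mass exceeds \<open>c\<close> times their
  volume. By Vitali's theorem disjoint balls among them cover almost all bad points, and their total volume is
  at most the mass of \<open>U\<close> divided by \<open>c\<close>.
\<close>

lemma AE_density_zero_off_support:
  fixes h :: "'a::euclidean_space \<Rightarrow> ennreal"
  assumes h [measurable]: "h \<in> borel_measurable borel" and fin: "(\<integral>\<^sup>+y. h y \<partial>lborel) < \<infinity>"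
    and T [measurable]: "T \<in> sets borel" and zero: "\<And>y. y \<in> T \<Longrightarrow> h y = 0" and c: "(c::real) > 0"
  shows "AE x in lborel. x \<in> T \<longrightarrow>
    (\<forall>\<^sub>F r in at_right 0. (\<integral>\<^sup>+y\<in>ball x r. h y \<partial>lborel) \<le> ennreal c * emeasure lborel (ball x r))"
proof -
  define \<nu> where "\<nu> = density lborel h"
  define S where "S = {x\<in>T. \<not> (\<forall>\<^sub>F r in at_right 0. (\<integral>\<^sup>+y\<in>ball x r. h y \<partial>lborel) \<le> ennreal c * emeasure lborel (ball x r))}"
  have \<nu>: "emeasure \<nu> A = (\<integral>\<^sup>+y\<in>A. h y \<partial>lborel)" if "A \<in> sets borel" for A
    using that unfolding \<nu>_def by (simp add: emeasure_density)
  have sets\<nu>: "sets \<nu> = sets borel" by (simp add: \<nu>_def)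
  have fin\<nu>: "emeasure \<nu> (space \<nu>) \<noteq> \<infinity>"
    using fin \<nu>[of UNIV] by (simp add: \<nu>_def)
  have "emeasure \<nu> T = 0"
  proof -
    have "(\<lambda>y. h y * indicator T y) = (\<lambda>_. 0)"
      using zero by (auto simp: fun_eq_iff split: split_indicator)
    then show ?thesis by (simp add: \<nu>[OF T])
  qed
  then have inf0: "(INF U\<in>{U. T \<subseteq> U \<and> open U}. emeasure \<nu> U) = 0"
    using outer_regular[OF sets\<nu> fin\<nu> T] by simp
  have "negligible S"
    unfolding negligible_outer_le
  proof (intro allI impI)
    fix e :: real assume e: "e > 0"
    have "(INF U\<in>{U. T \<subseteq> U \<and> open U}. emeasure \<nu> U) < ennreal (c * e)"
      using inf0 c e by simp
    then obtain U where U: "T \<subseteq> U" "open U" "emeasure \<nu> U < ennreal (c * e)"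
      unfolding INF_less_iff by auto
    define K where "K = {(x, r). 0 < r \<and> ball x r \<subseteq> U \<and> ennreal c * emeasure lborel (ball x r) < emeasure \<nu> (ball x r)}"
    have cover: "\<exists>i. i \<in> K \<and> x \<in> ball (fst i) (snd i) \<and> snd i < d" if x: "x \<in> S" and d: "0 < d" for x d
    proof -
      have "x \<in> U" using x U(1) by (auto simp: S_def)
      then obtain r0 where r0: "r0 > 0" "ball x r0 \<subseteq> U" using U(2) openE by blast
      have "\<exists>r. 0 < r \<and> r < min d r0 \<and> \<not> ((\<integral>\<^sup>+y\<in>ball x r. h y \<partial>lborel) \<le> ennreal c * emeasure lborel (ball x r))"
      proof (rule ccontr)
        assume "\<not> ?thesis"
        then have "\<forall>y>0. y < min d r0 \<longrightarrow> (\<integral>\<^sup>+z\<in>ball x y. h z \<partial>lborel) \<le> ennreal c * emeasure lborel (ball x y)"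
          by auto
        then have "\<forall>\<^sub>F r in at_right 0. (\<integral>\<^sup>+y\<in>ball x r. h y \<partial>lborel) \<le> ennreal c * emeasure lborel (ball x r)"
          using d r0 by (intro eventually_at_rightI[of 0 "min d r0"]) auto
        then show False using x by (auto simp: S_def)
      qed
      then obtain r where r: "0 < r" "r < d" "r < r0" "ennreal c * emeasure lborel (ball x r) < emeasure \<nu> (ball x r)"
        by (auto simp: \<nu> not_le)
      have "ball x r \<subseteq> U" using r r0 by (meson less_imp_le order_trans subset_ball)
      then show ?thesis using r by (intro exI[of _ "(x, r)"]) (auto simp: K_def)
    qed
    obtain C where C: "countable C" "C \<subseteq> K"
      "pairwise (\<lambda>i j. disjnt (ball (fst i) (snd i)) (ball (fst j) (snd j))) C"
      "negligible (S - (\<Union>i\<in>C. ball (fst i) (snd i)))"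
      by (rule Vitali_covering_theorem_balls[of S K fst snd]) (use cover in blast)+
    define W where "W = (\<Union>i\<in>C. ball (fst i) (snd i))"
    have disj: "disjoint_family_on (\<lambda>i. ball (fst i) (snd i)) C"
      using C(3) by (auto simp: disjoint_family_on_def pairwise_def disjnt_def)
    have "ennreal c * emeasure lborel W = ennreal c * (\<integral>\<^sup>+i. emeasure lborel (ball (fst i) (snd i)) \<partial>count_space C)"
      unfolding W_def using C(1) disj by (subst emeasure_UN_countable) auto
    also have "\<dots> = (\<integral>\<^sup>+i. ennreal c * emeasure lborel (ball (fst i) (snd i)) \<partial>count_space C)"
      by (simp add: nn_integral_cmult)
    also have "\<dots> \<le> (\<integral>\<^sup>+i. emeasure \<nu> (ball (fst i) (snd i)) \<partial>count_space C)"
      using C(2) by (intro nn_integral_mono) (auto simp: K_def less_imp_le)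
    also have "\<dots> = emeasure \<nu> W"
      unfolding W_def using C(1) disj by (subst emeasure_UN_countable) (auto simp: sets\<nu>)
    also have "\<dots> \<le> emeasure \<nu> U"
    proof (rule emeasure_mono)
      have "ball (fst i) (snd i) \<subseteq> U" if "i \<in> C" for i
        using C(2) that by (cases i) (auto simp: K_def)
      then show "W \<subseteq> U" by (auto simp: W_def)
      show "U \<in> sets \<nu>" using U(2) by (simp add: sets\<nu>)
    qed
    also have "\<dots> \<le> ennreal c * ennreal e" using U(3) c e by (simp add: ennreal_mult)
    finally have mW: "emeasure lborel W \<le> ennreal e"
      using c by (simp add: ennreal_mult_le_mult_iff)
    have Wb: "W \<in> sets borel" by (simp add: W_def open_UN)
    let ?N = "S - W"
    have N: "negligible ?N" using C(4) by (simp add: W_def)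
    have Wl: "W \<in> lmeasurable" using mW Wb by (intro fmeasurableI) (auto intro: le_less_trans)
    have "measure lebesgue W \<le> e"
      using mW Wb e by (simp add: measure_def enn2real_leI)
    moreover have "measure lebesgue (W \<union> ?N) = measure lebesgue W"
    proof -
      have "?N \<in> null_sets lebesgue" "W \<in> sets lebesgue"
        using N Wb by (auto simp: negligible_iff_null_sets)
      then show ?thesis unfolding measure_def by (subst emeasure_Un_null_set) auto
    qed
    moreover have "W \<union> ?N \<in> lmeasurable"
      using Wl N by (metis N Wl fmeasurable.Un negligible_imp_measurable)
    ultimately show "\<exists>T. S \<subseteq> T \<and> T \<in> lmeasurable \<and> measure lebesgue T \<le> e"
      by (intro exI[of _ "W \<union> ?N"]) auto
  qed
  then have "AE x in lebesgue. x \<notin> S"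
    by (simp add: negligible_iff_null_sets AE_not_in)
  then have "AE x in lborel. x \<notin> S" by (simp add: AE_completion_iff)
  then show ?thesis by eventually_elim (auto simp: S_def)
qed

text \<open>
  Near a point \<open>x\<close> with \<open>f x\<close> close to \<open>q\<close>, the mean of \<open>|f - q|\<close> is small apart from the contribution of the
  set where \<open>f\<close> is far from \<open>q\<close>, and that set has density \<open>0\<close> at almost every such \<open>x\<close> in the sense of the
  preceding lemma. Countably many \<open>q\<close>, tolerances and radii suffice.
\<close>

theorem AE_lebesgue_point:
  fixes f :: "'a::euclidean_space \<Rightarrow> 'b::{banach, second_countable_topology}"
  assumes f [measurable]: "f \<in> borel_measurable borel"
    and loc: "\<And>r. (\<integral>\<^sup>+y\<in>ball 0 r. ennreal (norm (f y)) \<partial>lborel) < \<infinity>"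
  shows "AE x in lborel. \<forall>\<epsilon>>0. \<forall>\<^sub>F r in at_right 0.
    (\<integral>\<^sup>+y\<in>ball x r. ennreal (norm (f y - f x)) \<partial>lborel) \<le> ennreal \<epsilon> * emeasure lborel (ball x r)"
proof -
  obtain D :: "'b set" where D: "countable D" "\<And>X. open X \<Longrightarrow> X \<noteq> {} \<Longrightarrow> \<exists>d\<in>D. d \<in> X"
    using countable_dense_setE by blast
  define T where "T q e N = ball 0 (real N) \<inter> {x. norm (f x - q) < 1 / real (Suc e)}" for q and e N :: nat
  define h where "h q e N y = ennreal (norm (f y - q)) * indicator (ball 0 (real N) - T q e N) y" for q e N y
  have T [measurable]: "T q e N \<in> sets borel" for q e N unfolding T_def by measurable
  have h [measurable]: "h q e N \<in> borel_measurable borel" for q e N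
    unfolding h_def using T[of q e N] by (intro borel_measurable_times_ennreal borel_measurable_indicator) auto
  have hfin: "(\<integral>\<^sup>+y. h q e N y \<partial>lborel) < \<infinity>" for q e N
  proof -
    have "(\<integral>\<^sup>+y. h q e N y \<partial>lborel) \<le> (\<integral>\<^sup>+y\<in>ball 0 (real N). (ennreal (norm (f y)) + ennreal (norm q)) \<partial>lborel)"
      by (intro nn_integral_mono) (auto simp: h_def norm_triangle_ineq4 simp flip: ennreal_plus split: split_indicator)
    also have "\<dots> = (\<integral>\<^sup>+y\<in>ball 0 (real N). ennreal (norm (f y)) \<partial>lborel) + (\<integral>\<^sup>+y\<in>ball (0::'a) (real N). ennreal (norm q) \<partial>lborel)"
      unfolding distrib_right by (subst nn_integral_add) (auto intro!: borel_measurable_times_ennreal borel_measurable_indicator)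
    also have "\<dots> < \<infinity>"
      using loc[of "real N"] emeasure_lborel_ball_finite[of "0::'a" "real N"]
      by (simp add: nn_integral_cmult_indicator ennreal_mult_less_top)
    finally show ?thesis .
  qed
  have "AE x in lborel. \<forall>q\<in>D. \<forall>e N. x \<in> T q e N \<longrightarrow> (\<forall>\<^sub>F r in at_right 0.
      (\<integral>\<^sup>+y\<in>ball x r. h q e N y \<partial>lborel) \<le> ennreal (1 / real (Suc e)) * emeasure lborel (ball x r))"
    unfolding AE_ball_countable[OF D(1)] AE_all_countable
    by (intro ballI allI AE_density_zero_off_support hfin T h) (auto simp: h_def)
  then show ?thesis
  proof eventually_elim
    fix x assume *: "\<forall>q\<in>D. \<forall>e N. x \<in> T q e N \<longrightarrow> (\<forall>\<^sub>F r in at_right 0.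
      (\<integral>\<^sup>+y\<in>ball x r. h q e N y \<partial>lborel) \<le> ennreal (1 / real (Suc e)) * emeasure lborel (ball x r))"
    show "\<forall>\<epsilon>>0. \<forall>\<^sub>F r in at_right 0.
      (\<integral>\<^sup>+y\<in>ball x r. ennreal (norm (f y - f x)) \<partial>lborel) \<le> ennreal \<epsilon> * emeasure lborel (ball x r)"
    proof (intro allI impI)
      fix \<epsilon> :: real assume \<epsilon>: "\<epsilon> > 0"
      obtain e :: nat where e: "1 / real (Suc e) < \<epsilon> / 3"
        using \<epsilon> by (meson nat_approx_posE zero_less_divide_iff zero_less_numeral)
      let ?e = "1 / real (Suc e)"
      obtain q where q: "q \<in> D" "norm (f x - q) < ?e"
        using D(2)[of "ball (f x) ?e"] by (auto simp: dist_norm)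
      obtain N :: nat where N: "norm x + 1 < real N" using reals_Archimedean2 by blast
      have xT: "x \<in> T q e N" using q N by (auto simp: T_def)
      have ev1: "\<forall>\<^sub>F r in at_right 0. r < (1::real)" 
        unfolding eventually_at_right_field by (intro exI[of _ 1]) auto
      show "\<forall>\<^sub>F r in at_right 0. (\<integral>\<^sup>+y\<in>ball x r. ennreal (norm (f y - f x)) \<partial>lborel) \<le> ennreal \<epsilon> * emeasure lborel (ball x r)"
        using ev1 *[rule_format, OF q(1) xT]
      proof eventually_elim
        fix r assume r: "r < 1" and I: "(\<integral>\<^sup>+y\<in>ball x r. h q e N y \<partial>lborel) \<le> ennreal ?e * emeasure lborel (ball x r)"
        have pt: "ennreal (norm (f y - f x)) * indicator (ball x r) y \<le>
            h q e N y * indicator (ball x r) y + ennreal (2 * ?e) * indicator (ball x r) y" for y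
        proof (cases "y \<in> ball x r")
          case True
          have "norm y \<le> norm x + norm (y - x)" by (metis add.commute diff_add_cancel norm_triangle_ineq)
          then have yN: "y \<in> ball 0 (real N)" using True r N by (simp add: dist_norm norm_minus_commute)
          have tri: "norm (f y - f x) \<le> norm (f y - q) + ?e"
            using norm_triangle_ineq4[of "f y - q" "f x - q"] q(2) by simp
          show ?thesis
          proof (cases "norm (f y - q) < ?e")
            case True
            then have "norm (f y - f x) \<le> 2 * ?e" using tri by simp
            then have "ennreal (norm (f y - f x)) \<le> ennreal (2 * ?e)" by (intro ennreal_leI)
            then show ?thesis using \<open>y \<in> ball x r\<close> by (simp add: add_increasing)
          next
            case False
            then have "h q e N y = ennreal (norm (f y - q))" using yN by (simp add: h_def T_def)
            moreover have "ennreal (norm (f y - f x)) \<le> ennreal (norm (f y - q) + 2 * ?e)"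
              using tri by (intro ennreal_leI) (simp add: field_simps)
            ultimately show ?thesis using \<open>y \<in> ball x r\<close> by (simp add: ennreal_plus)
          qed
        qed simp
        have "(\<integral>\<^sup>+y\<in>ball x r. ennreal (norm (f y - f x)) \<partial>lborel)
          \<le> (\<integral>\<^sup>+y. h q e N y * indicator (ball x r) y + ennreal (2 * ?e) * indicator (ball x r) y \<partial>lborel)"
          by (intro nn_integral_mono pt)
        also have "\<dots> = (\<integral>\<^sup>+y\<in>ball x r. h q e N y \<partial>lborel) + ennreal (2 * ?e) * emeasure lborel (ball x r)"
          by (subst nn_integral_add) (auto simp: nn_integral_cmult_indicator intro!: borel_measurable_times_ennreal borel_measurable_indicator)
        also have "\<dots> \<le> ennreal ?e * emeasure lborel (ball x r) + ennreal (2 * ?e) * emeasure lborel (ball x r)"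
          using I by (intro add_mono) auto
        also have "\<dots> = ennreal (3 * ?e) * emeasure lborel (ball x r)"
          by (simp flip: distrib_right ennreal_plus)
        also have "\<dots> \<le> ennreal \<epsilon> * emeasure lborel (ball x r)"
          using e by (intro mult_right_mono ennreal_leI) auto
        finally show "(\<integral>\<^sup>+y\<in>ball x r. ennreal (norm (f y - f x)) \<partial>lborel) \<le> ennreal \<epsilon> * emeasure lborel (ball x r)" .
      qed
    qed
  qed
qed

section \<open>The heat semigroup at small times\<close>

text \<open>
  A Gaussian is a superposition of indicator functions of balls, because \<open>exp (- q)\<close> is the integral of
  \<open>exp (- w)\<close> over \<open>w > q\<close>. Gaussian averages are thereby reduced to averages over balls.
\<close>

lemma nn_integral_exp_layer:
  fixes g :: "'a::euclidean_space \<Rightarrow> ennreal" and x :: 'a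
  assumes [measurable]: "g \<in> borel_measurable borel" and s: "s > 0"
  shows "(\<integral>\<^sup>+y. ennreal (exp (- ((norm (x - y))\<^sup>2 / s))) * g y \<partial>lborel)
    = (\<integral>\<^sup>+w. ennreal (exp (- w)) * indicator {0<..} w * (\<integral>\<^sup>+y\<in>ball x (sqrt (s * w)). g y \<partial>lborel) \<partial>lborel)"
proof -
  have tail: "ennreal (exp (- q)) = (\<integral>\<^sup>+w. ennreal (exp (- w)) * indicator {q<..} w \<partial>lborel)" for q :: real
  proof -
    have "(\<integral>\<^sup>+w. ennreal (exp (- w)) * indicator {q..} w \<partial>lborel) = ennreal (0 - (- exp (- q)))"
    proof (rule nn_integral_FTC_atLeast)
      show "((\<lambda>w::real. - exp (- w)) \<longlongrightarrow> 0) at_top" by real_asymp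
    qed (auto intro!: derivative_eq_intros)
    moreover have "(\<integral>\<^sup>+w. ennreal (exp (- w)) * indicator {q<..} w \<partial>lborel) = (\<integral>\<^sup>+w. ennreal (exp (- w)) * indicator {q..} w \<partial>lborel)"
      using AE_lborel_singleton[of q] by (intro nn_integral_cong_AE) (auto elim!: eventually_mono split: split_indicator)
    ultimately show ?thesis by simp
  qed
  have ind: "indicator {(norm (x - y))\<^sup>2 / s<..} w = (indicator {0<..} w * indicator (ball x (sqrt (s * w))) y :: ennreal)" for y w
  proof (cases "w > 0")
    case True
    have "(norm (x - y))\<^sup>2 / s < w \<longleftrightarrow> (norm (x - y))\<^sup>2 < s * w" using s by (simp add: divide_less_eq mult.commute)
    also have "\<dots> \<longleftrightarrow> norm (x - y) < sqrt (s * w)"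
      using s True by (metis abs_norm_cancel real_sqrt_abs real_sqrt_less_iff)
    finally show ?thesis using True by (simp add: indicator_def dist_norm)
  next
    case False
    have "0 \<le> (norm (x - y))\<^sup>2 / s" using s by simp
    then show ?thesis using False by (simp add: indicator_def)
  qed
  have "(\<integral>\<^sup>+y. ennreal (exp (- ((norm (x - y))\<^sup>2 / s))) * g y \<partial>lborel)
    = (\<integral>\<^sup>+y. (\<integral>\<^sup>+w. ennreal (exp (- w)) * indicator {0<..} w * (g y * indicator (ball x (sqrt (s * w))) y) \<partial>lborel) \<partial>lborel)"
  proof (rule nn_integral_cong)
    fix y
    have "ennreal (exp (- ((norm (x - y))\<^sup>2 / s))) * g y = (\<integral>\<^sup>+w. ennreal (exp (- w)) * indicator {(norm (x - y))\<^sup>2 / s<..} w * g y \<partial>lborel)"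
      unfolding tail[of "(norm (x - y))\<^sup>2 / s"] by (rule nn_integral_multc[symmetric]) measurable
    then show "ennreal (exp (- ((norm (x - y))\<^sup>2 / s))) * g y = (\<integral>\<^sup>+w. ennreal (exp (- w)) * indicator {0<..} w * (g y * indicator (ball x (sqrt (s * w))) y) \<partial>lborel)"
      unfolding ind by (simp only: mult_ac)
  qed
  also have "\<dots> = (\<integral>\<^sup>+w. (\<integral>\<^sup>+y. ennreal (exp (- w)) * indicator {0<..} w * (g y * indicator (ball x (sqrt (s * w))) y) \<partial>lborel) \<partial>lborel)"
  proof (rule lborel_pair.Fubini')
    have "(\<lambda>(w, y). indicator (ball x (sqrt (s * w))) y :: ennreal) = (\<lambda>(w, y). indicator {p. dist x (snd p) < sqrt (s * fst p)} (w, y))"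
      by (auto simp: fun_eq_iff indicator_def)
    moreover have "(\<lambda>(w, y). indicator {p. dist x (snd p) < sqrt (s * fst p)} (w, y) :: ennreal) \<in> borel_measurable (lborel \<Otimes>\<^sub>M lborel)"
    proof -
      have "{p :: real \<times> 'a. dist x (snd p) < sqrt (s * fst p)} \<in> sets borel"
        by (intro borel_open open_Collect_less continuous_intros)
      then have "{p :: real \<times> 'a. dist x (snd p) < sqrt (s * fst p)} \<in> sets (lborel \<Otimes>\<^sub>M lborel)"
        by (simp only: sets_pair_measure_cong[OF sets_lborel sets_lborel] borel_prod)
      then show ?thesis by (simp add: case_prod_beta)
    qed
    ultimately have [measurable]: "(\<lambda>(w, y). indicator (ball x (sqrt (s * w))) y :: ennreal) \<in> borel_measurable (lborel \<Otimes>\<^sub>M lborel)"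
      by simp
    show "(\<lambda>(w, y). ennreal (exp (- w)) * indicator {0<..} w * (g y * indicator (ball x (sqrt (s * w))) y)) \<in> borel_measurable (lborel \<Otimes>\<^sub>M lborel)"
      by measurable
  qed
  also have "\<dots> = (\<integral>\<^sup>+w. ennreal (exp (- w)) * indicator {0<..} w * (\<integral>\<^sup>+y\<in>ball x (sqrt (s * w)). g y \<partial>lborel) \<partial>lborel)"
    by (intro nn_integral_cong nn_integral_cmult) (auto intro!: borel_measurable_times_ennreal borel_measurable_indicator)
  finally show ?thesis .
qed

lemma nn_integral_powr_exp:
  fixes p :: real
  assumes "p > -1"
  shows "(\<integral>\<^sup>+w. ennreal (exp (- w)) * indicator {0<..} w * ennreal (w powr p) \<partial>lborel) = ennreal (Gamma (p + 1))"
proof -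
  have "(\<integral>\<^sup>+w. ennreal (exp (- w)) * indicator {0<..} w * ennreal (w powr p) \<partial>lborel)
    = (\<integral>\<^sup>+w. ennreal (indicator {0..} w * w powr (p + 1 - 1) / exp w) \<partial>lborel)"
    by (intro nn_integral_cong) (auto split: split_indicator simp: exp_minus divide_inverse mult.commute simp flip: ennreal_mult)
  also have "\<dots> = ennreal (Gamma (p + 1))" using assms by (intro Gamma_conv_nn_integral_real[symmetric]) simp
  finally show ?thesis .
qed

text \<open>
  The mass of \<open>g\<close> in a ball of radius \<open>r\<close> is at most a small multiple of \<open>r powr d\<close> for small \<open>r\<close> and bounded for
  all \<open>r\<close>, hence at most a small multiple of \<open>r powr d\<close> plus a multiple of \<open>r powr (d + 1)\<close> for all \<open>r\<close>. In the
  layer formula the first term contributes a small constant and the second one a multiple of \<open>sqrt u\<close>.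
\<close>

lemma gaussian_average_tendsto_0:
  fixes g :: "'a::euclidean_space \<Rightarrow> ennreal" and x :: 'a
  assumes g [measurable]: "g \<in> borel_measurable borel" and fin: "(\<integral>\<^sup>+y. g y \<partial>lborel) < \<infinity>" and A: "A > 0"
    and dens: "\<And>\<epsilon>. \<epsilon> > 0 \<Longrightarrow> \<forall>\<^sub>F r in at_right 0. (\<integral>\<^sup>+y\<in>ball x r. g y \<partial>lborel) \<le> ennreal \<epsilon> * emeasure lborel (ball x r)"
    and e: "(e::real) > 0"
  shows "\<forall>\<^sub>F u in at_right 0. ennreal (u powr (- (DIM('a) / 2))) *
    (\<integral>\<^sup>+y. ennreal (exp (- ((norm (x - y))\<^sup>2 / (A * u)))) * g y \<partial>lborel) \<le> ennreal e"
proof -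
  define d where "d = real DIM('a)"
  have d: "d > 0" by (simp add: d_def)
  define G where "G r = (\<integral>\<^sup>+y\<in>ball x r. g y \<partial>lborel)" for r
  define Gi where "Gi = enn2real (\<integral>\<^sup>+y. g y \<partial>lborel)"
  have Gi: "(\<integral>\<^sup>+y. g y \<partial>lborel) = ennreal Gi" "Gi \<ge> 0" using fin by (auto simp: Gi_def)
  define \<epsilon> where "\<epsilon> = e / 2 / (A powr (d/2) * Gamma (d/2 + 1) * unit_ball_vol d)"
  have gp: "Gamma (d/2 + 1) > 0" "Gamma ((d + 1)/2 + 1) > 0" "unit_ball_vol d > 0" using d by (auto intro!: Gamma_real_pos add_pos_pos)
  have \<epsilon>: "\<epsilon> > 0" using e A gp by (simp add: \<epsilon>_def)
  obtain \<delta> where \<delta>: "\<delta> > 0" "\<And>r. 0 < r \<Longrightarrow> r < \<delta> \<Longrightarrow> G r \<le> ennreal \<epsilon> * emeasure lborel (ball x r)"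
    using dens[OF \<epsilon>] unfolding eventually_at_right_field G_def by auto
  define M where "M = Gi / \<delta> powr (d + 1)"
  have M: "M \<ge> 0" using Gi \<delta> by (simp add: M_def)
  have Gb: "G r \<le> ennreal (\<epsilon> * unit_ball_vol d * r powr d + M * r powr (d + 1))" if r: "r > 0" for r
  proof (cases "r < \<delta>")
    case True
    have "G r \<le> ennreal \<epsilon> * ennreal (unit_ball_vol d * r ^ DIM('a))"
      using \<delta>(2)[OF r True] emeasure_ball[of r x] r by (simp add: d_def)
    also have "\<dots> = ennreal (\<epsilon> * unit_ball_vol d * r powr d)"
      using \<epsilon> gp r by (subst ennreal_mult[symmetric]) (auto simp: d_def powr_realpow mult.assoc)
    also have "\<dots> \<le> ennreal (\<epsilon> * unit_ball_vol d * r powr d + M * r powr (d + 1))" using M by (intro ennreal_leI) simp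
    finally show ?thesis .
  next
    case False
    have "G r \<le> ennreal Gi" unfolding G_def Gi(1)[symmetric] by (intro nn_integral_mono) (auto split: split_indicator)
    also have "\<dots> \<le> ennreal (\<epsilon> * unit_ball_vol d * r powr d + M * r powr (d + 1))"
    proof (rule ennreal_leI)
      have "\<delta> powr (d + 1) \<le> r powr (d + 1)" using False \<delta> d by (intro powr_mono2) auto
      then have "M * \<delta> powr (d + 1) \<le> M * r powr (d + 1)" using M by (rule mult_left_mono)
      moreover have "M * \<delta> powr (d + 1) = Gi" using \<delta> by (simp add: M_def)
      moreover have "0 \<le> \<epsilon> * unit_ball_vol d * r powr d" using \<epsilon> gp by simp
      ultimately show "Gi \<le> \<epsilon> * unit_ball_vol d * r powr d + M * r powr (d + 1)" by linarith
    qed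
    finally show ?thesis .
  qed
  define B where "B = M * A powr ((d + 1)/2) * Gamma ((d + 1)/2 + 1)"
  have bound: "ennreal (u powr (- (DIM('a) / 2))) * (\<integral>\<^sup>+y. ennreal (exp (- ((norm (x - y))\<^sup>2 / (A * u)))) * g y \<partial>lborel) \<le> ennreal (e / 2 + B * u powr (1/2))"
    if u: "u > 0" for u
  proof -
    have Au: "A * u > 0" using A u by simp
    define a1 where "a1 = \<epsilon> * unit_ball_vol d * (A * u) powr (d/2)"
    define a2 where "a2 = M * (A * u) powr ((d + 1)/2)"
    have a: "a1 \<ge> 0" "a2 \<ge> 0" using \<epsilon> M gp by (auto simp: a1_def a2_def)
    have "(\<integral>\<^sup>+y. ennreal (exp (- ((norm (x - y))\<^sup>2 / (A * u)))) * g y \<partial>lborel)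
      = (\<integral>\<^sup>+w. ennreal (exp (- w)) * indicator {0<..} w * G (sqrt (A * u * w)) \<partial>lborel)"
      unfolding nn_integral_exp_layer[OF g Au] G_def ..
    also have "\<dots> \<le> (\<integral>\<^sup>+w. ennreal a1 * (ennreal (exp (- w)) * indicator {0<..} w * ennreal (w powr (d/2)))
       + ennreal a2 * (ennreal (exp (- w)) * indicator {0<..} w * ennreal (w powr ((d + 1)/2))) \<partial>lborel)"
    proof (rule nn_integral_mono)
      fix w :: real
      show "ennreal (exp (- w)) * indicator {0<..} w * G (sqrt (A * u * w)) \<le> ennreal a1 * (ennreal (exp (- w)) * indicator {0<..} w * ennreal (w powr (d/2)))
       + ennreal a2 * (ennreal (exp (- w)) * indicator {0<..} w * ennreal (w powr ((d + 1)/2)))"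
      proof (cases "w > 0")
        case True
        have sq: "sqrt (A * u * w) powr p = (A * u) powr (p / 2) * w powr (p / 2)" for p
          using Au True by (simp add: powr_half_sqrt[symmetric] powr_powr powr_mult)
        have "G (sqrt (A * u * w)) \<le> ennreal (a1 * w powr (d/2) + a2 * w powr ((d + 1)/2))"
        proof -
          have pos: "sqrt (A * u * w) > 0" using Au True by simp
          show ?thesis using Gb[OF pos] unfolding sq a1_def a2_def by (simp only: mult.assoc)
        qed
        also have "\<dots> = ennreal a1 * ennreal (w powr (d/2)) + ennreal a2 * ennreal (w powr ((d + 1)/2))"
          using a by (subst ennreal_plus) (auto simp: ennreal_mult)
        finally have "ennreal (exp (- w)) * G (sqrt (A * u * w)) \<le> ennreal (exp (- w)) * (ennreal a1 * ennreal (w powr (d/2)) + ennreal a2 * ennreal (w powr ((d + 1)/2)))"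
          by (rule mult_left_mono) simp
        then show ?thesis using True by (simp add: distrib_left mult_ac)
      qed simp
    qed
    also have "\<dots> = ennreal a1 * ennreal (Gamma (d/2 + 1)) + ennreal a2 * ennreal (Gamma ((d + 1)/2 + 1))"
      using d by (subst nn_integral_add) (auto simp: nn_integral_cmult nn_integral_powr_exp)
    also have "\<dots> = ennreal (a1 * Gamma (d/2 + 1) + a2 * Gamma ((d + 1)/2 + 1))"
      using a gp by (simp add: ennreal_mult[symmetric] ennreal_plus[symmetric] del: ennreal_plus)
    finally have "ennreal (u powr (- (DIM('a) / 2))) * (\<integral>\<^sup>+y. ennreal (exp (- ((norm (x - y))\<^sup>2 / (A * u)))) * g y \<partial>lborel)
      \<le> ennreal (u powr (- (d / 2))) * ennreal (a1 * Gamma (d/2 + 1) + a2 * Gamma ((d + 1)/2 + 1))"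
      unfolding d_def by (rule mult_left_mono) simp
    also have "\<dots> = ennreal (u powr (- (d / 2)) * (a1 * Gamma (d/2 + 1) + a2 * Gamma ((d + 1)/2 + 1)))"
      using a gp by (intro ennreal_mult[symmetric]) auto
    also have "u powr (- (d / 2)) * (a1 * Gamma (d/2 + 1) + a2 * Gamma ((d + 1)/2 + 1)) = e / 2 + B * u powr (1/2)"
    proof -
      have u1: "u powr (- (d / 2)) * u powr (d / 2) = 1" using u by (simp flip: powr_add)
      have u2: "u powr (- (d / 2)) * u powr ((d + 1) / 2) = u powr (1/2)" using u by (simp add: add_divide_distrib flip: powr_add)
      have "u powr (- (d / 2)) * (a1 * Gamma (d/2 + 1)) = (u powr (- (d / 2)) * u powr (d / 2)) * (\<epsilon> * (A powr (d/2) * Gamma (d/2 + 1) * unit_ball_vol d))"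
        using A u unfolding a1_def powr_mult by (simp only: mult_ac)
      also have "\<dots> = e / 2" unfolding u1 \<epsilon>_def using A gp by simp
      finally have 1: "u powr (- (d / 2)) * (a1 * Gamma (d/2 + 1)) = e / 2" .
      have "u powr (- (d / 2)) * (a2 * Gamma ((d + 1)/2 + 1)) = (u powr (- (d / 2)) * u powr ((d + 1) / 2)) * B"
        using A u unfolding a2_def B_def powr_mult by (simp only: mult_ac)
      then have 2: "u powr (- (d / 2)) * (a2 * Gamma ((d + 1)/2 + 1)) = B * u powr (1/2)" unfolding u2 by (simp only: mult.commute)
      show ?thesis unfolding distrib_left 1 2 ..
    qed
    finally show ?thesis .
  qed
  have "((\<lambda>u. u powr (1/2)) \<longlongrightarrow> 0) (at_right (0::real))" by real_asymp
  then have "((\<lambda>u. B * u powr (1/2)) \<longlongrightarrow> 0) (at_right 0)" by (rule tendsto_mult_right_zero)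
  then have "\<forall>\<^sub>F u in at_right 0. B * u powr (1/2) < e / 2" using e by (intro order_tendstoD) auto
  moreover have "\<forall>\<^sub>F u in at_right 0. u > (0::real)" by (simp add: eventually_at_right_less)
  ultimately show ?thesis
  proof eventually_elim
    fix u :: real assume "B * u powr (1/2) < e / 2" "u > 0"
    then have "ennreal (e / 2 + B * u powr (1/2)) \<le> ennreal e" by (intro ennreal_leI) simp
    with bound[OF \<open>u > 0\<close>] show "ennreal (u powr (- (DIM('a) / 2))) * (\<integral>\<^sup>+y. ennreal (exp (- ((norm (x - y))\<^sup>2 / (A * u)))) * g y \<partial>lborel) \<le> ennreal e"
      by (rule order_trans)
  qed
qed

lemma nn_integral_gaussian:
  fixes v :: "'a::euclidean_space"
  assumes c: "c > 0"
  shows "(\<integral>\<^sup>+y. ennreal (exp (- (c / 2 * (norm (y - v))\<^sup>2))) \<partial>lborel) = ennreal ((2 * pi / c) powr (DIM('a) / 2))"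
proof -
  have one: "(\<integral>\<^sup>+s. ennreal (exp (- (c / 2 * (s - \<mu>)\<^sup>2))) \<partial>lborel) = ennreal (sqrt (2 * pi / c))" for \<mu> :: real
  proof -
    define \<sigma> where "\<sigma> = 1 / sqrt c"
    have \<sigma>: "\<sigma> > 0" "\<sigma>\<^sup>2 = 1 / c" using c by (auto simp: \<sigma>_def power_divide)
    have "exp (- (c / 2 * (s - \<mu>)\<^sup>2)) = sqrt (2 * pi / c) * normal_density \<mu> \<sigma> s" for s
      using c by (simp add: normal_density_def \<sigma>)
    then have "(\<integral>\<^sup>+s. ennreal (exp (- (c / 2 * (s - \<mu>)\<^sup>2))) \<partial>lborel) = (\<integral>\<^sup>+s. ennreal (sqrt (2 * pi / c)) * ennreal (normal_density \<mu> \<sigma> s) \<partial>lborel)"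
      using c by (simp add: ennreal_mult normal_density_nonneg)
    also have "\<dots> = ennreal (sqrt (2 * pi / c)) * (\<integral>\<^sup>+s. ennreal (normal_density \<mu> \<sigma> s) \<partial>lborel)"
      by (rule nn_integral_cmult) measurable
    also have "(\<integral>\<^sup>+s. ennreal (normal_density \<mu> \<sigma> s) \<partial>lborel) = ennreal 1"
      using \<sigma>(1) by (subst nn_integral_eq_integral) (auto simp: normal_density_nonneg)
    finally show ?thesis by simp
  qed
  have eq: "ennreal (exp (- (c / 2 * (norm (y - v))\<^sup>2))) = (\<Prod>b\<in>Basis. ennreal (exp (- (c / 2 * (y \<bullet> b - v \<bullet> b)\<^sup>2))))" for y
  proof -
    have nrm: "(norm (y - v))\<^sup>2 = (\<Sum>b\<in>Basis. (y \<bullet> b - v \<bullet> b)\<^sup>2)"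
      unfolding power2_norm_eq_inner by (subst euclidean_inner) (simp only: inner_diff_left power2_eq_square)
    have "- (c / 2 * (norm (y - v))\<^sup>2) = (\<Sum>b\<in>Basis. - (c / 2 * (y \<bullet> b - v \<bullet> b)\<^sup>2))"
      unfolding nrm sum_distrib_left sum_negf ..
    then have "exp (- (c / 2 * (norm (y - v))\<^sup>2)) = (\<Prod>b\<in>Basis. exp (- (c / 2 * (y \<bullet> b - v \<bullet> b)\<^sup>2)))"
      by (simp only: exp_sum[OF finite_Basis])
    then show ?thesis by (subst prod_ennreal) simp_all
  qed
  have "(\<integral>\<^sup>+y. ennreal (exp (- (c / 2 * (norm (y - v))\<^sup>2))) \<partial>lborel) = (\<Prod>b\<in>(Basis :: 'a set). (\<integral>\<^sup>+s. ennreal (exp (- (c / 2 * (s - v \<bullet> b)\<^sup>2))) \<partial>lborel))"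
    unfolding eq by (rule nn_integral_lborel_prod[where f = "\<lambda>b s. ennreal (exp (- (c / 2 * (s - v \<bullet> b)\<^sup>2)))"]) simp_all
  also have "\<dots> = ennreal (sqrt (2 * pi / c) ^ DIM('a))" unfolding one using c by (simp add: ennreal_power)
  also have "sqrt (2 * pi / c) ^ DIM('a) = (2 * pi / c) powr (DIM('a) / 2)"
    using c by (simp add: powr_half_sqrt[symmetric] powr_powr flip: powr_realpow)
  finally show ?thesis .
qed

text \<open>
  In \<open>y\<close> the kernel is a Gaussian centred at \<open>(csch (2u) / coth (2u)) x\<close>. Completing the square leaves
  \<open>-|x|\<^sup>2 / (2 coth (2u))\<close> in the exponent, since \<open>coth\<^sup>2 - csch\<^sup>2 = 1\<close>.
\<close>

lemma heat_kernel_mass: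
  fixes x :: "real ^ 'n::finite"
  assumes u: "u > 0"
  shows "(\<integral>\<^sup>+y. ennreal (heat_kernel m u x y) \<partial>lborel)
    = ennreal (exp (- (u * m)) * cosh (2 * u) powr (- (real CARD('n) / 2)) * exp (- (tanh (2 * u) / 2 * (norm x)\<^sup>2)))"
proof -
  have c: "coth2 u > 0" using coth2_ge_1[OF u] by linarith
  have s: "sinh (2 * u) > 0" using u by simp
  define v where "v = (csch2 u / coth2 u) *\<^sub>R x"
  have inv: "1 / coth2 u = tanh (2 * u)" by (simp add: coth2_def tanh_def)
  have expo: "csch2 u * (x \<bullet> y) - coth2 u / 2 * ((norm x)\<^sup>2 + (norm y)\<^sup>2) = - (tanh (2 * u) / 2 * (norm x)\<^sup>2) + - (coth2 u / 2 * (norm (y - v))\<^sup>2)" for y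
  proof -
    have n: "(norm (y - v))\<^sup>2 = (norm y)\<^sup>2 + (csch2 u / coth2 u)\<^sup>2 * (norm x)\<^sup>2 - 2 * ((csch2 u / coth2 u) * (x \<bullet> y))"
      unfolding norm_diff_square v_def norm_scaleR power_mult_distrib power2_abs inner_scaleR_right
      by (simp only: inner_commute)
    have e1: "coth2 u / 2 * ((csch2 u / coth2 u)\<^sup>2 * (norm x)\<^sup>2) = (csch2 u)\<^sup>2 / coth2 u / 2 * (norm x)\<^sup>2"
      and e2: "coth2 u / 2 * (2 * ((csch2 u / coth2 u) * (x \<bullet> y))) = csch2 u * (x \<bullet> y)"
      using c by (simp_all add: power2_eq_square)
    have "1 / coth2 u + (csch2 u)\<^sup>2 / coth2 u = (coth2 u)\<^sup>2 / coth2 u" unfolding coth2_square[OF u] by (simp add: add_divide_distrib)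
    also have "\<dots> = coth2 u" by (simp add: power2_eq_square)
    finally have "(1 / coth2 u + (csch2 u)\<^sup>2 / coth2 u) / 2 * (norm x)\<^sup>2 = coth2 u / 2 * (norm x)\<^sup>2" by simp
    then have "1 / coth2 u / 2 * (norm x)\<^sup>2 + (csch2 u)\<^sup>2 / coth2 u / 2 * (norm x)\<^sup>2 = coth2 u / 2 * (norm x)\<^sup>2"
      by (simp only: add_divide_distrib distrib_right)
    then show ?thesis unfolding n inv[symmetric] distrib_left right_diff_distrib e1 e2 by linarith
  qed
  define k where "k = exp (- (u * m)) * (2 * pi * sinh (2 * u)) powr (- (real CARD('n) / 2)) * exp (- (tanh (2 * u) / 2 * (norm x)\<^sup>2))"
  have "(\<integral>\<^sup>+y. ennreal (heat_kernel m u x y) \<partial>lborel) = (\<integral>\<^sup>+y. ennreal k * ennreal (exp (- (coth2 u / 2 * (norm (y - v))\<^sup>2))) \<partial>lborel)"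
    unfolding heat_kernel_eq[OF u] expo exp_add k_def
    by (intro nn_integral_cong) (subst ennreal_mult[symmetric], auto simp: mult.assoc)
  also have "\<dots> = ennreal k * ennreal ((2 * pi / coth2 u) powr (real CARD('n) / 2))"
  proof -
    have G: "(\<integral>\<^sup>+y. ennreal (exp (- (coth2 u / 2 * (norm (y - v))\<^sup>2))) \<partial>lborel) = ennreal ((2 * pi / coth2 u) powr (real CARD('n) / 2))"
      unfolding nn_integral_gaussian[OF c] by simp
    show ?thesis unfolding G[symmetric] by (rule nn_integral_cmult) simp
  qed
  also have "\<dots> = ennreal (k * (2 * pi / coth2 u) powr (real CARD('n) / 2))" by (rule ennreal_mult[symmetric]) (auto simp: k_def)
  also have "k * (2 * pi / coth2 u) powr (real CARD('n) / 2)
    = exp (- (u * m)) * cosh (2 * u) powr (- (real CARD('n) / 2)) * exp (- (tanh (2 * u) / 2 * (norm x)\<^sup>2))"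
  proof -
    have eq: "2 * pi / coth2 u = (2 * pi * sinh (2 * u)) / cosh (2 * u)" by (simp add: coth2_def)
    define S where "S = 2 * pi * sinh (2 * u)"
    have "S > 0" using s by (simp add: S_def)
    then have p: "S powr (- (real CARD('n) / 2)) * (S / cosh (2 * u)) powr (real CARD('n) / 2) = cosh (2 * u) powr (- (real CARD('n) / 2))"
      unfolding powr_minus_divide powr_divide by simp
    show ?thesis unfolding k_def eq S_def[symmetric] p[symmetric] by (simp only: mult_ac)
  qed
  finally show ?thesis .
qed

text \<open>
  Half of the exponent \<open>-csch (2u) |x - y|\<^sup>2 / 2\<close> is kept as a Gaussian of width \<open>sqrt u\<close> around \<open>x\<close>. The other
  half is at most \<open>-2 |x - y|\<^sup>2\<close> and provides the decay \<open>exp (- |y|\<^sup>2)\<close> that functions in \<open>L\<^sup>1(\<phi>)\<close> call for.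
\<close>

lemma heat_kernel_small_time:
  fixes x :: "real ^ 'n::finite"
  obtains C where "C > 0" "\<And>u y. 0 < u \<Longrightarrow> u \<le> 1/128 \<Longrightarrow>
    heat_kernel m u x y \<le> C * u powr (- (real CARD('n) / 2)) * exp (- ((norm (x - y))\<^sup>2 / (64 * u))) * exp (- (norm y)\<^sup>2)"
proof -
  define C where "C = exp \<bar>m\<bar> * exp (2 * (norm x)\<^sup>2)"
  have "heat_kernel m u x y \<le> C * u powr (- (real CARD('n) / 2)) * exp (- ((norm (x - y))\<^sup>2 / (64 * u))) * exp (- (norm y)\<^sup>2)"
    if u: "0 < u" "u \<le> 1/128" for u y
  proof -
    have s: "1 / (16 * u) \<le> csch2 u" using csch2_ge u by simp
    have "8 \<le> 1 / (16 * u)" using u by (simp add: field_simps)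
    then have s8: "8 \<le> csch2 u" using s by linarith
    have "csch2 u * (x \<bullet> y) - coth2 u / 2 * ((norm x)\<^sup>2 + (norm y)\<^sup>2) \<le> csch2 u * (x \<bullet> y) - csch2 u / 2 * ((norm x)\<^sup>2 + (norm y)\<^sup>2)"
      using csch2_le_coth2[OF u(1)] by (intro diff_left_mono mult_right_mono) auto
    also have "\<dots> = - (csch2 u / 4 * (norm (x - y))\<^sup>2) - (csch2 u / 4 * (norm (x - y))\<^sup>2)"
      unfolding norm_diff_square by (simp add: field_simps)
    also have "\<dots> \<le> - (1 / (16 * u) / 4 * (norm (x - y))\<^sup>2) - (8 / 4 * (norm (x - y))\<^sup>2)"
      using s s8 by (intro diff_mono le_imp_neg_le mult_right_mono divide_right_mono) auto
    also have "\<dots> \<le> - ((norm (x - y))\<^sup>2 / (64 * u)) + (2 * (norm x)\<^sup>2 - (norm y)\<^sup>2)"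
    proof -
      have "norm y \<le> norm x + norm (x - y)" using norm_triangle_ineq4[of x "x - y"] by simp
      then have "(norm y)\<^sup>2 \<le> (norm x + norm (x - y))\<^sup>2" by (intro power_mono) auto
      also have "(norm x + norm (x - y))\<^sup>2 \<le> 2 * (norm x)\<^sup>2 + 2 * (norm (x - y))\<^sup>2"
        using zero_le_power2[of "norm x - norm (x - y)"] by (simp add: power2_sum power2_diff)
      finally show ?thesis by simp
    qed
    finally have expo: "csch2 u * (x \<bullet> y) - coth2 u / 2 * ((norm x)\<^sup>2 + (norm y)\<^sup>2) \<le> - ((norm (x - y))\<^sup>2 / (64 * u)) + (2 * (norm x)\<^sup>2 - (norm y)\<^sup>2)" .
    have em: "exp (- (u * m)) \<le> exp \<bar>m\<bar>"
    proof -
      have "\<bar>u * m\<bar> \<le> 1 * \<bar>m\<bar>" unfolding abs_mult using u by (intro mult_right_mono) auto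
      then show ?thesis by simp
    qed
    have "u \<le> 2 * u" using u by simp
    also have "\<dots> \<le> sinh (2 * u)" using le_sinh[of "2 * u"] u by simp
    also have "\<dots> \<le> 2 * pi * sinh (2 * u)" using sinh_le_two_pi_sinh[OF u(1)] .
    finally have pw: "(2 * pi * sinh (2 * u)) powr (- (real CARD('n) / 2)) \<le> u powr (- (real CARD('n) / 2))"
      using u by (intro powr_mono2') auto
    have "heat_kernel m u x y \<le> exp \<bar>m\<bar> * u powr (- (real CARD('n) / 2)) * exp (- ((norm (x - y))\<^sup>2 / (64 * u)) + (2 * (norm x)\<^sup>2 - (norm y)\<^sup>2))"
      unfolding heat_kernel_eq[OF u(1)] using pw em expo by (intro mult_mono mult_nonneg_nonneg) auto
    also have "\<dots> = C * u powr (- (real CARD('n) / 2)) * exp (- ((norm (x - y))\<^sup>2 / (64 * u))) * exp (- (norm y)\<^sup>2)"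
    proof -
      have "exp (- ((norm (x - y))\<^sup>2 / (64 * u)) + (2 * (norm x)\<^sup>2 - (norm y)\<^sup>2))
        = exp (2 * (norm x)\<^sup>2) * exp (- ((norm (x - y))\<^sup>2 / (64 * u))) * exp (- (norm y)\<^sup>2)"
        by (simp flip: exp_add)
      then show ?thesis unfolding C_def by (simp only: mult_ac)
    qed
    finally show ?thesis .
  qed
  moreover have "C > 0" by (simp add: C_def)
  ultimately show ?thesis using that by blast
qed

text \<open>
  The total mass of the kernel tends to \<open>1\<close>, so \<open>f y\<close> may be replaced by \<open>f y - f x\<close>. The function
  \<open>|f y - f x| exp (- |y|\<^sup>2)\<close> is integrable and has vanishing averages at \<open>x\<close>, and its Gaussian averages
  dominate the difference.
\<close>

lemma heat_semigroup_tendsto: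
  fixes f :: "real ^ 'n::finite \<Rightarrow> complex"
  assumes f [measurable]: "f \<in> borel_measurable borel"
    and fin: "(\<integral>\<^sup>+y. ennreal (norm (f y) * exp (- (norm y)\<^sup>2)) \<partial>lborel) < \<infinity>"
    and leb: "\<And>\<epsilon>. \<epsilon> > 0 \<Longrightarrow> \<forall>\<^sub>F r in at_right 0. (\<integral>\<^sup>+y\<in>ball x r. ennreal (norm (f y - f x)) \<partial>lborel) \<le> ennreal \<epsilon> * emeasure lborel (ball x r)"
  shows "((\<lambda>u. \<integral>y. heat_kernel m u x y *\<^sub>R f y \<partial>lborel) \<longlongrightarrow> f x) (at_right 0)"
proof -
  obtain C where C: "C > 0" "\<And>u y. 0 < u \<Longrightarrow> u \<le> 1/128 \<Longrightarrow>
    heat_kernel m u x y \<le> C * u powr (- (real CARD('n) / 2)) * exp (- ((norm (x - y))\<^sup>2 / (64 * u))) * exp (- (norm y)\<^sup>2)"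
    by (rule heat_kernel_small_time[where m = m and x = x]) (rule that; assumption)
  define g where "g y = ennreal (norm (f y - f x) * exp (- (norm y)\<^sup>2))" for y
  have g [measurable]: "g \<in> borel_measurable borel" unfolding g_def by measurable
  define mass where "mass u = exp (- (u * m)) * cosh (2 * u) powr (- (real CARD('n) / 2)) * exp (- (tanh (2 * u) / 2 * (norm x)\<^sup>2))" for u
  have gauss1: "(\<integral>\<^sup>+y. ennreal (exp (- (norm (y :: real ^ 'n))\<^sup>2)) \<partial>lborel) < \<infinity>"
    using nn_integral_gaussian[of 2 "0 :: real ^ 'n"] by simp
  have gfin: "(\<integral>\<^sup>+y. g y \<partial>lborel) < \<infinity>"
  proof -
    have "(\<integral>\<^sup>+y. g y \<partial>lborel) \<le> (\<integral>\<^sup>+y. ennreal (norm (f y) * exp (- (norm y)\<^sup>2)) + ennreal (norm (f x)) * ennreal (exp (- (norm y)\<^sup>2)) \<partial>lborel)"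
    proof (rule nn_integral_mono)
      fix y
      have "norm (f y - f x) * exp (- (norm y)\<^sup>2) \<le> (norm (f y) + norm (f x)) * exp (- (norm y)\<^sup>2)"
        by (intro mult_right_mono norm_triangle_ineq4) simp
      then have "g y \<le> ennreal (norm (f y) * exp (- (norm y)\<^sup>2) + norm (f x) * exp (- (norm y)\<^sup>2))"
        unfolding g_def by (intro ennreal_leI) (simp add: distrib_right)
      then show "g y \<le> ennreal (norm (f y) * exp (- (norm y)\<^sup>2)) + ennreal (norm (f x)) * ennreal (exp (- (norm y)\<^sup>2))"
        by (simp add: ennreal_plus ennreal_mult)
    qed
    also have "\<dots> = (\<integral>\<^sup>+y. ennreal (norm (f y) * exp (- (norm y)\<^sup>2)) \<partial>lborel) + ennreal (norm (f x)) * (\<integral>\<^sup>+y. ennreal (exp (- (norm (y :: real ^ 'n))\<^sup>2)) \<partial>lborel)"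
      by (subst nn_integral_add) (auto simp: nn_integral_cmult)
    also have "\<dots> < \<infinity>" using fin gauss1 by (simp add: ennreal_mult_less_top)
    finally show ?thesis .
  qed
  have dens: "\<forall>\<^sub>F r in at_right 0. (\<integral>\<^sup>+y\<in>ball x r. g y \<partial>lborel) \<le> ennreal \<epsilon> * emeasure lborel (ball x r)" if "\<epsilon> > 0" for \<epsilon>
    using leb[OF that]
  proof eventually_elim
    fix r assume "(\<integral>\<^sup>+y\<in>ball x r. ennreal (norm (f y - f x)) \<partial>lborel) \<le> ennreal \<epsilon> * emeasure lborel (ball x r)"
    moreover have "(\<integral>\<^sup>+y\<in>ball x r. g y \<partial>lborel) \<le> (\<integral>\<^sup>+y\<in>ball x r. ennreal (norm (f y - f x)) \<partial>lborel)"
      unfolding g_def by (intro nn_integral_mono mult_right_mono ennreal_leI) (auto simp: mult_left_le)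
    ultimately show "(\<integral>\<^sup>+y\<in>ball x r. g y \<partial>lborel) \<le> ennreal \<epsilon> * emeasure lborel (ball x r)" by (rule order_trans[rotated])
  qed
  have small: "norm ((\<integral>y. heat_kernel m u x y *\<^sub>R f y \<partial>lborel) - mass u *\<^sub>R f x) \<le> C * e"
    if u: "0 < u" "u \<le> 1/128" and e: "e > 0" and av: "ennreal (u powr (- (DIM(real ^ 'n) / 2))) * (\<integral>\<^sup>+y. ennreal (exp (- ((norm (x - y))\<^sup>2 / (64 * u)))) * g y \<partial>lborel) \<le> ennreal e" for u e
  proof -
    have kint: "integrable lborel (heat_kernel m u x)" and kval: "(\<integral>y. heat_kernel m u x y \<partial>lborel) = mass u"
    proof -
      have "has_bochner_integral lborel (heat_kernel m u x) (mass u)"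
        using heat_kernel_mass[OF u(1), of m x] heat_kernel_nonneg[OF u(1)]
        by (intro has_bochner_integral_nn_integral) (auto simp: mass_def)
      then show "integrable lborel (heat_kernel m u x)" "(\<integral>y. heat_kernel m u x y \<partial>lborel) = mass u"
        by (auto simp: has_bochner_integral_iff)
    qed
    have le: "(\<integral>\<^sup>+y. ennreal (norm (heat_kernel m u x y *\<^sub>R (f y - f x))) \<partial>lborel) \<le> ennreal (C * e)"
    proof -
      have "(\<integral>\<^sup>+y. ennreal (norm (heat_kernel m u x y *\<^sub>R (f y - f x))) \<partial>lborel)
        \<le> (\<integral>\<^sup>+y. ennreal (C * u powr (- (real CARD('n) / 2))) * (ennreal (exp (- ((norm (x - y))\<^sup>2 / (64 * u)))) * g y) \<partial>lborel)"
      proof (rule nn_integral_mono)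
        fix y
        have "norm (heat_kernel m u x y *\<^sub>R (f y - f x)) \<le> (C * u powr (- (real CARD('n) / 2)) * exp (- ((norm (x - y))\<^sup>2 / (64 * u))) * exp (- (norm y)\<^sup>2)) * norm (f y - f x)"
          using C(2)[OF u, of y] heat_kernel_nonneg[OF u(1), of m x y] by (simp add: mult_right_mono)
        also have "\<dots> = (C * u powr (- (real CARD('n) / 2))) * (exp (- ((norm (x - y))\<^sup>2 / (64 * u))) * (norm (f y - f x) * exp (- (norm y)\<^sup>2)))"
          by (simp only: mult_ac)
        finally have "ennreal (norm (heat_kernel m u x y *\<^sub>R (f y - f x))) \<le> ennreal \<dots>" by (rule ennreal_leI)
        also have "\<dots> = ennreal (C * u powr (- (real CARD('n) / 2))) * (ennreal (exp (- ((norm (x - y))\<^sup>2 / (64 * u)))) * g y)"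
          unfolding g_def using C(1) by (subst ennreal_mult, simp, simp, subst ennreal_mult, auto)
        finally show "ennreal (norm (heat_kernel m u x y *\<^sub>R (f y - f x))) \<le> ennreal (C * u powr (- (real CARD('n) / 2))) * (ennreal (exp (- ((norm (x - y))\<^sup>2 / (64 * u)))) * g y)" .
      qed
      also have "\<dots> = ennreal C * (ennreal (u powr (- (DIM(real ^ 'n) / 2))) * (\<integral>\<^sup>+y. ennreal (exp (- ((norm (x - y))\<^sup>2 / (64 * u)))) * g y \<partial>lborel))"
        using C(1) by (subst nn_integral_cmult) (auto simp: ennreal_mult mult.assoc)
      also have "\<dots> \<le> ennreal C * ennreal e" by (rule mult_left_mono[OF av]) simp
      also have "\<dots> = ennreal (C * e)" using C(1) e by (intro ennreal_mult[symmetric]) auto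
      finally show ?thesis .
    qed
    have dint: "integrable lborel (\<lambda>y. heat_kernel m u x y *\<^sub>R (f y - f x))"
    proof (rule integrableI_bounded)
      show "(\<integral>\<^sup>+y. ennreal (norm (heat_kernel m u x y *\<^sub>R (f y - f x))) \<partial>lborel) < \<infinity>"
        using le by (rule le_less_trans) simp
    qed measurable
    have cint: "integrable lborel (\<lambda>y. heat_kernel m u x y *\<^sub>R f x)" using kint by (intro integrable_scaleR_left)
    have "(\<integral>y. heat_kernel m u x y *\<^sub>R f y \<partial>lborel) = (\<integral>y. heat_kernel m u x y *\<^sub>R (f y - f x) + heat_kernel m u x y *\<^sub>R f x \<partial>lborel)"
      by (simp add: scaleR_diff_right)
    also have "\<dots> = (\<integral>y. heat_kernel m u x y *\<^sub>R (f y - f x) \<partial>lborel) + (\<integral>y. heat_kernel m u x y *\<^sub>R f x \<partial>lborel)"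
      by (rule Bochner_Integration.integral_add[OF dint cint])
    also have "(\<integral>y. heat_kernel m u x y *\<^sub>R f x \<partial>lborel) = mass u *\<^sub>R f x"
      using kint kval by (subst integral_scaleR_left) auto
    finally have eq: "(\<integral>y. heat_kernel m u x y *\<^sub>R f y \<partial>lborel) - mass u *\<^sub>R f x = (\<integral>y. heat_kernel m u x y *\<^sub>R (f y - f x) \<partial>lborel)" by simp
    have "ennreal (norm (\<integral>y. heat_kernel m u x y *\<^sub>R (f y - f x) \<partial>lborel)) \<le> ennreal (C * e)"
      using integral_norm_bound_ennreal[OF dint] le by (rule order_trans)
    then show ?thesis unfolding eq using C(1) e by (subst (asm) ennreal_le_iff) auto
  qed
  have "((\<lambda>u. (\<integral>y. heat_kernel m u x y *\<^sub>R f y \<partial>lborel) - mass u *\<^sub>R f x) \<longlongrightarrow> 0) (at_right 0)"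
  proof (rule tendstoI)
    fix e :: real assume e: "e > 0"
    define e' where "e' = e / (2 * C)"
    have e': "e' > 0" "C * e' < e" using e C(1) by (auto simp: e'_def)
    have "\<forall>\<^sub>F u in at_right 0. ennreal (u powr (- (DIM(real ^ 'n) / 2))) * (\<integral>\<^sup>+y. ennreal (exp (- ((norm (x - y))\<^sup>2 / (64 * u)))) * g y \<partial>lborel) \<le> ennreal e'"
      by (rule gaussian_average_tendsto_0[OF g gfin _ dens e'(1)]) auto
    moreover have "\<forall>\<^sub>F u in at_right 0. u > (0::real)" by (simp add: eventually_at_right_less)
    moreover have "\<forall>\<^sub>F u in at_right 0. u \<le> (1/128::real)"
      unfolding eventually_at_right_field by (intro exI[of _ "1/128"]) auto
    ultimately show "\<forall>\<^sub>F u in at_right 0. dist ((\<integral>y. heat_kernel m u x y *\<^sub>R f y \<partial>lborel) - mass u *\<^sub>R f x) 0 < e"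
    proof eventually_elim
      case (elim u)
      have "norm ((\<integral>y. heat_kernel m u x y *\<^sub>R f y \<partial>lborel) - mass u *\<^sub>R f x) \<le> C * e'"
        by (rule small[OF elim(2,3) e'(1) elim(1)])
      then show ?case using e'(2) by (simp add: dist_norm)
    qed
  qed
  moreover have "((\<lambda>u. mass u *\<^sub>R f x) \<longlongrightarrow> f x) (at_right 0)"
  proof -
    have "(mass \<longlongrightarrow> exp (- (0 * m)) * cosh (2 * 0) powr (- (real CARD('n) / 2)) * exp (- (tanh (2 * 0) / 2 * (norm x)\<^sup>2))) (at_right 0)"
      unfolding mass_def by (intro tendsto_intros) (auto simp: cosh_real_nonzero)
    then have "(mass \<longlongrightarrow> 1) (at_right 0)" by simp
    from tendsto_scaleR[OF this tendsto_const[of "f x"]] show ?thesis by simp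
  qed
  ultimately show ?thesis using tendsto_add by fastforce
qed

section \<open>A lower bound for the Poisson kernel, and subordination\<close>

text \<open>
  If \<open>\<kappa> = 0\<close> the integral is explicit; if \<open>\<kappa> > 0\<close> the first unit of time alone has the right size.
\<close>

lemma tail_integral_ge:
  assumes "\<kappa> \<ge> 0" "\<nu> > 0"
  obtains c where "c > 0" "\<And>R. R \<ge> 0 \<Longrightarrow>
    ennreal (c * tail_weight \<kappa> \<nu> R) \<le> (\<integral>\<^sup>+u\<in>{ln (exp 1 + R) / 2..}. ennreal (u powr (- (1 + \<nu>)) * exp (- (\<kappa> * u))) \<partial>lborel)"
proof (cases "\<kappa> = 0")
  case True
  have "ennreal ((1/2) powr (- \<nu>) / \<nu> * tail_weight \<kappa> \<nu> R) \<le> (\<integral>\<^sup>+u\<in>{ln (exp 1 + R) / 2..}. ennreal (u powr (- (1 + \<nu>)) * exp (- (\<kappa> * u))) \<partial>lborel)" if R: "R \<ge> 0" for R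
  proof -
    have l: "ln (exp 1 + R) \<ge> 1" by (rule ln_e_plus_ge_1[OF R])
    have "(ln (exp 1 + R) / 2) powr (- \<nu>) / \<nu> = (1/2) powr (- \<nu>) / \<nu> * tail_weight \<kappa> \<nu> R"
      using True l powr_mult[of "1/2" "ln (exp 1 + R)" "- \<nu>"] by (simp add: tail_weight_def)
    moreover have "(\<integral>\<^sup>+u\<in>{ln (exp 1 + R) / 2..}. ennreal (u powr (- (1 + \<nu>)) * exp (- (\<kappa> * u))) \<partial>lborel) = ennreal ((ln (exp 1 + R) / 2) powr (- \<nu>) / \<nu>)"
      using True l nn_integral_powr_tail[of "ln (exp 1 + R) / 2" \<nu>] assms by simp
    ultimately show ?thesis by (simp only: order.refl)
  qed
  moreover have "(1/2) powr (- \<nu>) / \<nu> > 0" using assms by simp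
  ultimately show ?thesis using that by blast
next
  case False
  then have \<kappa>: "\<kappa> > 0" using assms by simp
  define c where "c = (3/2) powr (- (1 + \<nu>)) * (exp (- \<kappa>) * (exp 1) powr (- (\<kappa> / 2)))"
  have "ennreal (c * tail_weight \<kappa> \<nu> R) \<le> (\<integral>\<^sup>+u\<in>{ln (exp 1 + R) / 2..}. ennreal (u powr (- (1 + \<nu>)) * exp (- (\<kappa> * u))) \<partial>lborel)" if R: "R \<ge> 0" for R
  proof -
    define V where "V = ln (exp 1 + R) / 2"
    have l: "ln (exp 1 + R) \<ge> 1" by (rule ln_e_plus_ge_1[OF R])
    have V: "V \<ge> 1/2" using l by (simp add: V_def)
    have eR: "exp 1 + R > 0" using R by (simp add: add_pos_nonneg)
    have pt: "c * tail_weight \<kappa> \<nu> R \<le> u powr (- (1 + \<nu>)) * exp (- (\<kappa> * u))" if u: "V \<le> u" "u \<le> V + 1" for u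
    proof -
      have "(3/2) powr (- (1 + \<nu>)) * ln (exp 1 + R) powr (- (1 + \<nu>)) = (3 * V) powr (- (1 + \<nu>))"
        using l powr_mult[of "3/2" "ln (exp 1 + R)" "- (1 + \<nu>)"] by (simp add: V_def)
      also have "\<dots> \<le> u powr (- (1 + \<nu>))" using u V assms by (intro powr_mono2') auto
      finally have p1: "(3/2) powr (- (1 + \<nu>)) * ln (exp 1 + R) powr (- (1 + \<nu>)) \<le> u powr (- (1 + \<nu>))" .
      have "exp 1 * (1 + R) \<ge> exp 1 + R"
        using R mult_right_mono[of 1 "exp 1" R] by (simp add: distrib_left)
      then have "(exp 1 * (1 + R)) powr (- (\<kappa> / 2)) \<le> (exp 1 + R) powr (- (\<kappa> / 2))"
        using eR \<kappa> by (intro powr_mono2') auto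
      also have "\<dots> = exp (- (\<kappa> * V))" using eR by (simp add: powr_def V_def)
      finally have p: "(exp 1) powr (- (\<kappa> / 2)) * (1 + R) powr (- (\<kappa> / 2)) \<le> exp (- (\<kappa> * V))"
        using R by (simp add: powr_mult)
      have "exp (- \<kappa>) * (exp 1 powr (- (\<kappa> / 2)) * (1 + R) powr (- (\<kappa> / 2))) \<le> exp (- \<kappa>) * exp (- (\<kappa> * V))"
        by (rule mult_left_mono[OF p]) simp
      also have "\<dots> = exp (- (\<kappa> * (V + 1)))" by (simp add: algebra_simps flip: exp_add)
      also have "\<dots> \<le> exp (- (\<kappa> * u))" using u \<kappa> by simp
      finally have p2: "exp (- \<kappa>) * (exp 1 powr (- (\<kappa> / 2)) * (1 + R) powr (- (\<kappa> / 2))) \<le> exp (- (\<kappa> * u))" .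
      have "c * tail_weight \<kappa> \<nu> R = ((3/2) powr (- (1 + \<nu>)) * ln (exp 1 + R) powr (- (1 + \<nu>))) * (exp (- \<kappa>) * (exp 1 powr (- (\<kappa> / 2)) * (1 + R) powr (- (\<kappa> / 2))))"
        unfolding c_def tail_weight_def using False by (simp only: if_False mult_ac)
      also have "\<dots> \<le> u powr (- (1 + \<nu>)) * exp (- (\<kappa> * u))"
        by (rule mult_mono[OF p1 p2]) simp_all
      finally show ?thesis .
    qed
    have "ennreal (c * tail_weight \<kappa> \<nu> R) = (\<integral>\<^sup>+u\<in>{V..V + 1}. ennreal (c * tail_weight \<kappa> \<nu> R) \<partial>lborel)"
      by (simp add: nn_integral_cmult_indicator)
    also have "\<dots> \<le> (\<integral>\<^sup>+u\<in>{V..}. ennreal (u powr (- (1 + \<nu>)) * exp (- (\<kappa> * u))) \<partial>lborel)"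
      using pt by (intro nn_integral_mono) (auto split: split_indicator intro: ennreal_leI)
    finally show ?thesis by (simp add: V_def)
  qed
  moreover have "c > 0" by (simp add: c_def)
  ultimately show ?thesis using that by blast
qed

text \<open>
  At times \<open>u \<ge> ln (e + |y|) / 2\<close> one has \<open>exp (-2u) |y| \<le> 1\<close>, so the cross term and the excess of \<open>coth (2u)\<close>
  over \<open>1\<close> change the exponent by a bounded amount only. These times already produce the weight, which is
  therefore the exact order of magnitude of the kernel.
\<close>

lemma kern_integral_ge:
  fixes x :: "real ^ 'n::finite"
  assumes \<nu>: "\<nu> > 0" and m: "m \<ge> - real CARD('n)"
  obtains c where "c > 0"
    "\<And>y. ennreal (c * weight_phi m \<nu> y) \<le> (\<integral>\<^sup>+u\<in>{0<..}. ennreal (pkern m \<nu> t x u y) \<partial>lborel)"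
proof -
  define \<kappa> where "\<kappa> = real CARD('n) + m"
  have \<kappa>: "\<kappa> \<ge> 0" using m by (simp add: \<kappa>_def)
  define q :: real where "q = 1 - exp (- 2)"
  have q: "q > 0" by (simp add: q_def)
  define c0 where "c0 = pi powr (- (real CARD('n) / 2)) * exp (- (2 / q * norm x + t\<^sup>2 / 2 + (norm x)\<^sup>2 + 1 / q))"
  have c0: "c0 > 0" by (simp add: c0_def)
  obtain c1 where c1: "c1 > 0" "\<And>R. R \<ge> 0 \<Longrightarrow>
    ennreal (c1 * tail_weight \<kappa> \<nu> R) \<le> (\<integral>\<^sup>+u\<in>{ln (exp 1 + R) / 2..}. ennreal (u powr (- (1 + \<nu>)) * exp (- (\<kappa> * u))) \<partial>lborel)"
    by (rule tail_integral_ge[OF \<kappa> \<nu>]) (rule that; assumption)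
  have "ennreal (c0 * c1 * weight_phi m \<nu> y) \<le> (\<integral>\<^sup>+u\<in>{0<..}. ennreal (pkern m \<nu> t x u y) \<partial>lborel)" for y
  proof -
    define R where "R = norm y"
    define V where "V = ln (exp 1 + R) / 2"
    have R: "R \<ge> 0" by (simp add: R_def)
    have V: "V \<ge> 1/2" using ln_e_plus_ge_1[OF R] by (simp add: V_def)
    have eR: "exp 1 + R > 0" using R by (simp add: add_pos_nonneg)
    have pt: "c0 * exp (- (R\<^sup>2 / 2)) * (u powr (- (1 + \<nu>)) * exp (- (\<kappa> * u))) \<le> pkern m \<nu> t x u y" if u: "V \<le> u" for u
    proof -
      have u0: "u > 0" "u \<ge> 1/2" using u V by auto
      have "exp (2 * u) \<ge> exp (2 * V)" using u by simp
      also have "exp (2 * V) = exp 1 + R" using eR by (simp add: V_def)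
      finally have "R \<le> exp (2 * u)" using exp_gt_zero[of "1::real"] by linarith
      then have "exp (- (2 * u)) * R \<le> exp (- (2 * u)) * exp (2 * u)" by (intro mult_left_mono) auto
      then have z: "exp (- (2 * u)) * R \<le> 1" by (simp flip: exp_add)
      have qu: "q \<le> 1 - exp (- (4 * u))" using u0 by (simp add: q_def)
      have "csch2 u \<le> 2 * exp (- (2 * u)) / q"
        unfolding csch2_exp[OF u0(1)] using qu q u0 by (intro divide_left_mono mult_pos_pos) auto
      then have "csch2 u * (norm x * R) \<le> 2 * exp (- (2 * u)) / q * (norm x * R)" using R by (intro mult_right_mono) auto
      also have "\<dots> = 2 / q * norm x * (exp (- (2 * u)) * R)" by simp
      also have "\<dots> \<le> 2 / q * norm x * 1" using z q by (intro mult_left_mono) auto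
      finally have "csch2 u * (norm x * R) \<le> 2 / q * norm x" by simp
      moreover have "csch2 u * (- (norm x * R)) \<le> csch2 u * (x \<bullet> y)"
        using csch2_pos[OF u0(1)] Cauchy_Schwarz_ineq2[of x y] by (intro mult_left_mono) (auto simp: R_def abs_le_iff)
      ultimately have e1: "- (2 / q * norm x) \<le> csch2 u * (x \<bullet> y)" by simp
      have "t\<^sup>2 / (4 * u) \<le> t\<^sup>2 / 2" using u0 by (intro divide_left_mono) auto
      moreover have "coth2 u / 2 \<le> 1"
      proof -
        have "1 / (2 * u) \<le> 1" using u0 by simp
        then show ?thesis using coth2_le[OF u0(1)] by simp
      qed
      then have "(norm x)\<^sup>2 * (coth2 u / 2) \<le> (norm x)\<^sup>2 * 1" by (intro mult_left_mono) auto
      moreover have "coth2 u / 2 * R\<^sup>2 \<le> R\<^sup>2 / 2 + 1 / q"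
      proof -
        have "coth2 u \<le> 1 + 2 * exp (- (4 * u)) / q"
          unfolding coth2_exp[OF u0(1)] using qu q u0 by (intro add_left_mono divide_left_mono mult_pos_pos) auto
        then have "coth2 u / 2 * R\<^sup>2 \<le> (1 + 2 * exp (- (4 * u)) / q) / 2 * R\<^sup>2" by (intro mult_right_mono divide_right_mono) auto
        also have "\<dots> = R\<^sup>2 / 2 + (exp (- (4 * u)) * R\<^sup>2) / q" by (simp add: algebra_simps)
        also have "exp (- (4 * u)) * R\<^sup>2 = (exp (- (2 * u)) * R)\<^sup>2" by (simp add: power_mult_distrib flip: exp_double)
        also have "(exp (- (2 * u)) * R)\<^sup>2 \<le> 1\<^sup>2" using z R by (intro power_mono) auto
        finally show ?thesis using q by (simp add: divide_right_mono)
      qed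
      ultimately have expo: "- (2 / q * norm x + t\<^sup>2 / 2 + (norm x)\<^sup>2 + 1 / q) + - (R\<^sup>2 / 2)
        \<le> csch2 u * (x \<bullet> y) - t\<^sup>2 / (4 * u) - (norm x)\<^sup>2 * (coth2 u / 2) - coth2 u / 2 * (norm y)\<^sup>2"
        using e1 unfolding R_def by linarith
      have "exp (2 * u) * (1 - exp (- (4 * u))) \<le> exp (2 * u) * 1" by (intro mult_left_mono) auto
      then have "2 * sinh (2 * u) \<le> exp (2 * u)" unfolding sinh_exp by simp
      then have "2 * pi * sinh (2 * u) \<le> pi * exp (2 * u)" by simp
      then have "(pi * exp (2 * u)) powr (- (real CARD('n) / 2)) \<le> (2 * pi * sinh (2 * u)) powr (- (real CARD('n) / 2))"
        using u0 by (intro powr_mono2') auto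
      moreover have "(pi * exp (2 * u)) powr (- (real CARD('n) / 2)) = pi powr (- (real CARD('n) / 2)) * exp (- (real CARD('n) * u))"
        by (subst powr_mult) (auto simp: powr_def)
      ultimately have pw: "pi powr (- (real CARD('n) / 2)) * exp (- (real CARD('n) * u)) \<le> (2 * pi * sinh (2 * u)) powr (- (real CARD('n) / 2))" by simp
      have "exp (- (\<kappa> * u)) = exp (- (real CARD('n) * u)) * exp (- (u * m))" by (simp add: \<kappa>_def algebra_simps flip: exp_add)
      then have "c0 * exp (- (R\<^sup>2 / 2)) * (u powr (- (1 + \<nu>)) * exp (- (\<kappa> * u)))
        = u powr (- (1 + \<nu>)) * (pi powr (- (real CARD('n) / 2)) * exp (- (real CARD('n) * u))) * exp (- (u * m)) * exp (- (2 / q * norm x + t\<^sup>2 / 2 + (norm x)\<^sup>2 + 1 / q) + - (R\<^sup>2 / 2))"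
        unfolding c0_def exp_add[of _ "- (R\<^sup>2 / 2)"] by (simp only: mult_ac)
      also have "\<dots> \<le> pkern m \<nu> t x u y"
        unfolding kern_eq using pw expo by (intro mult_mono mult_nonneg_nonneg order.refl) auto
      finally show ?thesis .
    qed
    have "ennreal (c0 * c1 * weight_phi m \<nu> y) = ennreal (c0 * exp (- (R\<^sup>2 / 2))) * ennreal (c1 * tail_weight \<kappa> \<nu> R)"
      using c0 c1(1) tail_weight_pos[OF R, of \<kappa> \<nu>] by (subst ennreal_mult[symmetric]) (auto simp: weight_phi_eq \<kappa>_def R_def mult_ac)
    also have "\<dots> \<le> ennreal (c0 * exp (- (R\<^sup>2 / 2))) * (\<integral>\<^sup>+u\<in>{V..}. ennreal (u powr (- (1 + \<nu>)) * exp (- (\<kappa> * u))) \<partial>lborel)"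
      unfolding V_def by (intro mult_left_mono c1(2) R) auto
    also have "\<dots> = (\<integral>\<^sup>+u. ennreal (c0 * exp (- (R\<^sup>2 / 2))) * (ennreal (u powr (- (1 + \<nu>)) * exp (- (\<kappa> * u))) * indicator {V..} u) \<partial>lborel)"
      by (rule nn_integral_cmult[symmetric]) measurable
    also have "\<dots> \<le> (\<integral>\<^sup>+u\<in>{0<..}. ennreal (pkern m \<nu> t x u y) \<partial>lborel)"
    proof (rule nn_integral_mono)
      fix u
      show "ennreal (c0 * exp (- (R\<^sup>2 / 2))) * (ennreal (u powr (- (1 + \<nu>)) * exp (- (\<kappa> * u))) * indicator {V..} u)
        \<le> ennreal (pkern m \<nu> t x u y) * indicator {0<..} u"
      proof (cases "V \<le> u")
        case True
        have "ennreal (c0 * exp (- (R\<^sup>2 / 2))) * ennreal (u powr (- (1 + \<nu>)) * exp (- (\<kappa> * u)))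
          = ennreal (c0 * exp (- (R\<^sup>2 / 2)) * (u powr (- (1 + \<nu>)) * exp (- (\<kappa> * u))))"
          using c0 by (intro ennreal_mult[symmetric]) auto
        also have "\<dots> \<le> ennreal (pkern m \<nu> t x u y)"
          by (rule ennreal_leI[OF pt[OF True]])
        finally show ?thesis using True V by simp
      qed simp
    qed
    finally show ?thesis .
  qed
  moreover have "c0 * c1 > 0" using c0 c1 by simp
  ultimately show ?thesis using that by blast
qed

lemma L1_phi_if_poisson_abs_finite:
  fixes f :: "real ^ 'n::finite \<Rightarrow> complex"
  assumes f: "f \<in> borel_measurable lebesgue" and \<nu>: "\<nu> > 0" and m: "m \<ge> - real CARD('n)"
    and t: "t > 0" and fin: "poisson_abs m \<nu> f t x < \<infinity>"
  shows "f \<in> L1_phi m \<nu>"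
proof -
  obtain f' where f' [measurable]: "f' \<in> borel_measurable borel" and ae: "AE y in lborel. f y = f' y"
    using lebesgue_ex_borel_complex[OF f] by blast
  obtain c where c: "c > 0"
    "\<And>y. ennreal (c * weight_phi m \<nu> y) \<le> (\<integral>\<^sup>+u\<in>{0<..}. ennreal (pkern m \<nu> t x u y) \<partial>lborel)"
    by (rule kern_integral_ge[OF \<nu> m, where t = t and x = x]) (rule that; assumption)
  define I where "I = (\<integral>\<^sup>+y. ennreal (norm (f' y)) * (\<integral>\<^sup>+u\<in>{0<..}. ennreal (pkern m \<nu> t x u y) \<partial>lborel) \<partial>lborel)"
  have "poisson_abs m \<nu> f t x = ennreal (t powr (2 * \<nu>) / (4 powr \<nu> * Gamma \<nu>)) * I"
    unfolding poisson_abs_eq[OF f' ae] kern_iterated_nn_integral[OF f'] I_def ..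
  moreover have "t powr (2 * \<nu>) / (4 powr \<nu> * Gamma \<nu>) > 0"
    using t \<nu> by (intro divide_pos_pos mult_pos_pos Gamma_real_pos) auto
  ultimately have I: "I < \<infinity>" using fin by (auto simp: ennreal_mult_less_top ennreal_eq_0_iff)
  have "ennreal c * (\<integral>\<^sup>+y. ennreal (norm (f' y) * weight_phi m \<nu> y) \<partial>lborel) = (\<integral>\<^sup>+y. ennreal c * ennreal (norm (f' y) * weight_phi m \<nu> y) \<partial>lborel)"
    by (rule nn_integral_cmult[symmetric]) measurable
  also have "\<dots> = (\<integral>\<^sup>+y. ennreal (norm (f' y)) * ennreal (c * weight_phi m \<nu> y) \<partial>lborel)"
    by (intro nn_integral_cong)
      (simp only: ennreal_mult[OF less_imp_le[OF c(1)] less_imp_le[OF weight_phi_pos]] ennreal_mult[OF norm_ge_zero less_imp_le[OF weight_phi_pos]] mult_ac)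
  also have "\<dots> \<le> I" unfolding I_def by (intro nn_integral_mono mult_left_mono c(2)) auto
  also have "\<dots> < \<infinity>" by (rule I)
  finally have "(\<integral>\<^sup>+y. ennreal (norm (f' y) * weight_phi m \<nu> y) \<partial>lborel) < \<infinity>"
    using c(1) by (auto simp: ennreal_mult_less_top ennreal_eq_0_iff)
  moreover have "(\<integral>\<^sup>+y. ennreal (norm (f y) * weight_phi m \<nu> y) \<partial>lebesgue) = (\<integral>\<^sup>+y. ennreal (norm (f' y) * weight_phi m \<nu> y) \<partial>lborel)"
    unfolding nn_integral_completion using ae by (intro nn_integral_cong_AE) (auto elim!: eventually_mono)
  ultimately show ?thesis using f by (simp add: L1_phi_def)
qed

text \<open>
  The substitution \<open>s = t\<^sup>2 / (4u)\<close> turns the integral into the one of the Gamma function. The substitution theorem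
  wants increasing maps, hence the detour through the negative half-line.
\<close>

lemma subordinator_mass:
  fixes t \<nu> :: real
  assumes t: "t > 0" and \<nu>: "\<nu> > 0"
  shows "set_integrable lborel {0<..} (\<lambda>u. levy_weight \<nu> t u)"
    and "(LINT u:{0<..}|lborel. levy_weight \<nu> t u) = 4 powr \<nu> * Gamma \<nu> / t powr (2 * \<nu>)"
proof -
  define f where "f v = exp (t\<^sup>2 / (4 * v)) * (- v) powr (- (1 + \<nu>))" for v
  define g where "g s = - (t\<^sup>2 / (4 * s))" for s
  define g' where "g' s = t\<^sup>2 / (4 * s\<^sup>2)" for s
  define K where "K = (t\<^sup>2 / 4) powr (- \<nu>)"
  have e: "einterval (ereal 0) \<infinity> = {0<..}" by (auto simp: einterval_def)
  have fg: "f (g s) * g' s = K * (s powr (\<nu> - 1) / exp s)" if s: "s > 0" for s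
  proof -
    have a: "t\<^sup>2 / 4 > 0" using t by simp
    have "f (g s) = exp (- s) * ((t\<^sup>2 / 4) / s) powr (- (1 + \<nu>))"
      using s t by (simp add: f_def g_def)
    also have "((t\<^sup>2 / 4) / s) powr (- (1 + \<nu>)) = (t\<^sup>2 / 4) powr (- (1 + \<nu>)) * s powr (1 + \<nu>)"
    proof -
      have "((t\<^sup>2 / 4) / s) powr (- (1 + \<nu>)) = (t\<^sup>2 / 4) powr (- (1 + \<nu>)) / s powr (- (1 + \<nu>))"
        by (rule powr_divide)
      then show ?thesis unfolding powr_minus_divide[of s] by (simp only: divide_divide_eq_right div_by_1)
    qed
    also have "(t\<^sup>2 / 4) powr (- (1 + \<nu>)) = K / (t\<^sup>2 / 4)"
    proof -
      have "- (1 + \<nu>) = - \<nu> - 1" by simp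
      then show ?thesis unfolding K_def by (simp only: powr_diff powr_one[OF less_imp_le[OF a]])
    qed
    also have "s powr (1 + \<nu>) = s powr (\<nu> - 1) * s\<^sup>2"
    proof -
      have "1 + \<nu> = (\<nu> - 1) + 2" by simp
      moreover have "s powr 2 = s\<^sup>2" using s by simp
      ultimately show ?thesis by (simp only: powr_add)
    qed
    finally show ?thesis using s t by (simp add: g'_def exp_minus field_simps)
  qed
  have Gint: "set_integrable lborel {0<..} (\<lambda>s. s powr (\<nu> - 1) / exp s)" 
    and Gval: "(LINT s:{0<..}|lborel. s powr (\<nu> - 1) / exp s) = Gamma \<nu>"
  proof -
    have "(\<integral>\<^sup>+s. ennreal (indicator {0<..} s *\<^sub>R (s powr (\<nu> - 1) / exp s)) \<partial>lborel)
      = (\<integral>\<^sup>+s. ennreal (indicator {0..} s * s powr (\<nu> - 1) / exp s) \<partial>lborel)"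
      by (intro nn_integral_cong) (auto split: split_indicator)
    also have "\<dots> = ennreal (Gamma \<nu>)" by (rule Gamma_conv_nn_integral_real[OF \<nu>, symmetric])
    finally have "has_bochner_integral lborel (\<lambda>s. indicator {0<..} s *\<^sub>R (s powr (\<nu> - 1) / exp s)) (Gamma \<nu>)"
      using Gamma_real_pos[OF \<nu>] by (intro has_bochner_integral_nn_integral) auto
    then show "set_integrable lborel {0<..} (\<lambda>s. s powr (\<nu> - 1) / exp s)"
      "(LINT s:{0<..}|lborel. s powr (\<nu> - 1) / exp s) = Gamma \<nu>"
      by (auto simp: set_integrable_def set_lebesgue_integral_def has_bochner_integral_iff)
  qed
  have fgint: "set_integrable lborel (einterval (ereal 0) \<infinity>) (\<lambda>s. f (g s) * g' s)"
  proof -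
    have "set_integrable lborel {0<..} (\<lambda>s. K * (s powr (\<nu> - 1) / exp s))"
      by (intro set_integrable_mult_right Gint)
    then show ?thesis unfolding e by (rule set_integrable_cong[THEN iffD2, rotated 3]) (simp_all add: fg)
  qed
  have sub: "(LBINT v=-\<infinity>..ereal 0. f v) = (LBINT s=ereal 0..\<infinity>. f (g s) * g' s)"
  proof (rule interval_integral_substitution_nonneg(2)[where f = f and g = g and g' = g' and a = "ereal 0" and b = \<infinity>])
    fix s assume "ereal 0 < ereal s"
    then have s: "s > 0" by simp
    show "(g has_real_derivative g' s) (at s)"
      unfolding g_def[abs_def] g'_def using s by (auto intro!: derivative_eq_intros simp: power2_eq_square field_simps)
    show "isCont f (g s)" unfolding f_def[abs_def] using s t
      by (intro continuous_intros) (auto simp: g_def)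
    show "isCont g' s" unfolding g'_def[abs_def] using s by (intro continuous_intros) auto
    show "0 \<le> f (g s)" by (simp add: f_def)
  next
    show "0 \<le> g' s" for s by (simp add: g'_def)
    have "filterlim g at_bot (at_right 0)" unfolding g_def[abs_def] using t by real_asymp
    then show "((ereal \<circ> g \<circ> real_of_ereal) \<longlongrightarrow> - \<infinity>) (at_right (ereal 0))"
      by (simp add: ereal_tendsto_simps comp_def[symmetric] comp_assoc[symmetric])
    have "(g \<longlongrightarrow> 0) at_top" unfolding g_def[abs_def] by real_asymp
    then show "((ereal \<circ> g \<circ> real_of_ereal) \<longlongrightarrow> ereal 0) (at_left \<infinity>)"
      by (simp add: ereal_tendsto_simps)
    show "set_integrable lborel (einterval (ereal 0) \<infinity>) (\<lambda>s. f (g s) * g' s)" by (rule fgint)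
  qed auto
  have "(LBINT s=ereal 0..\<infinity>. f (g s) * g' s) = (LINT s:{0<..}|lborel. K * (s powr (\<nu> - 1) / exp s))"
    unfolding interval_integral_to_infinity_eq using fg by (intro set_lebesgue_integral_cong) auto
  also have "\<dots> = K * Gamma \<nu>" unfolding set_integral_mult_right Gval ..
  finally have val: "(LBINT v=-\<infinity>..ereal 0. f v) = K * Gamma \<nu>" unfolding sub .
  have "(LBINT v=-\<infinity>..ereal 0. f v) = (LBINT u=ereal 0..\<infinity>. f (- u))"
    by (subst interval_integral_reflect) (simp add: zero_ereal_def[symmetric])
  also have "\<dots> = (LINT u:{0<..}|lborel. levy_weight \<nu> t u)"
    unfolding interval_integral_to_infinity_eq f_def
    unfolding powr_minus_divide by (intro set_lebesgue_integral_cong) auto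
  finally have I: "(LINT u:{0<..}|lborel. levy_weight \<nu> t u) = K * Gamma \<nu>" using val by simp
  have K: "K = 4 powr \<nu> / t powr (2 * \<nu>)"
  proof -
    have t2: "t\<^sup>2 = t powr 2" using t by simp
    show ?thesis unfolding K_def powr_minus_divide powr_divide t2 powr_powr by simp
  qed
  then show "(LINT u:{0<..}|lborel. levy_weight \<nu> t u) = 4 powr \<nu> * Gamma \<nu> / t powr (2 * \<nu>)"
    using I by simp
  \<comment> \<open>A function that is not integrable has Bochner integral \<open>0\<close>.\<close>
  have "K * Gamma \<nu> \<noteq> 0" using t by (simp add: K_def less_imp_neq[OF Gamma_real_pos[OF \<nu>], symmetric])
  then show "set_integrable lborel {0<..} (\<lambda>u. levy_weight \<nu> t u)"
    using I unfolding set_integrable_def set_lebesgue_integral_def by (metis not_integrable_integral_eq)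
qed

text \<open>
  The probability measures with which \<open>H\<close> is averaged concentrate at \<open>u = 0\<close> as \<open>t \<rightarrow> 0\<close>: away from \<open>0\<close> their
  densities are at most a constant times \<open>t powr (2 * \<nu>)\<close> times the density for \<open>t = 1\<close>.
\<close>

lemma subordination_tendsto:
  fixes H :: "real \<Rightarrow> complex"
  assumes \<nu>: "\<nu> > 0" and H: "(H \<longlongrightarrow> l) (at_right 0)"
    and int: "\<And>t. t > 0 \<Longrightarrow> set_integrable lborel {0<..} (\<lambda>u. levy_weight \<nu> t u *\<^sub>R H u)"
  shows "((\<lambda>t. (t powr (2 * \<nu>) / (4 powr \<nu> * Gamma \<nu>)) *\<^sub>R
     (LINT u:{0<..}|lborel. levy_weight \<nu> t u *\<^sub>R H u)) \<longlongrightarrow> l) (at_right 0)"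
proof (rule tendstoI)
  fix e :: real assume e: "e > 0"
  define w where "w t u = levy_weight \<nu> t u" for t u :: real
  define c where "c t = t powr (2 * \<nu>) / (4 powr \<nu> * Gamma \<nu>)" for t
  have Gpos: "4 powr \<nu> * Gamma \<nu> > 0" using Gamma_real_pos[OF \<nu>] by simp
  have w0: "w t u \<ge> 0" for t u by (simp add: w_def)
  have wint: "set_integrable lborel {0<..} (w t)" and wval: "c t * (LINT u:{0<..}|lborel. w t u) = 1" if "t > 0" for t
    using subordinator_mass[OF that \<nu>] that Gpos by (auto simp: w_def[abs_def] c_def)
  have Hint: "set_integrable lborel {0<..} (\<lambda>u. w t u *\<^sub>R H u)" if "t > 0" for t
    using int[OF that] by (simp add: w_def)
  have Dint: "set_integrable lborel {0<..} (\<lambda>u. w t u *\<^sub>R (H u - l))" if "t > 0" for t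
  proof -
    have "set_integrable lborel {0<..} (\<lambda>u. w t u *\<^sub>R l)" 
      using wint[OF that] unfolding set_integrable_def by (simp flip: scaleR_scaleR) (simp add: integrable_scaleR_left)
    from set_integral_diff(1)[OF Hint[OF that] this] show ?thesis by (simp add: scaleR_diff_right)
  qed
  have "\<forall>\<^sub>F u in at_right 0. dist (H u) l < e / 2" using H e by (intro tendstoD) auto
  then obtain \<eta> where \<eta>: "\<eta> > 0" "\<And>u. 0 < u \<Longrightarrow> u < \<eta> \<Longrightarrow> norm (H u - l) \<le> e / 2"
    unfolding eventually_at_right_field dist_norm by (meson less_imp_le)
  define J where "J = (LINT u:{0<..}|lborel. w 1 u * norm (H u - l))"
  define B where "B = exp (1 / (4 * \<eta>)) * J"
  have nint: "set_integrable lborel {0<..} (\<lambda>u. w t u * norm (H u - l))" if "t > 0" for t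
    using set_integrable_norm[OF Dint[OF that]] w0 by (simp add: abs_of_nonneg)
  have main: "norm (c t *\<^sub>R (LINT u:{0<..}|lborel. w t u *\<^sub>R H u) - l) \<le> e / 2 + c t * B" if t: "t > 0" for t
  proof -
    have c0: "c t > 0" using t Gpos by (simp add: c_def)
    have "(LINT u:{0<..}|lborel. w t u *\<^sub>R (H u - l)) = (LINT u:{0<..}|lborel. w t u *\<^sub>R H u) - (LINT u:{0<..}|lborel. w t u *\<^sub>R l)"
    proof -
      have "set_integrable lborel {0<..} (\<lambda>u. w t u *\<^sub>R l)" 
        using wint[OF t] unfolding set_integrable_def by (simp flip: scaleR_scaleR) (simp add: integrable_scaleR_left)
      from set_integral_diff(2)[OF Hint[OF t] this] show ?thesis by (simp add: scaleR_diff_right)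
    qed
    also have "(LINT u:{0<..}|lborel. w t u *\<^sub>R l) = (LINT u:{0<..}|lborel. w t u) *\<^sub>R l"
      using wint[OF t] unfolding set_lebesgue_integral_def set_integrable_def
      by (subst integral_scaleR_left[symmetric]) auto
    finally have "c t *\<^sub>R (LINT u:{0<..}|lborel. w t u *\<^sub>R (H u - l)) = c t *\<^sub>R (LINT u:{0<..}|lborel. w t u *\<^sub>R H u) - l"
      using wval[OF t] by (simp add: scaleR_diff_right)
    then have "norm (c t *\<^sub>R (LINT u:{0<..}|lborel. w t u *\<^sub>R H u) - l) = c t * norm (LINT u:{0<..}|lborel. w t u *\<^sub>R (H u - l))"
      using c0 by (metis abs_of_pos norm_scaleR)
    also have "norm (LINT u:{0<..}|lborel. w t u *\<^sub>R (H u - l)) \<le> (LINT u:{0<..}|lborel. w t u * norm (H u - l))"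
      using set_integral_norm_bound[OF Dint[OF t]] w0 by (simp add: abs_of_nonneg)
    also have "\<dots> \<le> (LINT u:{0<..}|lborel. e / 2 * w t u + exp (1 / (4 * \<eta>)) * (w 1 u * norm (H u - l)))"
    proof (rule set_integral_mono[OF nint[OF t]])
      show "set_integrable lborel {0<..} (\<lambda>u. e / 2 * w t u + exp (1 / (4 * \<eta>)) * (w 1 u * norm (H u - l)))"
        by (intro set_integral_add set_integrable_mult_right wint nint t) auto
      fix u :: real assume "u \<in> {0<..}"
      then have u: "u > 0" by simp
      show "w t u * norm (H u - l) \<le> e / 2 * w t u + exp (1 / (4 * \<eta>)) * (w 1 u * norm (H u - l))"
      proof (cases "u < \<eta>")
        case True
        have "w t u * norm (H u - l) \<le> w t u * (e / 2)" using \<eta>(2)[OF u True] w0 by (intro mult_left_mono)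
        moreover have "0 \<le> exp (1 / (4 * \<eta>)) * (w 1 u * norm (H u - l))" using w0 by simp
        ultimately show ?thesis by (simp add: mult.commute)
      next
        case False
        have "1 / (4 * u) \<le> 1 / (4 * \<eta>)" using False \<eta>(1) by (intro divide_left_mono) auto
        moreover have "0 \<le> t\<^sup>2 / (4 * u)" using u by simp
        ultimately have "exp (- (t\<^sup>2 / (4 * u))) \<le> exp (1 / (4 * \<eta>)) * exp (- (1 / (4 * u)))" by (simp flip: exp_add)
        then have "w t u \<le> exp (1 / (4 * \<eta>)) * exp (- (1 / (4 * u))) / u powr (1 + \<nu>)" unfolding w_def by (intro divide_right_mono) auto
        then have "w t u * norm (H u - l) \<le> exp (1 / (4 * \<eta>)) * w 1 u * norm (H u - l)" by (intro mult_right_mono) (auto simp: w_def)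
        moreover have "0 \<le> e / 2 * w t u" using e w0 by simp
        ultimately show ?thesis by (simp add: mult.assoc)
      qed
    qed
    also have "\<dots> = e / 2 * (LINT u:{0<..}|lborel. w t u) + B"
      unfolding B_def J_def using wint[OF t] nint[of 1] by (subst set_integral_add) (auto intro: set_integrable_mult_right)
    finally show ?thesis using c0 wval[OF t] by (simp add: distrib_left mult.left_commute)
  qed
  have "((\<lambda>t. c t * B) \<longlongrightarrow> 0) (at_right 0)"
  proof -
    have "((\<lambda>t. t powr (2 * \<nu>)) \<longlongrightarrow> 0) (at_right (0::real))" using \<nu> by real_asymp
    then have "((\<lambda>t. t powr (2 * \<nu>) * (B / (4 powr \<nu> * Gamma \<nu>))) \<longlongrightarrow> 0) (at_right 0)" by (rule tendsto_mult_left_zero)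
    then show ?thesis by (simp add: c_def)
  qed
  then have "\<forall>\<^sub>F t in at_right 0. c t * B < e / 2" using e by (intro order_tendstoD) auto
  moreover have "\<forall>\<^sub>F t in at_right 0. t > (0::real)" by (simp add: eventually_at_right_less)
  ultimately show "\<forall>\<^sub>F t in at_right 0. dist ((t powr (2 * \<nu>) / (4 powr \<nu> * Gamma \<nu>)) *\<^sub>R
     (LINT u:{0<..}|lborel. levy_weight \<nu> t u *\<^sub>R H u)) l < e"
  proof eventually_elim
    fix t :: real assume "c t * B < e / 2" "t > 0"
    then have "norm (c t *\<^sub>R (LINT u:{0<..}|lborel. w t u *\<^sub>R H u) - l) < e" using main[of t] by linarith
    then show "dist ((t powr (2 * \<nu>) / (4 powr \<nu> * Gamma \<nu>)) *\<^sub>R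
     (LINT u:{0<..}|lborel. levy_weight \<nu> t u *\<^sub>R H u)) l < e"
      by (simp add: dist_norm c_def w_def)
  qed
qed

section \<open>Poisson integrals of functions in the weighted space\<close>

lemma gaussian_le_weight_phi:
  assumes \<nu>: "\<nu> > 0" and m: "m \<ge> - real CARD('n::finite)"
  obtains C where "C > 0" "\<And>y :: real ^ 'n. exp (- (norm y)\<^sup>2) \<le> C * weight_phi m \<nu> y"
proof -
  obtain C where C: "C > 0" "\<And>R. R \<ge> 0 \<Longrightarrow> exp (- (R\<^sup>2 / 2)) \<le> C * tail_weight (real CARD('n) + m) \<nu> R"
    using gaussian_le_tail_weight[of "real CARD('n) + m" \<nu>] \<nu> m by auto
  have "exp (- (norm y)\<^sup>2) \<le> C * weight_phi m \<nu> y" for y :: "real ^ 'n"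
  proof -
    have "exp (- (norm y)\<^sup>2) = exp (- ((norm y)\<^sup>2 / 2)) * exp (- ((norm y)\<^sup>2 / 2))" by (simp flip: exp_add)
    also have "\<dots> \<le> exp (- ((norm y)\<^sup>2 / 2)) * (C * tail_weight (real CARD('n) + m) \<nu> (norm y))"
      by (intro mult_left_mono C(2)) auto
    finally show ?thesis unfolding weight_phi_eq by (simp only: mult_ac)
  qed
  with C(1) show ?thesis using that by blast
qed

lemma heat_semigroup_tendsto_AE:
  fixes f f' :: "real ^ 'n::finite \<Rightarrow> complex"
  assumes \<nu>: "\<nu> > 0" and m: "m \<ge> - real CARD('n)" and f: "f \<in> borel_measurable lebesgue"
    and f' [measurable]: "f' \<in> borel_measurable borel" and ae: "AE y in lborel. f y = f' y"
    and fin: "(\<integral>\<^sup>+y. ennreal (norm (f' y) * weight_phi m \<nu> y) \<partial>lborel) < \<infinity>"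
  shows "AE x in lborel. ((\<lambda>u. heat_semigroup m u f x) \<longlongrightarrow> f x) (at_right 0)"
proof -
  obtain C where C: "C > 0" "\<And>y :: real ^ 'n. exp (- (norm y)\<^sup>2) \<le> C * weight_phi m \<nu> y"
    by (rule gaussian_le_weight_phi[OF \<nu> m]) (rule that; assumption)
  have gfin: "(\<integral>\<^sup>+y. ennreal (norm (f' y) * exp (- (norm y)\<^sup>2)) \<partial>lborel) < \<infinity>"
  proof -
    have "(\<integral>\<^sup>+y. ennreal (norm (f' y) * exp (- (norm y)\<^sup>2)) \<partial>lborel) \<le> (\<integral>\<^sup>+y. ennreal C * ennreal (norm (f' y) * weight_phi m \<nu> y) \<partial>lborel)"
    proof (rule nn_integral_mono)
      fix y
      have "norm (f' y) * exp (- (norm y)\<^sup>2) \<le> norm (f' y) * (C * weight_phi m \<nu> y)" by (intro mult_left_mono C) auto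
      then have "ennreal (norm (f' y) * exp (- (norm y)\<^sup>2)) \<le> ennreal (C * (norm (f' y) * weight_phi m \<nu> y))"
        by (intro ennreal_leI) (simp only: mult_ac)
      also have "\<dots> = ennreal C * ennreal (norm (f' y) * weight_phi m \<nu> y)"
        using C(1) weight_phi_pos[of m \<nu> y] by (intro ennreal_mult) auto
      finally show "ennreal (norm (f' y) * exp (- (norm y)\<^sup>2)) \<le> ennreal C * ennreal (norm (f' y) * weight_phi m \<nu> y)" .
    qed
    also have "\<dots> = ennreal C * (\<integral>\<^sup>+y. ennreal (norm (f' y) * weight_phi m \<nu> y) \<partial>lborel)"
      by (rule nn_integral_cmult) measurable
    also have "\<dots> < \<infinity>" using fin by (simp add: ennreal_mult_less_top)
    finally show ?thesis .
  qed
  have "(\<integral>\<^sup>+y\<in>ball 0 r. ennreal (norm (f' y)) \<partial>lborel) < \<infinity>" for r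
  proof -
    have "(\<integral>\<^sup>+y\<in>ball 0 r. ennreal (norm (f' y)) \<partial>lborel) \<le> (\<integral>\<^sup>+y. ennreal (exp (r\<^sup>2)) * ennreal (norm (f' y) * exp (- (norm y)\<^sup>2)) \<partial>lborel)"
    proof (rule nn_integral_mono)
      fix y
      show "ennreal (norm (f' y)) * indicator (ball 0 r) y \<le> ennreal (exp (r\<^sup>2)) * ennreal (norm (f' y) * exp (- (norm y)\<^sup>2))"
      proof (cases "y \<in> ball 0 r")
        case True
        then have "(norm y)\<^sup>2 \<le> r\<^sup>2" by (intro power_mono) auto
        then have "1 \<le> exp (r\<^sup>2) * exp (- (norm y)\<^sup>2)" by (simp flip: exp_add)
        then have "norm (f' y) * 1 \<le> norm (f' y) * (exp (r\<^sup>2) * exp (- (norm y)\<^sup>2))" by (rule mult_left_mono) simp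
        then have "ennreal (norm (f' y)) \<le> ennreal (exp (r\<^sup>2) * (norm (f' y) * exp (- (norm y)\<^sup>2)))" by (intro ennreal_leI) (simp add: mult_ac)
        also have "\<dots> = ennreal (exp (r\<^sup>2)) * ennreal (norm (f' y) * exp (- (norm y)\<^sup>2))" by (intro ennreal_mult) auto
        finally show ?thesis using True by simp
      qed simp
    qed
    also have "\<dots> = ennreal (exp (r\<^sup>2)) * (\<integral>\<^sup>+y. ennreal (norm (f' y) * exp (- (norm y)\<^sup>2)) \<partial>lborel)"
      by (rule nn_integral_cmult) measurable
    also have "\<dots> < \<infinity>" using gfin by (simp add: ennreal_mult_less_top)
    finally show ?thesis .
  qed
  from AE_lebesgue_point[OF f' this] ae show ?thesis
  proof eventually_elim
    case (elim x)
    have "((\<lambda>u. \<integral>y. heat_kernel m u x y *\<^sub>R f' y \<partial>lborel) \<longlongrightarrow> f' x) (at_right 0)"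
      by (rule heat_semigroup_tendsto[OF f' gfin]) (use elim(1) in blast)
    then show ?case unfolding heat_semigroup_cong_AE[OF f' ae f] elim(2) .
  qed
qed

lemma poisson_of_L1_phi:
  fixes f :: "real ^ 'n::finite \<Rightarrow> complex"
  assumes m: "m \<ge> - real CARD('n)" and \<nu>: "\<nu> > 0" and fL: "f \<in> L1_phi m \<nu>"
  shows "\<And>t x. t > 0 \<Longrightarrow> poisson_abs m \<nu> f t x < \<infinity>"
    and "Cinfinity_on ({0<..} \<times> UNIV) (\<lambda>(t, x). poisson m \<nu> f t x)"
    and "\<And>t x. t > 0 \<Longrightarrow> extension_pde_at m \<nu> (poisson m \<nu> f) t x"
    and "AE x in lebesgue. ((\<lambda>t. poisson m \<nu> f t x) \<longlongrightarrow> f x) (at_right 0)"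
proof -
  have f: "f \<in> borel_measurable lebesgue" using fL by (simp add: L1_phi_def)
  obtain f' where f': "f' \<in> borel_measurable borel" and ae: "AE y in lborel. f y = f' y"
    by (rule lebesgue_ex_borel_complex[OF f])
  have "(\<integral>\<^sup>+y. ennreal (norm (f y) * weight_phi m \<nu> y) \<partial>lebesgue) = (\<integral>\<^sup>+y. ennreal (norm (f' y) * weight_phi m \<nu> y) \<partial>lborel)"
    unfolding nn_integral_completion using ae by (intro nn_integral_cong_AE) (auto elim!: eventually_mono)
  then have fin: "(\<integral>\<^sup>+y. ennreal (norm (f' y) * weight_phi m \<nu> y) \<partial>lborel) < \<infinity>"
    using fL by (simp add: L1_phi_def)
  note int = kern_integrable[OF f' fin \<nu> m]
  have adm: "kern_admissible (kern_density m \<nu> f')"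
    unfolding kern_admissible_def using int borel_measurable_kern_density[OF f'] by blast
  define c where "c = 1 / (4 powr \<nu> * Gamma \<nu>)"
  have rep: "poisson m \<nu> f t x = (c * t powr (2 * \<nu>)) *\<^sub>R kern_laplace (kern_density m \<nu> f') (ppoint t x)" if "t > 0" for t x
    using poisson_eq_laplace[OF f' ae f int[OF ppoint_in_domain]] that by (simp add: c_def)
  show "poisson_abs m \<nu> f t x < \<infinity>" if "t > 0" for t x
    unfolding poisson_abs_eq[OF f' ae] using kern_iterated_finite[OF f' fin _ \<nu> m, of x "t\<^sup>2" "(norm x)\<^sup>2"] that
    by (simp add: ennreal_mult_less_top)
  show "Cinfinity_on ({0<..} \<times> UNIV) (\<lambda>(t, x). poisson m \<nu> f t x)"
    unfolding Cinfinity_on_def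
  proof
    fix k
    have "open ({0<..} \<times> UNIV :: (real \<times> (real ^ 'n)) set)" by (intro open_Times) auto
    then show "Ck_on k ({0<..} \<times> UNIV) (\<lambda>(t, x). poisson m \<nu> f t x)"
      by (rule Ck_on_cong[OF _ _ poisson_Cinfinity[OF f' int, where c = c and s = "2 * \<nu>"]]) (auto simp: rep)
  qed
  show "extension_pde_at m \<nu> (poisson m \<nu> f) t x" if "t > 0" for t x
    by (rule poisson_pde[OF adm that \<nu> m rep])
  have "AE x in lborel. ((\<lambda>t. poisson m \<nu> f t x) \<longlongrightarrow> f x) (at_right 0)"
    using heat_semigroup_tendsto_AE[OF \<nu> m f f' ae fin]
  proof eventually_elim
    case (elim x)
    have "((\<lambda>t. (t powr (2 * \<nu>) / (4 powr \<nu> * Gamma \<nu>)) *\<^sub>R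
      (LINT u:{0<..}|lborel. levy_weight \<nu> t u *\<^sub>R heat_semigroup m u f x)) \<longlongrightarrow> f x) (at_right 0)"
      by (rule subordination_tendsto[OF \<nu> elim]) (rule set_integrable_subordinated_heat_semigroup[OF f' ae f int[OF ppoint_in_domain]], simp)
    moreover have "\<forall>\<^sub>F t in at_right 0. (t powr (2 * \<nu>) / (4 powr \<nu> * Gamma \<nu>)) *\<^sub>R
      (LINT u:{0<..}|lborel. levy_weight \<nu> t u *\<^sub>R heat_semigroup m u f x) = poisson m \<nu> f t x"
    proof -
      have "\<forall>\<^sub>F t in at_right 0. t > (0::real)" by (simp add: eventually_at_right_less)
      then show ?thesis
        by eventually_elim (rule poisson_eq_lborel[OF f' ae f int[OF ppoint_in_domain], symmetric], simp)
    qed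
    ultimately show ?case by (rule Lim_transform_eventually)
  qed
  then show "AE x in lebesgue. ((\<lambda>t. poisson m \<nu> f t x) \<longlongrightarrow> f x) (at_right 0)" by (rule AE_completion)
qed

theorem theorem1p1:
  fixes m \<nu> :: real
  assumes "m \<ge> - real CARD('n::finite)" and "\<nu> > 0"
  shows "(\<forall>f :: real ^ 'n \<Rightarrow> complex. f \<in> L1_phi m \<nu> \<longrightarrow>
            (\<forall>t>0. \<forall>x. poisson_abs m \<nu> f t x < \<infinity>) \<and>
            Cinfinity_on ({0<..} \<times> UNIV) (\<lambda>(t, x). poisson m \<nu> f t x) \<and>
            (\<forall>t>0. \<forall>x. extension_pde_at m \<nu> (poisson m \<nu> f) t x) \<and>
            (AE x in lebesgue. ((\<lambda>t. poisson m \<nu> f t x) \<longlongrightarrow> f x) (at_right 0))) \<and>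
         (\<forall>f :: real ^ 'n \<Rightarrow> real. f \<in> borel_measurable lebesgue \<and> (\<forall>y. f y \<ge> 0) \<and>
            (\<exists>t>0. \<exists>x. poisson_abs m \<nu> (\<lambda>y. complex_of_real (f y)) t x < \<infinity>) \<longrightarrow>
            (\<lambda>y. complex_of_real (f y)) \<in> L1_phi m \<nu>)"
proof (intro conjI allI impI)
  fix f :: "real ^ 'n \<Rightarrow> complex" assume f: "f \<in> L1_phi m \<nu>"
  note P = poisson_of_L1_phi[OF assms f]
  show "poisson_abs m \<nu> f t x < \<infinity>" if "t > 0" for t x by (rule P(1)[OF that])
  show "Cinfinity_on ({0<..} \<times> UNIV) (\<lambda>(t, x). poisson m \<nu> f t x)" by (rule P(2))
  show "extension_pde_at m \<nu> (poisson m \<nu> f) t x" if "t > 0" for t x by (rule P(3)[OF that])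
  show "AE x in lebesgue. ((\<lambda>t. poisson m \<nu> f t x) \<longlongrightarrow> f x) (at_right 0)" by (rule P(4))
next
  fix f :: "real ^ 'n \<Rightarrow> real"
  assume "f \<in> borel_measurable lebesgue \<and> (\<forall>y. f y \<ge> 0) \<and>
    (\<exists>t>0. \<exists>x. poisson_abs m \<nu> (\<lambda>y. complex_of_real (f y)) t x < \<infinity>)"
  then obtain t x where "f \<in> borel_measurable lebesgue" "t > 0" "poisson_abs m \<nu> (\<lambda>y. complex_of_real (f y)) t x < \<infinity>"
    by blast
  then show "(\<lambda>y. complex_of_real (f y)) \<in> L1_phi m \<nu>"
    by (intro L1_phi_if_poisson_abs_finite[OF _ assms(2,1)]) auto
qed

end
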